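(* Let $M$ be a compact connected Riemannian manifold, and let $D^1,\dots,D^m$ be smooth vector fields on $M$ such that $D^1_x,\dots,D^m_x$ span $T_xM$ for every $x\in M$. Let $P$ be a probability measure on $M$ with density $p>0$ with respect to the Riemannian volume measure, and suppose $p\in C^{s+1}(M)$ for some integer $s>\dim M/2$. Let $\psi:M\to\mathbb{R}^{d'}$ be a smooth embedding with $d'>\dim M$, let $\kappa\in C^{(1,1)}(\mathbb{R}^{d'})$ be a characteristic translation-invariant kernel on $\mathbb{R}^{d'}$, and let $\tilde\kappa(x,y)=\kappa(\psi(x),\psi(y))$ for $x,y\in M$. Then the kernel Stein discrepancy $\mathrm{KSD}$ defined via $\tilde\kappa$ satisfies, for any sequence of Borel probability measures $Q_n$ on $M$, $$Q_n\Rightarrow P\iff \mathrm{KSD}(P,Q_n)\to 0 .$$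
   Context: Manifolds are without boundary. Kernels are real-valued, symmetric and positive semi-definite. $C^{(1,1)}$ denotes bivariate functions that are once continuously differentiable in each argument (the mixed derivative of order $(1,1)$ exists and is continuous). A kernel $\kappa$ on $\mathbb{R}^{d'}$ is translation-invariant if $\kappa(x+z,y+z)=\kappa(x,y)$ for all $x,y,z$. A bounded kernel is characteristic if the map sending a Borel probability measure $R$ to $\int\kappa(\cdot,y)\,R(dy)\in\mathcal{H}_\kappa$ is injective. $Q_n\Rightarrow P$ means $Q_n(f)\to P(f)$ for all bounded continuous $f$, where $Q(f)=\int f\,dQ$. $\mathcal{H}_{\tilde\kappa}$ is the reproducing kernel Hilbert space of $\tilde\kappa$ on $M$, and $\mathcal{H}_{\tilde\kappa}^m$ its $m$-fold product with inner product $\langle \vec f,\vec g\rangle=\sum_{l}\langle f_l,g_l\rangle_{\mathcal{H}_{\tilde\kappa}}$. The Stein operator is $$\mathcal{T}_p\vec f=\sum_{l=1}^m \left[D^l f_l+f_l\,D^l\log p+f_l\,\mathrm{div} D^l\right],\qquad \vec f\in\mathcal{H}_{\tilde\kappa}^m,$$ and $$\mathrm{KSD}(P,Q)=\sup\{Q(\mathcal{T}_p\vec f):\vec f\in\mathcal{H}^m_{\tilde\kappa},\ \|\vec f\|_{\mathcal{H}^m_{\tilde\kappa}}\le 1\}.$$ *)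

theory Defs
  imports "HOL-Probability.Probability"
begin

section \<open>Functions of class $C^k$ on open sets\<close>

text \<open>Meant for open sets \<open>S\<close> in finite-dimensional spaces: \<open>f\<close> and all its iterated
  directional derivatives up to order \<open>k\<close> exist and are continuous on \<open>S\<close>.\<close>

primrec Ck_on :: "nat \<Rightarrow> 'v::real_normed_vector set \<Rightarrow> ('v \<Rightarrow> 'w::real_normed_vector) \<Rightarrow> bool" where
  "Ck_on 0 S f \<longleftrightarrow> continuous_on S f"
| "Ck_on (Suc k) S f \<longleftrightarrow>
     (\<forall>x\<in>S. f differentiable (at x)) \<and> (\<forall>v. Ck_on k S (\<lambda>x. frechet_derivative f (at x) v))"

definition smooth_on :: "'v::real_normed_vector set \<Rightarrow> ('v \<Rightarrow> 'w::real_normed_vector) \<Rightarrow> bool" where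
  "smooth_on S f \<longleftrightarrow> (\<forall>k. Ck_on k S f)"


section \<open>Smooth manifolds\<close>

text \<open>The manifold is the whole type \<open>'a\<close>, a second countable Hausdorff space; its dimension is
  \<open>CARD('n)\<close>. A chart is a pair of a domain and a coordinate map, whose values outside the domain
  are irrelevant. Atlases need not be maximal; the smooth structure is the one they generate.\<close>

type_synonym ('a, 'n) chart = "'a set \<times> ('a \<Rightarrow> real ^ 'n)"

definition chart_inv :: "('a, 'n) chart \<Rightarrow> real ^ 'n \<Rightarrow> 'a" where
  "chart_inv c = inv_into (fst c) (snd c)"

definition is_chart :: "('a::topological_space, 'n::finite) chart \<Rightarrow> bool" where
  "is_chart c \<longleftrightarrow> open (fst c) \<and> open (snd c ` fst c) \<and>
     homeomorphism (fst c) (snd c ` fst c) (snd c) (chart_inv c)"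

definition smooth_atlas :: "('a::{t2_space, second_countable_topology}, 'n::finite) chart set \<Rightarrow> bool" where
  "smooth_atlas A \<longleftrightarrow> (\<forall>c\<in>A. is_chart c) \<and> (\<Union>c\<in>A. fst c) = UNIV \<and>
     (\<forall>c\<in>A. \<forall>c'\<in>A. smooth_on (snd c ` (fst c \<inter> fst c')) (snd c' \<circ> chart_inv c))"

definition Ck_manifold ::
  "('a, 'n::finite) chart set \<Rightarrow> nat \<Rightarrow> ('a \<Rightarrow> 'w::real_normed_vector) \<Rightarrow> bool" where
  "Ck_manifold A k f \<longleftrightarrow> (\<forall>c\<in>A. Ck_on k (snd c ` fst c) (f \<circ> chart_inv c))"

definition smooth_embedding ::
  "('a::topological_space, 'n::finite) chart set \<Rightarrow> ('a \<Rightarrow> 'w::real_normed_vector) \<Rightarrow> bool" where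
  "smooth_embedding A \<psi> \<longleftrightarrow>
     (\<forall>k. Ck_manifold A k \<psi>) \<and>
     (\<forall>c\<in>A. \<forall>x\<in>fst c. inj (frechet_derivative (\<psi> \<circ> chart_inv c) (at (snd c x)))) \<and>
     (\<exists>h. homeomorphism UNIV (range \<psi>) \<psi> h)"


section \<open>Tangent vectors and vector fields\<close>

definition coord_change ::
  "('a, 'n::finite) chart \<Rightarrow> ('a, 'n) chart \<Rightarrow> 'a \<Rightarrow> real ^ 'n \<Rightarrow> real ^ 'n" where
  "coord_change c c' x = frechet_derivative (snd c' \<circ> chart_inv c) (at (snd c x))"

text \<open>A tangent vector at \<open>x\<close> assigns to each chart around \<open>x\<close> its coordinate vector in that
  chart, compatibly with changes of coordinates. The value 0 at all other pairs makes the
  representation unique; the vector space operations are pointwise.\<close>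

type_synonym ('a, 'n) tvec = "('a, 'n) chart \<Rightarrow> real ^ 'n"

definition tangent_space :: "('a, 'n::finite) chart set \<Rightarrow> 'a \<Rightarrow> ('a, 'n) tvec set" where
  "tangent_space A x = {v.
     (\<forall>c\<in>A. \<forall>c'\<in>A. x \<in> fst c \<inter> fst c' \<longrightarrow> v c' = coord_change c c' x (v c)) \<and>
     (\<forall>c. c \<notin> A \<or> x \<notin> fst c \<longrightarrow> v c = 0)}"

definition coord_vector ::
  "('a, 'n::finite) chart set \<Rightarrow> ('a, 'n) chart \<Rightarrow> 'n \<Rightarrow> 'a \<Rightarrow> ('a, 'n) tvec" where
  "coord_vector A c i x =
     (\<lambda>c'. if c' \<in> A \<and> x \<in> fst c' then coord_change c c' x (axis i 1) else 0)"

definition smooth_vector_field ::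
  "('a, 'n::finite) chart set \<Rightarrow> ('a \<Rightarrow> ('a, 'n) tvec) \<Rightarrow> bool" where
  "smooth_vector_field A X \<longleftrightarrow> (\<forall>x. X x \<in> tangent_space A x) \<and>
     (\<forall>c\<in>A. smooth_on (snd c ` fst c) (\<lambda>u. X (chart_inv c u) c))"

definition spans_tangent_space ::
  "('a, 'n::finite) chart set \<Rightarrow> 'a \<Rightarrow> nat set \<Rightarrow> (nat \<Rightarrow> ('a, 'n) tvec) \<Rightarrow> bool" where
  "spans_tangent_space A x I V \<longleftrightarrow>
     (\<forall>v\<in>tangent_space A x. \<exists>a :: nat \<Rightarrow> real. v = (\<lambda>c. \<Sum>l\<in>I. a l *\<^sub>R V l c))"

text \<open>Any chart around the point gives the same value of the derivative along a vector field
  (by the chain rule) and of the divergence below.\<close>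

definition chart_at :: "('a, 'n) chart set \<Rightarrow> 'a \<Rightarrow> ('a, 'n) chart" where
  "chart_at A x = (SOME c. c \<in> A \<and> x \<in> fst c)"

definition vf_deriv ::
  "('a, 'n::finite) chart set \<Rightarrow> ('a \<Rightarrow> ('a, 'n) tvec) \<Rightarrow> ('a \<Rightarrow> real) \<Rightarrow> 'a \<Rightarrow> real" where
  "vf_deriv A X f x = (let c = chart_at A x in
     frechet_derivative (f \<circ> chart_inv c) (at (snd c x)) (X x c))"


section \<open>Riemannian metrics, volume and divergence\<close>

definition metric_matrix ::
  "('a, 'n::finite) chart set \<Rightarrow> ('a \<Rightarrow> ('a, 'n) tvec \<Rightarrow> ('a, 'n) tvec \<Rightarrow> real) \<Rightarrow>
   ('a, 'n) chart \<Rightarrow> real ^ 'n \<Rightarrow> real ^ 'n ^ 'n" where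
  "metric_matrix A g c u = (let x = chart_inv c u in
     (\<chi> i j. g x (coord_vector A c i x) (coord_vector A c j x)))"

definition riemannian_metric ::
  "('a, 'n::finite) chart set \<Rightarrow> ('a \<Rightarrow> ('a, 'n) tvec \<Rightarrow> ('a, 'n) tvec \<Rightarrow> real) \<Rightarrow> bool" where
  "riemannian_metric A g \<longleftrightarrow>
     (\<forall>x. \<forall>u\<in>tangent_space A x. \<forall>v\<in>tangent_space A x. \<forall>w\<in>tangent_space A x. \<forall>r.
        g x u v = g x v u \<and>
        g x (\<lambda>c. u c + v c) w = g x u w + g x v w \<and>
        g x (\<lambda>c. r *\<^sub>R u c) w = r * g x u w \<and>
        (u \<noteq> (\<lambda>c. 0) \<longrightarrow> 0 < g x u u)) \<and>
     (\<forall>c\<in>A. smooth_on (snd c ` fst c) (metric_matrix A g c))"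

text \<open>The volume measure is the Borel measure that is $\sqrt{\det g}\,du$ in every chart;
  these conditions determine it uniquely.\<close>

definition is_riemannian_volume ::
  "('a::topological_space, 'n::finite) chart set \<Rightarrow>
   ('a \<Rightarrow> ('a, 'n) tvec \<Rightarrow> ('a, 'n) tvec \<Rightarrow> real) \<Rightarrow> 'a measure \<Rightarrow> bool" where
  "is_riemannian_volume A g vol \<longleftrightarrow> sets vol = sets borel \<and>
     (\<forall>c\<in>A. \<forall>B\<in>sets borel. B \<subseteq> fst c \<longrightarrow>
        emeasure vol B =
          (\<integral>\<^sup>+u\<in>snd c ` B. ennreal (sqrt (det (metric_matrix A g c u))) \<partial>lborel))"

text \<open>In local coordinates,
  $\mathrm{div}\,X = (\det g)^{-1/2} \sum_i \partial_i(\sqrt{\det g}\,X^i)$.\<close>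

definition divergence ::
  "('a, 'n::finite) chart set \<Rightarrow> ('a \<Rightarrow> ('a, 'n) tvec \<Rightarrow> ('a, 'n) tvec \<Rightarrow> real) \<Rightarrow>
   ('a \<Rightarrow> ('a, 'n) tvec) \<Rightarrow> 'a \<Rightarrow> real" where
  "divergence A g X x = (let c = chart_at A x in
     (\<Sum>i\<in>UNIV. frechet_derivative
         (\<lambda>u. sqrt (det (metric_matrix A g c u)) * X (chart_inv c u) c $ i)
         (at (snd c x)) (axis i 1))
     / sqrt (det (metric_matrix A g c (snd c x))))"


section \<open>Kernels\<close>

definition psd_kernel :: "('a \<Rightarrow> 'a \<Rightarrow> real) \<Rightarrow> bool" where
  "psd_kernel K \<longleftrightarrow> (\<forall>x y. K x y = K y x) \<and>
     (\<forall>F (a :: 'a \<Rightarrow> real). finite F \<longrightarrow> 0 \<le> (\<Sum>x\<in>F. \<Sum>y\<in>F. a x * a y * K x y))"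

definition deriv_fst ::
  "'v::real_normed_vector \<Rightarrow> ('v \<Rightarrow> 'v \<Rightarrow> real) \<Rightarrow> 'v \<Rightarrow> 'v \<Rightarrow> real" where
  "deriv_fst v K x y = frechet_derivative (\<lambda>x'. K x' y) (at x) v"

definition deriv_snd ::
  "'v::real_normed_vector \<Rightarrow> ('v \<Rightarrow> 'v \<Rightarrow> real) \<Rightarrow> 'v \<Rightarrow> 'v \<Rightarrow> real" where
  "deriv_snd v K x y = frechet_derivative (\<lambda>y'. K x y') (at y) v"

definition C11 :: "('v::real_normed_vector \<Rightarrow> 'v \<Rightarrow> real) \<Rightarrow> bool" where
  "C11 K \<longleftrightarrow>
     (\<forall>x y. (\<lambda>x'. K x' y) differentiable (at x)) \<and>
     (\<forall>x y. (\<lambda>y'. K x y') differentiable (at y)) \<and>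
     (\<forall>v x y. (\<lambda>y'. deriv_fst v K x y') differentiable (at y)) \<and>
     continuous_on UNIV (\<lambda>(x, y). K x y) \<and>
     (\<forall>v. continuous_on UNIV (\<lambda>(x, y). deriv_fst v K x y)) \<and>
     (\<forall>v. continuous_on UNIV (\<lambda>(x, y). deriv_snd v K x y)) \<and>
     (\<forall>v w. continuous_on UNIV (\<lambda>(x, y). deriv_snd w (deriv_fst v K) x y))"

definition translation_invariant :: "('v::real_vector \<Rightarrow> 'v \<Rightarrow> real) \<Rightarrow> bool" where
  "translation_invariant K \<longleftrightarrow> (\<forall>x y z. K (x + z) (y + z) = K x y)"

text \<open>Point evaluation is continuous on the reproducing kernel Hilbert space of \<open>K\<close>, so the kernel
  mean embedding of \<open>R\<close> is the function \<open>\<lambda>x. \<integral>y. K x y \<partial>R\<close>.\<close>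

definition characteristic_kernel :: "('v::topological_space \<Rightarrow> 'v \<Rightarrow> real) \<Rightarrow> bool" where
  "characteristic_kernel K \<longleftrightarrow> bounded (range (\<lambda>(x, y). K x y)) \<and>
     inj_on (\<lambda>R x. \<integral>y. K x y \<partial>R) {R. prob_space R \<and> sets R = sets borel}"

text \<open>\<open>(H, ip)\<close> is the reproducing kernel Hilbert space of \<open>K\<close>: a Hilbert space of functions
  with the reproducing property. For positive semi-definite \<open>K\<close> it exists, and \<open>H\<close> and the
  restriction of \<open>ip\<close> to \<open>H\<close> are unique (Moore--Aronszajn).\<close>

definition is_rkhs ::
  "('a \<Rightarrow> 'a \<Rightarrow> real) \<Rightarrow> ('a \<Rightarrow> real) set \<Rightarrow> (('a \<Rightarrow> real) \<Rightarrow> ('a \<Rightarrow> real) \<Rightarrow> real) \<Rightarrow> bool" where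
  "is_rkhs K H ip \<longleftrightarrow>
     (\<lambda>x. 0) \<in> H \<and>
     (\<forall>f\<in>H. \<forall>h\<in>H. (\<lambda>x. f x + h x) \<in> H) \<and>
     (\<forall>f\<in>H. \<forall>r. (\<lambda>x. r * f x) \<in> H) \<and>
     (\<forall>f\<in>H. \<forall>h\<in>H. ip f h = ip h f) \<and>
     (\<forall>f\<in>H. \<forall>h\<in>H. \<forall>k\<in>H. ip (\<lambda>x. f x + h x) k = ip f k + ip h k) \<and>
     (\<forall>f\<in>H. \<forall>h\<in>H. \<forall>r. ip (\<lambda>x. r * f x) h = r * ip f h) \<and>
     (\<forall>f\<in>H. f \<noteq> (\<lambda>x. 0) \<longrightarrow> 0 < ip f f) \<and>
     (\<forall>F :: nat \<Rightarrow> 'a \<Rightarrow> real.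
        (\<forall>n. F n \<in> H) \<and>
        (\<forall>e>0. \<exists>N. \<forall>i\<ge>N. \<forall>j\<ge>N.
           sqrt (ip (\<lambda>x. F i x - F j x) (\<lambda>x. F i x - F j x)) < e) \<longrightarrow>
        (\<exists>f\<in>H. (\<lambda>n. sqrt (ip (\<lambda>x. F n x - f x) (\<lambda>x. F n x - f x))) \<longlonglongrightarrow> 0)) \<and>
     (\<forall>x. (\<lambda>y. K y x) \<in> H) \<and>
     (\<forall>f\<in>H. \<forall>x. ip f (\<lambda>y. K y x) = f x)"


section \<open>Kernel Stein discrepancy and weak convergence\<close>

definition stein_operator ::
  "('a, 'n::finite) chart set \<Rightarrow> ('a \<Rightarrow> ('a, 'n) tvec \<Rightarrow> ('a, 'n) tvec \<Rightarrow> real) \<Rightarrow>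
   nat \<Rightarrow> (nat \<Rightarrow> 'a \<Rightarrow> ('a, 'n) tvec) \<Rightarrow> ('a \<Rightarrow> real) \<Rightarrow> (nat \<Rightarrow> 'a \<Rightarrow> real) \<Rightarrow> 'a \<Rightarrow> real" where
  "stein_operator A g m D p f x =
     (\<Sum>l=1..m. vf_deriv A (D l) (f l) x
              + f l x * vf_deriv A (D l) (\<lambda>y. ln (p y)) x
              + f l x * divergence A g (D l) x)"

text \<open>The supremum is taken in \<open>ereal\<close>, where it always exists. The target measure enters only
  through its density \<open>p\<close>.\<close>

definition KSD ::
  "('a, 'n::finite) chart set \<Rightarrow> ('a \<Rightarrow> ('a, 'n) tvec \<Rightarrow> ('a, 'n) tvec \<Rightarrow> real) \<Rightarrow>
   nat \<Rightarrow> (nat \<Rightarrow> 'a \<Rightarrow> ('a, 'n) tvec) \<Rightarrow>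
   ('a \<Rightarrow> real) set \<Rightarrow> (('a \<Rightarrow> real) \<Rightarrow> ('a \<Rightarrow> real) \<Rightarrow> real) \<Rightarrow>
   ('a \<Rightarrow> real) \<Rightarrow> 'a measure \<Rightarrow> ereal" where
  "KSD A g m D H ip p Q =
     (SUP f \<in> {f. (\<forall>l\<in>{1..m}. f l \<in> H) \<and> sqrt (\<Sum>l=1..m. ip (f l) (f l)) \<le> 1}.
        ereal (\<integral>x. stein_operator A g m D p f x \<partial>Q))"

definition converges_weakly :: "(nat \<Rightarrow> 'a::topological_space measure) \<Rightarrow> 'a measure \<Rightarrow> bool" where
  "converges_weakly Q P \<longleftrightarrow>
     (\<forall>f :: 'a \<Rightarrow> real. continuous_on UNIV f \<and> bounded (range f) \<longrightarrow>
        (\<lambda>n. \<integral>x. f x \<partial>Q n) \<longlonglongrightarrow> (\<integral>x. f x \<partial>P))"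

end

theory Submission
  imports Defs
begin

text \<open>If \<open>Q\<^sub>n\<close> converges weakly to \<open>P\<close>, the Stein identity \<open>P(T f) = 0\<close> (divergence theorem, localised by a
  partition of unity) and the equicontinuity of the functions \<open>T f\<close> over the unit ball give
  \<open>KSD \<longlonglongrightarrow> 0\<close>.

  Conversely, let \<open>\<Lambda>\<close> be a cluster point of the functionals \<open>Q\<^sub>n\<close> on continuous functions; positive
  functionals replace limit measures, so neither Prokhorov's nor Riesz' theorem is needed. For each
  field \<open>D\<close> the distribution \<open>\<ell> = \<Lambda> \<circ> T\<^sub>D\<close>, pushed to the ambient space by \<open>\<psi>\<close>, has kernel energy
  \<open>\<ell>\<^sub>x \<ell>\<^sub>y \<kappa> = 0\<close>, so by positive semi-definiteness \<open>\<ell>\<^sub>x \<kappa>(x, z) = 0\<close> for all \<open>z\<close> of the ambient space.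
  Convolving with a test function turns \<open>\<ell>\<close> into a signed measure with the same property, which the
  characteristic kernel forces to vanish; hence \<open>\<ell> = 0\<close> on all test functions, without Bochner's
  theorem. Since the fields span, \<open>\<Lambda>\<close> divided by the density of \<open>P\<close> kills all derivatives in every
  chart, so \<open>\<Lambda>\<close> is locally, and by connectedness globally, a multiple of \<open>P\<close>.\<close>

section \<open>Continuously differentiable functions\<close>

text \<open>The discrepancy tests \<ell> only on kernel sections at points of \<psi>(M), whereas
  translation invariance and the characteristic property speak about the whole ambient space.
  Positivity bridges this gap: the energy of \<ell> + t \<delta>_z is nonnegative for every real t
  and has constant term 0, so its linear coefficient must vanish. A second gap is that \<ell> has
  order one, while a characteristic kernel separates probability measures only. Convolution removes
  the derivative, and subtracting a far translate removes the total mass, after which positive and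
  negative part normalise to probability measures. The kernel is of class C^(1,1), so its Hilbert
  space consists of C1 functions; this is why C1 is the regularity used throughout, for cutoffs and
  test functions as well. Functionals on continuous functions offer no dominated convergence. Double
  functionals, Fubini and uniformity over the unit ball all come from one device instead: a
  partition of unity that replaces an equicontinuous family by finite sums.\<close>

definition C1_on :: "'v::real_normed_vector set \<Rightarrow> ('v \<Rightarrow> 'w::real_normed_vector) \<Rightarrow> bool" where
  "C1_on S f \<longleftrightarrow> (\<forall>x\<in>S. f differentiable (at x)) \<and>
     (\<forall>v. continuous_on S (\<lambda>x. frechet_derivative f (at x) v))"

lemma C1_onI:
  assumes "\<And>x. x \<in> S \<Longrightarrow> (f has_derivative f' x) (at x)"
    and "\<And>v. continuous_on S (\<lambda>x. f' x v)"
  shows "C1_on S f"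
  unfolding C1_on_def
proof (intro conjI ballI allI)
  fix x assume "x \<in> S" then show "f differentiable (at x)" using assms(1) differentiable_def by blast
next
  fix v
  have "frechet_derivative f (at x) = f' x" if "x \<in> S" for x
    using assms(1)[OF that] frechet_derivative_at by metis
  then show "continuous_on S (\<lambda>x. frechet_derivative f (at x) v)"
    using assms(2)[of v] by (simp cong: continuous_on_cong)
qed

lemma C1_on_has_derivative:
  "C1_on S f \<Longrightarrow> x \<in> S \<Longrightarrow> (f has_derivative frechet_derivative f (at x)) (at x)"
  unfolding C1_on_def using frechet_derivative_works by blast

lemma C1_on_continuous_derivative:
  "C1_on S f \<Longrightarrow> continuous_on S (\<lambda>x. frechet_derivative f (at x) v)"
  unfolding C1_on_def by blast

lemma C1_on_imp_continuous_on: "C1_on S f \<Longrightarrow> continuous_on S f"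
  by (meson C1_on_has_derivative continuous_at_imp_continuous_on has_derivative_continuous)

lemma C1_on_subset: "C1_on S f \<Longrightarrow> T \<subseteq> S \<Longrightarrow> C1_on T f"
  unfolding C1_on_def by (meson continuous_on_subset subsetD)

lemma C1_on_Un:
  assumes "open S" "open T" "C1_on S f" "C1_on T f" shows "C1_on (S \<union> T) f"
  using assms unfolding C1_on_def by (auto intro: continuous_on_open_Un)

lemma C1_on_cong:
  assumes "open S" "\<And>x. x \<in> S \<Longrightarrow> f x = g x" "C1_on S f" shows "C1_on S g"
proof (rule C1_onI)
  fix x assume "x \<in> S"
  then show "(g has_derivative frechet_derivative f (at x)) (at x)"
    using assms by (meson C1_on_has_derivative has_derivative_transform_within_open)
qed (use assms(3) C1_on_def in blast)

text \<open>The derivative is defined by choice, so the predicates it chooses from are shown to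
  coincide; this also covers points where neither function is differentiable.\<close>

lemma frechet_derivative_cong_open:
  assumes "open S" "x \<in> S" "\<And>y. y \<in> S \<Longrightarrow> f y = g y"
  shows "frechet_derivative f (at x) = frechet_derivative g (at x)"
proof -
  have "(f has_derivative f') (at x) \<longleftrightarrow> (g has_derivative f') (at x)" for f'
    using assms has_derivative_transform_within_open[of f f' x UNIV S g]
      has_derivative_transform_within_open[of g f' x UNIV S f] by auto
  then show ?thesis unfolding frechet_derivative_def by simp
qed

lemma linear_expand:
  fixes f :: "'v::euclidean_space \<Rightarrow> 'w::real_normed_vector"
  assumes "linear f" shows "f v = (\<Sum>b\<in>Basis. (v \<bullet> b) *\<^sub>R f b)"
proof -
  have "f v = f (\<Sum>b\<in>Basis. (v \<bullet> b) *\<^sub>R b)" by (simp add: euclidean_representation)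
  also have "\<dots> = (\<Sum>b\<in>Basis. f ((v \<bullet> b) *\<^sub>R b))" using assms by (rule linear_sum)
  finally show ?thesis using assms by (simp add: linear_cmul)
qed

text \<open>\<open>C1_on\<close> asks for continuity of the derivative one direction at a time;
  expanding the direction in a basis recovers continuity jointly in point and direction.\<close>

lemma C1_on_joint_continuous:
  fixes f :: "'v::euclidean_space \<Rightarrow> 'w::real_normed_vector"
  assumes f: "C1_on S f" and h: "continuous_on T h" "h ` T \<subseteq> S" and v: "continuous_on T v"
  shows "continuous_on T (\<lambda>t. frechet_derivative f (at (h t)) (v t))"
proof -
  have "frechet_derivative f (at (h t)) (v t) =
      (\<Sum>b\<in>Basis. (v t \<bullet> b) *\<^sub>R frechet_derivative f (at (h t)) b)" if "t \<in> T" for t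
    by (rule linear_expand) (use C1_on_has_derivative[OF f] that h(2) has_derivative_linear in blast)
  moreover have "continuous_on T (\<lambda>t. \<Sum>b\<in>Basis. (v t \<bullet> b) *\<^sub>R frechet_derivative f (at (h t)) b)"
    by (intro continuous_intros v continuous_on_compose2[OF C1_on_continuous_derivative[OF f] h])
  ultimately show ?thesis by (simp cong: continuous_on_cong)
qed

lemma C1_on_const [simp, intro]: "C1_on S (\<lambda>x. c)"
  by (rule C1_onI[where f' = "\<lambda>_ _. 0"]) auto

lemma C1_on_bounded_linear: "bounded_linear f \<Longrightarrow> C1_on S f"
  by (rule C1_onI[where f' = "\<lambda>_. f"]) (auto intro: bounded_linear_imp_has_derivative)

lemma C1_on_add:
  assumes "C1_on S f" "C1_on S g" shows "C1_on S (\<lambda>x. f x + g x)"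
  by (rule C1_onI[where f' = "\<lambda>x v. frechet_derivative f (at x) v + frechet_derivative g (at x) v"])
    (auto intro!: derivative_eq_intros continuous_intros C1_on_has_derivative assms C1_on_continuous_derivative)

lemma C1_on_mult:
  fixes f g :: "'v::real_normed_vector \<Rightarrow> real"
  assumes "C1_on S f" "C1_on S g" shows "C1_on S (\<lambda>x. f x * g x)"
  by (rule C1_onI[where f' = "\<lambda>x v. f x * frechet_derivative g (at x) v + frechet_derivative f (at x) v * g x"])
    (auto intro!: derivative_eq_intros continuous_intros C1_on_has_derivative assms C1_on_continuous_derivative
       C1_on_imp_continuous_on[OF assms(1)] C1_on_imp_continuous_on[OF assms(2)])

lemma C1_on_sum:
  assumes "\<And>i. i \<in> I \<Longrightarrow> C1_on S (f i)" shows "C1_on S (\<lambda>x. \<Sum>i\<in>I. f i x)"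
  using assms by (induction I rule: infinite_finite_induct) (auto intro: C1_on_add)

lemma C1_on_prod:
  fixes f :: "'i \<Rightarrow> 'v::real_normed_vector \<Rightarrow> real"
  assumes "\<And>i. i \<in> I \<Longrightarrow> C1_on S (f i)" shows "C1_on S (\<lambda>x. \<Prod>i\<in>I. f i x)"
  using assms by (induction I rule: infinite_finite_induct) (auto intro: C1_on_mult)

lemma C1_on_compose:
  fixes f :: "'u::real_normed_vector \<Rightarrow> 'v::euclidean_space" and g :: "'v \<Rightarrow> 'w::real_normed_vector"
  assumes g: "C1_on T g" and f: "C1_on S f" and "f ` S \<subseteq> T"
  shows "C1_on S (\<lambda>x. g (f x))"
proof (rule C1_onI[where f' = "\<lambda>x v. frechet_derivative g (at (f x)) (frechet_derivative f (at x) v)"])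
  fix x assume "x \<in> S"
  then show "((\<lambda>x. g (f x)) has_derivative
      (\<lambda>v. frechet_derivative g (at (f x)) (frechet_derivative f (at x) v))) (at x)"
    using assms by (intro has_derivative_compose[of f _ x UNIV g]) (auto intro!: C1_on_has_derivative)
qed (intro C1_on_joint_continuous[OF g] C1_on_imp_continuous_on[OF f] C1_on_continuous_derivative[OF f] assms)

lemma C1_on_real:
  fixes f :: "real \<Rightarrow> real"
  assumes "\<And>x. x \<in> S \<Longrightarrow> (f has_real_derivative f' x) (at x)" "continuous_on S f'"
  shows "C1_on S f"
  by (rule C1_onI[where f' = "\<lambda>x v. f' x * v"])
    (auto intro!: continuous_intros assms simp: assms(1)[unfolded has_field_derivative_def])

lemma C1_on_inverse:
  fixes f :: "'v::real_normed_vector \<Rightarrow> real"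
  assumes "C1_on S f" "\<And>x. x \<in> S \<Longrightarrow> f x \<noteq> 0" shows "C1_on S (\<lambda>x. inverse (f x))"
proof (rule C1_on_compose[OF _ assms(1)])
  show "C1_on (-{0}) (inverse :: real \<Rightarrow> real)"
    by (rule C1_on_real[where f' = "\<lambda>x. - (inverse x ^ Suc (Suc 0))"])
      (simp add: DERIV_inverse del: power_Suc, intro continuous_intros, auto)
qed (use assms(2) in auto)

lemma C1_on_divide:
  fixes f :: "'v::real_normed_vector \<Rightarrow> real"
  assumes "C1_on S f" "C1_on S g" "\<And>x. x \<in> S \<Longrightarrow> g x \<noteq> 0" shows "C1_on S (\<lambda>x. f x / g x)"
  unfolding divide_inverse by (intro C1_on_mult C1_on_inverse assms)

lemma C1_on_sqrt:
  fixes f :: "'v::real_normed_vector \<Rightarrow> real"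
  assumes "C1_on S f" "\<And>x. x \<in> S \<Longrightarrow> 0 < f x" shows "C1_on S (\<lambda>x. sqrt (f x))"
proof (rule C1_on_compose[OF _ assms(1)])
  show "C1_on {0<..} sqrt"
    by (rule C1_on_real[where f' = "\<lambda>x. inverse (sqrt x) / 2"])
      (auto intro!: continuous_intros DERIV_real_sqrt)
qed (use assms(2) in auto)

lemma C1_on_ln:
  fixes f :: "'v::real_normed_vector \<Rightarrow> real"
  assumes "C1_on S f" "\<And>x. x \<in> S \<Longrightarrow> 0 < f x" shows "C1_on S (\<lambda>x. ln (f x))"
proof (rule C1_on_compose[OF _ assms(1)])
  show "C1_on {0<..} (ln :: real \<Rightarrow> real)"
    by (rule C1_on_real[where f' = "\<lambda>x. 1 / x"])
      (auto intro!: continuous_intros DERIV_ln_divide)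
qed (use assms(2) in auto)

lemma C1_on_bounded_linear_compose:
  fixes f :: "'u::real_normed_vector \<Rightarrow> 'v::euclidean_space"
  assumes "bounded_linear g" "C1_on S f" shows "C1_on S (\<lambda>x. g (f x))"
  by (rule C1_on_compose[OF C1_on_bounded_linear[OF assms(1), of UNIV] assms(2)]) auto

lemma C1_on_vec_nth:
  fixes f :: "'u::real_normed_vector \<Rightarrow> real ^ 'n"
  assumes "C1_on S f" shows "C1_on S (\<lambda>x. f x $ i)"
  by (rule C1_on_bounded_linear_compose[OF _ assms]) (simp add: bounded_linear_vec_nth)

lemma C1_on_mat_nth:
  fixes f :: "'u::real_normed_vector \<Rightarrow> real ^ 'n ^ 'k"
  assumes "C1_on S f" shows "C1_on S (\<lambda>x. f x $ i $ j)"
  by (rule C1_on_bounded_linear_compose[OF _ assms])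
    (intro bounded_linear_compose[OF bounded_linear_vec_nth bounded_linear_vec_nth])

lemma C1_on_det:
  fixes M :: "'u::real_normed_vector \<Rightarrow> real ^ 'n ^ 'n"
  assumes "\<And>i j. C1_on S (\<lambda>x. M x $ i $ j)" shows "C1_on S (\<lambda>x. det (M x))"
  unfolding det_def by (intro C1_on_sum C1_on_mult C1_on_const C1_on_prod assms)

lemma C1_on_vec:
  fixes f :: "'u::real_normed_vector \<Rightarrow> real ^ 'n"
  assumes "\<And>i. C1_on S (\<lambda>x. f x $ i)" shows "C1_on S f"
proof (rule C1_onI[where f' = "\<lambda>x v. \<chi> i. frechet_derivative (\<lambda>x. f x $ i) (at x) v"])
  fix x assume x: "x \<in> S"
  have "((\<lambda>x. f x $ i) has_derivative frechet_derivative (\<lambda>x. f x $ i) (at x)) (at x)" for i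
    using assms x by (rule C1_on_has_derivative)
  then show "(f has_derivative (\<lambda>v. \<chi> i. frechet_derivative (\<lambda>x. f x $ i) (at x) v)) (at x)"
    by (subst has_derivative_componentwise_within) (auto simp: Basis_vec_def inner_axis)
qed (intro continuous_on_vec_lambda C1_on_continuous_derivative assms)

lemma Ck_on_imp_continuous_on: "Ck_on k S f \<Longrightarrow> continuous_on S f"
  by (cases k) (auto intro!: continuous_at_imp_continuous_on differentiable_imp_continuous_within)

lemma Ck_on_Suc_imp_C1_on: "Ck_on (Suc k) S f \<Longrightarrow> C1_on S f"
  unfolding C1_on_def by (auto intro: Ck_on_imp_continuous_on)

lemma smooth_on_imp_C1_on: "smooth_on S f \<Longrightarrow> C1_on S f"
  unfolding smooth_on_def using Ck_on_Suc_imp_C1_on by blast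

section \<open>Extension by zero, differentiability from lines, and cutoffs\<close>

text \<open>The open sets \<open>S\<close> and \<open>-K\<close> cover the space, and the extension
  is C1 on each. Functions built in a chart, or near a point of the ambient space, become global in
  this way.\<close>

lemma C1_on_extend_zero:
  assumes S: "open S" and f: "C1_on S f" and K: "closed K" "K \<subseteq> S" "\<And>x. x \<in> S - K \<Longrightarrow> f x = 0"
  shows "C1_on UNIV (\<lambda>x. if x \<in> S then f x else 0)"
proof -
  have "C1_on S (\<lambda>x. if x \<in> S then f x else 0)"
    by (rule C1_on_cong[OF S _ f]) auto
  moreover have "C1_on (-K) (\<lambda>x. if x \<in> S then f x else 0)"
    by (rule C1_on_cong[of _ "\<lambda>_. 0"]) (use K in auto)
  ultimately have "C1_on (S \<union> -K) (\<lambda>x. if x \<in> S then f x else 0)"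
    using S K(1) by (intro C1_on_Un) auto
  moreover have "S \<union> -K = UNIV" using K by auto
  ultimately show ?thesis by simp
qed

text \<open>Elements of the Hilbert space are first known to be differentiable only along lines in a
  chart. The mean value theorem on the segment from \<open>x\<close> to \<open>y\<close>, with
  continuity in the finitely many basis directions, upgrades this to a Frechet derivative.\<close>

lemma gateaux_C1_imp_has_derivative:
  fixes f :: "'v::euclidean_space \<Rightarrow> real"
  assumes S: "open S" "x \<in> S"
    and d: "\<And>y h. y \<in> S \<Longrightarrow> ((\<lambda>t. f (y + t *\<^sub>R h)) has_real_derivative g y h) (at 0)"
    and lin: "\<And>y. y \<in> S \<Longrightarrow> linear (g y)"
    and cont: "\<And>h. continuous_on S (\<lambda>y. g y h)"
  shows "(f has_derivative g x) (at x)"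
  unfolding has_derivative_within_alt
proof (intro conjI allI impI)
  show "bounded_linear (g x)" using lin[OF S(2)] linear_conv_bounded_linear by blast
  fix e :: real assume e: "0 < e"
  \<comment> \<open>The budget \<open>e\<close> is shared among the basis directions, because every
    coordinate of \<open>h\<close> is bounded by \<open>norm h\<close>.\<close>
  define e' where "e' = e / DIM('v)"
  have e': "e' > 0" using e by (simp add: e'_def)
  have "\<exists>d>0. \<forall>y. norm (y - x) < d \<longrightarrow> y \<in> S \<and> \<bar>g y b - g x b\<bar> < e'" if "b \<in> Basis" for b
  proof -
    have "continuous (at x) (\<lambda>y. g y b)" using cont S continuous_on_eq_continuous_at by blast
    then obtain d1 where "d1 > 0" "\<forall>y. dist y x < d1 \<longrightarrow> dist (g y b) (g x b) < e'"
      using e' unfolding continuous_at_eps_delta by blast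
    moreover obtain d2 where "d2 > 0" "ball x d2 \<subseteq> S" using S open_contains_ball by blast
    ultimately show ?thesis
      by (intro exI[of _ "min d1 d2"]) (auto simp: dist_norm norm_minus_commute subset_iff)
  qed
  then obtain dd where dd: "\<And>b. b \<in> Basis \<Longrightarrow> dd b > 0 \<and>
      (\<forall>y. norm (y - x) < dd b \<longrightarrow> y \<in> S \<and> \<bar>g y b - g x b\<bar> < e')" by metis
  define d0 where "d0 = Min (dd ` Basis)"
  have d0: "d0 > 0" unfolding d0_def using dd by (subst Min_gr_iff) auto
  have d0le: "d0 \<le> dd b" if "b \<in> Basis" for b unfolding d0_def using that by auto
  have near: "y \<in> S" "\<And>b. b \<in> Basis \<Longrightarrow> \<bar>g y b - g x b\<bar> < e'" if "norm (y - x) < d0" for y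
    using dd d0le that nonempty_Basis by (meson all_not_in_conv less_le_trans)+
  show "\<exists>d>0. \<forall>y\<in>UNIV. norm (y - x) < d \<longrightarrow> norm (f y - f x - g x (y - x)) \<le> e * norm (y - x)"
  proof (intro exI[of _ d0] conjI d0 ballI impI)
    fix y assume y: "norm (y - x) < d0"
    define h where "h = y - x"
    define \<phi> where "\<phi> t = f (x + t *\<^sub>R h)" for t :: real
    have nr: "norm (x + t *\<^sub>R h - x) < d0" if "0 \<le> t" "t \<le> 1" for t
      using y that mult_right_mono[of t 1 "norm h"] by (simp add: h_def)
    have D: "(\<phi> has_real_derivative g (x + t *\<^sub>R h) h) (at t)" if t: "0 \<le> t" "t \<le> 1" for t
    proof -
      have "((\<lambda>s. f ((x + t *\<^sub>R h) + s *\<^sub>R h)) has_real_derivative g (x + t *\<^sub>R h) h) (at (t - t))"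
        using d[OF near(1)[OF nr[OF t]]] by simp
      from DERIV_chain2[OF this DERIV_diff[OF DERIV_ident DERIV_const]]
      have "((\<lambda>s. f ((x + t *\<^sub>R h) + (s - t) *\<^sub>R h)) has_real_derivative g (x + t *\<^sub>R h) h) (at t)"
        by simp
      then show ?thesis by (simp add: \<phi>_def[abs_def] algebra_simps)
    qed
    have "\<exists>z. z > 0 \<and> z < 1 \<and> \<phi> 1 - \<phi> 0 = (1 - 0) * g (x + z *\<^sub>R h) h"
      by (rule MVT2) (use D in auto)
    then obtain z where z: "0 < z" "z < 1" "\<phi> 1 - \<phi> 0 = g (x + z *\<^sub>R h) h" by auto
    let ?w = "x + z *\<^sub>R h"
    have w: "norm (?w - x) < d0" using nr z by auto
    have "f y - f x - g x h = g ?w h - g x h" using z(3) by (simp add: \<phi>_def h_def)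
    also have "\<dots> = (\<Sum>b\<in>Basis. (h \<bullet> b) * (g ?w b - g x b))"
      using linear_expand[OF lin[OF near(1)[OF w]], of h] linear_expand[OF lin[OF S(2)], of h]
      by (simp add: sum_subtractf right_diff_distrib)
    finally have "norm (f y - f x - g x h) \<le> (\<Sum>b\<in>Basis. \<bar>(h \<bullet> b) * (g ?w b - g x b)\<bar>)" by simp
    also have "\<dots> \<le> (\<Sum>b\<in>(Basis::'v set). norm h * e')"
    proof (rule sum_mono)
      fix b :: 'v assume b: "b \<in> Basis"
      then show "\<bar>(h \<bullet> b) * (g ?w b - g x b)\<bar> \<le> norm h * e'"
        unfolding abs_mult using near(2)[OF w b] Basis_le_norm[OF b, of h] by (intro mult_mono) auto
    qed
    also have "\<dots> = e * norm h" by (simp add: e'_def)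
    finally show "norm (f y - f x - g x (y - x)) \<le> e * norm (y - x)" by (simp add: h_def)
  qed
qed

text \<open>The square makes the truncation at the sphere of radius \<open>r\<close> once
  continuously differentiable, matching the C1 regularity of all test functions.\<close>

definition bump :: "real \<Rightarrow> 'v::euclidean_space \<Rightarrow> real" where
  "bump r z = (max 0 (r\<^sup>2 - z \<bullet> z))\<^sup>2"

lemma C1_on_bump: "C1_on S (bump r)"
proof -
  have 1: "((\<lambda>s::real. (max 0 s)\<^sup>2) has_real_derivative 2 * max 0 s) (at s)" for s
  proof (cases "s = 0")
    case False
    have "((\<lambda>s::real. (max 0 s)\<^sup>2) has_real_derivative 2 * max 0 s) (at s)" if "s > 0"
      by (rule has_field_derivative_transform_within_open[where f = "\<lambda>s. s\<^sup>2" and S = "{0<..}"])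
        (use that in \<open>auto intro!: derivative_eq_intros\<close>)
    moreover have "((\<lambda>s::real. (max 0 s)\<^sup>2) has_real_derivative 2 * max 0 s) (at s)" if "s < 0"
      by (rule has_field_derivative_transform_within_open[where f = "\<lambda>s. 0" and S = "{..<0}"])
        (use that in \<open>auto intro!: derivative_eq_intros\<close>)
    ultimately show ?thesis using False by fastforce
  next
    case True
    \<comment> \<open>At the kink the difference quotient is dominated by the modulus of its
      argument.\<close>
    have "(\<lambda>y::real. (max 0 y)\<^sup>2 / y) \<midarrow>0\<rightarrow> 0"
    proof (rule Lim_null_comparison[where g = "\<lambda>y. \<bar>y\<bar>"])
      show "\<forall>\<^sub>F x::real in at 0. norm ((max 0 x)\<^sup>2 / x) \<le> \<bar>x\<bar>"
        by (rule always_eventually) (auto simp: max_def power2_eq_square)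
      show "abs \<midarrow>0\<rightarrow> (0::real)" using tendsto_rabs[OF tendsto_ident_at, of "0::real" UNIV] by simp
    qed
    then show ?thesis unfolding True has_field_derivative_iff by simp
  qed
  have 2: "C1_on UNIV (\<lambda>s::real. (max 0 s)\<^sup>2)"
    by (rule C1_on_real[OF 1]) (intro continuous_intros)
  have 3: "C1_on S (\<lambda>z::'a. r\<^sup>2 - z \<bullet> z)"
    by (rule C1_onI[where f' = "\<lambda>z v. - (z \<bullet> v + v \<bullet> z)"])
      (auto intro!: derivative_eq_intros continuous_intros)
  show ?thesis unfolding bump_def[abs_def] by (rule C1_on_compose[OF 2 3]) auto
qed

lemma bump_nonneg [simp]: "0 \<le> bump r z" by (simp add: bump_def)

lemma bump_pos_iff: "r > 0 \<Longrightarrow> 0 < bump r z \<longleftrightarrow> norm z < r"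
  by (auto simp: bump_def norm_lt_square max_def)

lemma bump_zero_iff: "r > 0 \<Longrightarrow> bump r z = 0 \<longleftrightarrow> norm z \<ge> r"
  using bump_pos_iff[of r z] bump_nonneg[of r z] by linarith

section \<open>Integrals of compactly supported functions\<close>

lemma integrable_compact_support:
  fixes f :: "'v::euclidean_space \<Rightarrow> real"
  assumes "continuous_on UNIV f" "compact K" "\<And>x. x \<notin> K \<Longrightarrow> f x = 0"
  shows "integrable lborel f"
proof -
  have "integrable lborel (\<lambda>x. indicator K x *\<^sub>R f x)"
    using assms by (intro borel_integrable_compact) (auto intro: continuous_on_subset)
  moreover have "(\<lambda>x. indicator K x *\<^sub>R f x) = f" by (intro ext) (use assms(3) in \<open>auto simp: indicator_def\<close>)
  ultimately show ?thesis by simp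
qed

lemma frechet_derivative_zero_outside:
  assumes "closed K" "\<And>x. x \<notin> K \<Longrightarrow> f x = 0" "x \<notin> K"
  shows "frechet_derivative f (at x) v = 0"
proof -
  have "frechet_derivative f (at x) = frechet_derivative (\<lambda>_. 0) (at x)"
    by (rule frechet_derivative_cong_open[of "-K"]) (use assms in auto)
  then show ?thesis by simp
qed

lemma C1_on_line_derivative:
  assumes "C1_on S f" "x + t *\<^sub>R v \<in> S"
  shows "((\<lambda>t. f (x + t *\<^sub>R v)) has_vector_derivative frechet_derivative f (at (x + t *\<^sub>R v)) v) (at t)"
proof -
  let ?D = "frechet_derivative f (at (x + t *\<^sub>R v))"
  have "((\<lambda>t. x + t *\<^sub>R v) has_derivative (\<lambda>s. s *\<^sub>R v)) (at t)"
    by (auto intro!: derivative_eq_intros)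
  from has_derivative_compose[OF this C1_on_has_derivative[OF assms]]
  have "((\<lambda>t. f (x + t *\<^sub>R v)) has_derivative (\<lambda>s. ?D (s *\<^sub>R v))) (at t)" .
  moreover have "?D (s *\<^sub>R v) = s *\<^sub>R ?D v" for s
    using C1_on_has_derivative[OF assms] has_derivative_linear linear_cmul by blast
  ultimately show ?thesis unfolding has_vector_derivative_def by simp
qed

lemma C1_on_line_real_derivative:
  fixes f :: "'v::real_normed_vector \<Rightarrow> real"
  assumes "C1_on S f" "x + t *\<^sub>R v \<in> S"
  shows "((\<lambda>t. f (x + t *\<^sub>R v)) has_real_derivative frechet_derivative f (at (x + t *\<^sub>R v)) v) (at t)"
  using C1_on_line_derivative[OF assms] by (simp add: has_real_derivative_iff_has_vector_derivative)

lemma integral_translate: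
  fixes f :: "'v::euclidean_space \<Rightarrow> real"
  assumes "f \<in> borel_measurable borel"
  shows "(\<integral>x. f (c + x) \<partial>lborel) = (\<integral>x. f x \<partial>lborel)"
  using assms by (subst (2) lborel_distr_plus[of c, symmetric]) (subst integral_distr, auto)

lemma integral_reflect:
  fixes f :: "'v::euclidean_space \<Rightarrow> real"
  assumes "f \<in> borel_measurable borel"
  shows "(\<integral>x. f (c - x) \<partial>lborel) = (\<integral>x. f x \<partial>lborel)"
proof -
  have "lborel = distr lborel borel (\<lambda>x::'v. c - x)"
    using lborel_affine[of "-1" c] by (simp add: density_1)
  then have "(\<integral>x. f x \<partial>lborel) = (\<integral>x. f x \<partial>distr lborel borel (\<lambda>x. c - x))" by simp
  also have "\<dots> = (\<integral>x. f (c - x) \<partial>lborel)" using assms by (subst integral_distr) auto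
  finally show ?thesis by simp
qed

text \<open>Translation invariance of Lebesgue measure makes the integral of every difference
  quotient zero, and dominated convergence passes to the derivative.\<close>

lemma integral_frechet_derivative_zero:
  fixes G :: "'v::euclidean_space \<Rightarrow> real"
  assumes G: "C1_on UNIV G" and K: "compact K" "\<And>x. x \<notin> K \<Longrightarrow> G x = 0"
  shows "(\<integral>x. frechet_derivative G (at x) v \<partial>lborel) = 0"
proof -
  define D where "D x = frechet_derivative G (at x) v" for x
  have Dc: "continuous_on UNIV D" unfolding D_def by (rule C1_on_continuous_derivative[OF G])
  have Gc: "continuous_on UNIV G" by (rule C1_on_imp_continuous_on[OF G])
  have D0: "D x = 0" if "x \<notin> K" for x
    unfolding D_def using K that compact_imp_closed by (intro frechet_derivative_zero_outside[of K]) auto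
  have "bounded (D ` K)" using Dc K(1) by (meson compact_continuous_image compact_imp_bounded continuous_on_subset subset_UNIV)
  then obtain C where C: "\<And>x. x \<in> K \<Longrightarrow> \<bar>D x\<bar> \<le> C" "C > 0" unfolding bounded_pos by auto
  have C': "\<bar>D x\<bar> \<le> C" for x using C D0[of x] by (cases "x \<in> K") auto
  \<comment> \<open>By the mean value theorem the quotient at \<open>x\<close> is a derivative at
    some \<open>x + z *\<^sub>R v\<close> with \<open>z\<close> between 0 and 1, so it can be
    nonzero only for \<open>x\<close> in this compact set, the support of the dominating
    function.\<close>
  define K' where "K' = (\<lambda>(k, s::real). k - s *\<^sub>R v) ` (K \<times> {0..1})"
  have K': "compact K'" unfolding K'_def
    by (intro compact_continuous_image compact_Times K(1)) (auto simp: case_prod_beta intro!: continuous_intros)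
  define t where "t n = inverse (real (Suc n))" for n
  have t: "0 < t n" "t n \<le> 1" for n unfolding t_def by (auto simp: field_simps)
  have line: "((\<lambda>s. G (x + s *\<^sub>R v)) has_real_derivative D (x + s *\<^sub>R v)) (at s)" for x s
    unfolding D_def by (rule C1_on_line_real_derivative[OF G]) simp
  define q where "q n x = (G (t n *\<^sub>R v + x) - G x) / t n" for n x
  have qM: "\<exists>z. 0 < z \<and> z < t n \<and> q n x = D (x + z *\<^sub>R v)" for n x
  proof -
    have "\<exists>z. z > 0 \<and> z < t n \<and> G (x + t n *\<^sub>R v) - G (x + 0 *\<^sub>R v) = (t n - 0) * D (x + z *\<^sub>R v)"
      by (rule MVT2[OF t(1)]) (rule line)
    then obtain z where "0 < z" "z < t n" "G (x + t n *\<^sub>R v) - G x = t n * D (x + z *\<^sub>R v)" by auto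
    then show ?thesis using t(1)[of n] by (intro exI[of _ z]) (simp add: q_def add.commute)
  qed
  have qb: "norm (q n x) \<le> indicator K' x * C" for n x
  proof -
    obtain z where z: "0 < z" "z < t n" "q n x = D (x + z *\<^sub>R v)" using qM by blast
    show ?thesis
    proof (cases "x + z *\<^sub>R v \<in> K")
      case True
      then have "x \<in> K'" unfolding K'_def using z(1,2) t(2)[of n]
        by (intro image_eqI[of _ _ "(x + z *\<^sub>R v, z)"]) auto
      then show ?thesis using C'[of "x + z *\<^sub>R v"] z(3) by simp
    next
      case False then show ?thesis using D0 z(3) C(2) by simp
    qed
  qed
  have Gi: "integrable lborel G" by (rule integrable_compact_support[OF Gc K])
  have Gti: "integrable lborel (\<lambda>x. G (t n *\<^sub>R v + x))" for n
  proof (rule integrable_compact_support)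
    show "compact ((\<lambda>x. - (t n *\<^sub>R v) + x) ` K)" using K(1) by (rule compact_translation)
    show "G (t n *\<^sub>R v + x) = 0" if "x \<notin> (\<lambda>x. - (t n *\<^sub>R v) + x) ` K" for x
    proof (rule K(2), rule notI)
      assume "t n *\<^sub>R v + x \<in> K"
      then have "- (t n *\<^sub>R v) + (t n *\<^sub>R v + x) \<in> (\<lambda>x. - (t n *\<^sub>R v) + x) ` K" by blast
      then show False using that by simp
    qed
  qed (intro continuous_on_compose2[OF Gc] continuous_intros, simp)
  have q0: "(\<integral>x. q n x \<partial>lborel) = 0" for n
    unfolding q_def using Gi Gti integral_translate[of G "t n *\<^sub>R v"] borel_measurable_continuous_onI[OF Gc] by simp
  have "(\<lambda>n. \<integral>x. q n x \<partial>lborel) \<longlonglongrightarrow> (\<integral>x. D x \<partial>lborel)"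
  proof (rule integral_dominated_convergence[where w = "\<lambda>x. indicator K' x * C"])
    have "integrable lborel (\<lambda>x. indicator K' x *\<^sub>R C)"
      by (rule borel_integrable_compact[OF K']) simp
    then show "integrable lborel (\<lambda>x. indicator K' x * C)" by simp
    show "D \<in> borel_measurable lborel" using borel_measurable_continuous_onI[OF Dc] by simp
    show "q n \<in> borel_measurable lborel" for n unfolding q_def[abs_def] using Gi Gti by measurable
    show "AE x in lborel. (\<lambda>n. q n x) \<longlonglongrightarrow> D x"
    proof (rule AE_I2)
      fix x
      have "(\<lambda>s. (G (x + s *\<^sub>R v) - G (x + 0 *\<^sub>R v)) / (s - 0)) \<midarrow>0\<rightarrow> D (x + 0 *\<^sub>R v)"
        using line[of x 0] unfolding has_field_derivative_iff by simp
      moreover have "filterlim t (at 0) sequentially"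
      proof -
        have "t \<longlonglongrightarrow> 0" unfolding t_def[abs_def] by (rule LIMSEQ_inverse_real_of_nat)
        then show ?thesis using t(1) by (auto simp: filterlim_at intro!: always_eventually less_imp_neq[symmetric])
      qed
      ultimately have "(\<lambda>n. (G (x + t n *\<^sub>R v) - G (x + 0 *\<^sub>R v)) / (t n - 0)) \<longlonglongrightarrow> D (x + 0 *\<^sub>R v)"
        by (rule filterlim_compose)
      then show "(\<lambda>n. q n x) \<longlonglongrightarrow> D x" by (simp add: q_def add.commute)
    qed
  qed (use qb in auto)
  then have "(\<integral>x. D x \<partial>lborel) = 0" by (simp add: q0 LIMSEQ_const_iff)
  then show ?thesis by (simp add: D_def)
qed

section \<open>Mean functionals on a compact embedded space\<close>

locale compact_embedding =
  fixes \<psi> :: "'a::t2_space \<Rightarrow> 'e::euclidean_space"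
  assumes compact_space: "compact (UNIV :: 'a set)"
    and \<psi>_cont: "continuous_on UNIV \<psi>" and \<psi>_inj: "inj \<psi>"
begin

text \<open>The image of the compact complement of \<open>N\<close> is closed and misses
  \<open>\<psi> x\<close> by injectivity, so it keeps a positive distance. Preimages of closed
  ambient balls thus form a neighbourhood basis, and cutoffs on the space can be ambient bumps
  composed with \<open>\<psi>\<close>.\<close>

lemma embedding_nbhd:
  assumes "open N" "x \<in> N"
  obtains r where "r > 0" "\<And>y. norm (\<psi> y - \<psi> x) \<le> r \<Longrightarrow> y \<in> N"
proof -
  have "compact (- N)" using assms(1) compact_space
    by (metis Compl_eq_Diff_UNIV compact_diff)
  then have "closed (\<psi> ` (- N))"
    by (meson \<psi>_cont compact_continuous_image compact_imp_closed continuous_on_subset subset_UNIV)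
  moreover have "\<psi> x \<notin> \<psi> ` (- N)" using assms(2) \<psi>_inj by (auto dest: injD)
  ultimately obtain r where r: "r > 0" "ball (\<psi> x) r \<subseteq> - \<psi> ` (- N)"
    by (meson Compl_iff open_Compl openE)
  show ?thesis
  \<comment> \<open>Halving the radius passes from the open ball to a closed one, so that supports
    of bumps are closed subsets of \<open>N\<close>.\<close>
  proof (rule that[of "r/2"])
    fix y assume "norm (\<psi> y - \<psi> x) \<le> r/2"
    then have "\<psi> y \<in> ball (\<psi> x) r" using r(1) by (simp add: dist_norm norm_minus_commute)
    then show "y \<in> N" using r(2) by auto
  qed (use r in auto)
qed

text \<open>Ambient bumps around the points \<open>\<psi> x\<close>, normalised by their sum. Each
  \<open>\<theta> x\<close> is recorded as a C1 function near the range composed with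
  \<open>\<psi>\<close>, so that its regularity in every chart can be read off once charts are
  present.\<close>

lemma C1_partition_of_unity:
  assumes N: "\<And>x. open (N x)" "\<And>x. x \<in> N x"
  obtains X :: "'a set" and \<theta> :: "'a \<Rightarrow> 'a \<Rightarrow> real"
  where "finite X" "\<And>x. x \<in> X \<Longrightarrow> \<exists>W F. open W \<and> range \<psi> \<subseteq> W \<and> C1_on W F \<and> \<theta> x = (\<lambda>y. F (\<psi> y))"
    "\<And>x y. 0 \<le> \<theta> x y" "\<And>y. (\<Sum>x\<in>X. \<theta> x y) = 1"
    "\<And>x. x \<in> X \<Longrightarrow> \<exists>K. closed K \<and> K \<subseteq> N x \<and> (\<forall>y. y \<notin> K \<longrightarrow> \<theta> x y = 0)"
proof -
  have "\<forall>x. \<exists>r>0. \<forall>y. norm (\<psi> y - \<psi> x) \<le> r \<longrightarrow> y \<in> N x" using embedding_nbhd[OF N] by metis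
  then obtain r where r: "\<And>x. r x > 0" "\<And>x y. norm (\<psi> y - \<psi> x) \<le> r x \<Longrightarrow> y \<in> N x" by metis
  define U where "U x = {y. norm (\<psi> y - \<psi> x) < r x}" for x
  have U: "open (U x)" for x unfolding U_def
    by (intro open_Collect_less continuous_intros \<psi>_cont)
  have "x \<in> U x" for x using r(1) by (simp add: U_def)
  then obtain X where X: "finite X" "UNIV \<subseteq> (\<Union>x\<in>X. U x)"
    using compactE_image[OF compact_space, of UNIV U] U by (metis UNIV_I UN_I subsetI)
  define S where "S z = (\<Sum>x\<in>X. bump (r x) (z - \<psi> x))" for z
  define F where "F x z = bump (r x) (z - \<psi> x) / S z" for x z
  \<comment> \<open>The quotients are C1 only where \<open>S\<close> is positive; the covering
    property puts the range of \<open>\<psi>\<close> there.\<close>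
  define W where "W = {z. 0 < S z}"
  have b: "C1_on T (\<lambda>z. bump (r x) (z - \<psi> x))" for x T
  proof (rule C1_on_compose[OF C1_on_bump[of UNIV]])
    show "C1_on T (\<lambda>z. z - \<psi> x)" using C1_on_add[OF C1_on_bounded_linear[OF bounded_linear_ident] C1_on_const[of T "- \<psi> x"]] by simp
  qed auto
  have SC: "C1_on T S" for T unfolding S_def[abs_def] by (intro C1_on_sum b)
  have W: "open W" unfolding W_def
    using C1_on_imp_continuous_on[OF SC[of UNIV]] by (intro open_Collect_less continuous_intros) auto
  have Spos: "S (\<psi> y) > 0" for y
  proof -
    obtain x where x: "x \<in> X" "y \<in> U x" using X by blast
    then have "0 < bump (r x) (\<psi> y - \<psi> x)" using r(1) by (simp add: bump_pos_iff U_def)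
    then show ?thesis unfolding S_def using x(1) X(1) by (intro sum_pos2) auto
  qed
  define \<theta> where "\<theta> x y = F x (\<psi> y)" for x y
  show ?thesis
  proof (rule that[of X \<theta>])
    show "\<exists>W F. open W \<and> range \<psi> \<subseteq> W \<and> C1_on W F \<and> \<theta> x = (\<lambda>y. F (\<psi> y))" for x
    proof (intro exI[of _ W] exI[of _ "F x"] conjI W)
      show "C1_on W (F x)" unfolding F_def[abs_def] by (intro C1_on_divide b SC) (simp add: W_def)
    qed (use Spos in \<open>auto simp: W_def \<theta>_def\<close>)
    show "0 \<le> \<theta> x y" for x y using Spos[of y] by (simp add: \<theta>_def F_def)
    show "(\<Sum>x\<in>X. \<theta> x y) = 1" for y
      using Spos[of y] by (simp add: \<theta>_def F_def sum_divide_distrib[symmetric] S_def)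
    show "\<exists>K. closed K \<and> K \<subseteq> N x \<and> (\<forall>y. y \<notin> K \<longrightarrow> \<theta> x y = 0)" for x
    proof (intro exI[of _ "{y. norm (\<psi> y - \<psi> x) \<le> r x}"] conjI)
      show "closed {y. norm (\<psi> y - \<psi> x) \<le> r x}" by (intro closed_Collect_le continuous_intros \<psi>_cont)
      show "\<forall>y. y \<notin> {y. norm (\<psi> y - \<psi> x) \<le> r x} \<longrightarrow> \<theta> x y = 0"
        using r(1)[of x] by (auto simp: \<theta>_def F_def bump_zero_iff)
    qed (use r(2) in auto)
  qed (rule X(1))
qed

text \<open>One partition of unity serves all \<open>v\<close> in \<open>V\<close>, because the
  neighbourhoods do not depend on \<open>v\<close>. To a mean functional, \<open>F y v\<close> then
  looks like a Riemann sum with the coefficients \<open>F x v\<close>.\<close>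

lemma equicontinuous_approx:
  fixes F :: "'a \<Rightarrow> 'v \<Rightarrow> real"
  assumes equi: "\<And>x. \<exists>N. open N \<and> x \<in> N \<and> (\<forall>y\<in>N. \<forall>v\<in>V. \<bar>F y v - F x v\<bar> \<le> e)"
  obtains X :: "'a set" and \<theta> :: "'a \<Rightarrow> 'a \<Rightarrow> real"
  where "finite X" "\<And>x. x \<in> X \<Longrightarrow> continuous_on UNIV (\<theta> x)" "\<And>x y. 0 \<le> \<theta> x y" "\<And>y. (\<Sum>x\<in>X. \<theta> x y) = 1"
    "\<And>y v. v \<in> V \<Longrightarrow> \<bar>F y v - (\<Sum>x\<in>X. \<theta> x y * F x v)\<bar> \<le> e"
proof -
  obtain N where N: "\<And>x. open (N x)" "\<And>x. x \<in> N x" "\<And>x y v. y \<in> N x \<Longrightarrow> v \<in> V \<Longrightarrow> \<bar>F y v - F x v\<bar> \<le> e"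
    using equi by metis
  obtain X \<theta> where X: "finite X"
    and C: "\<And>x. x \<in> X \<Longrightarrow> \<exists>W F. open W \<and> range \<psi> \<subseteq> W \<and> C1_on W F \<and> \<theta> x = (\<lambda>y. F (\<psi> y))"
    and nn: "\<And>x y. 0 \<le> \<theta> x y" and one: "\<And>y. (\<Sum>x\<in>X. \<theta> x y) = 1"
    and K: "\<And>x. x \<in> X \<Longrightarrow> \<exists>K. closed K \<and> K \<subseteq> N x \<and> (\<forall>y. y \<notin> K \<longrightarrow> \<theta> x y = (0::real))"
    by (rule C1_partition_of_unity[OF N(1,2)]) (rule that; assumption)
  show ?thesis
  proof (rule that[of X \<theta>])
    show "continuous_on UNIV (\<theta> x)" if x: "x \<in> X" for x
    proof -
      obtain W F where WF: "range \<psi> \<subseteq> W" "C1_on W F" and eq: "\<theta> x = (\<lambda>y. F (\<psi> y))" using C[OF x] by blast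
      show ?thesis unfolding eq
        by (rule continuous_on_compose2[OF C1_on_imp_continuous_on[OF WF(2)] \<psi>_cont WF(1)])
    qed
    fix y v assume v: "v \<in> V"
    have "F y v - (\<Sum>x\<in>X. \<theta> x y * F x v) = (\<Sum>x\<in>X. \<theta> x y * (F y v - F x v))"
      by (simp add: right_diff_distrib sum_subtractf sum_distrib_right[symmetric] one)
    also have "\<bar>\<dots>\<bar> \<le> (\<Sum>x\<in>X. \<theta> x y * e)"
    proof (rule order_trans[OF sum_abs sum_mono])
      fix x assume x: "x \<in> X"
      show "\<bar>\<theta> x y * (F y v - F x v)\<bar> \<le> \<theta> x y * e"
      proof (cases "y \<in> N x")
        case True then show ?thesis using N(3)[OF True v] nn[of x y] by (simp add: abs_mult mult_left_mono)
      next
        case False then have "\<theta> x y = 0" using K[OF x] by auto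
        then show ?thesis by simp
      qed
    qed
    also have "\<dots> = e" by (simp add: sum_distrib_right[symmetric] one)
    finally show "\<bar>F y v - (\<Sum>x\<in>X. \<theta> x y * F x v)\<bar> \<le> e" .
  qed (use X nn one in auto)
qed

end

section \<open>Positive normalised functionals in the role of probability measures\<close>

lemma tube_nbhd:
  fixes F :: "'a::topological_space \<Rightarrow> 'b::topological_space \<Rightarrow> real"
  assumes "continuous_on (S \<times> C) (\<lambda>(x, v). F x v)" "open S" "compact C" "x \<in> S" "e > 0"
  shows "\<exists>N. open N \<and> x \<in> N \<and> N \<subseteq> S \<and> (\<forall>y\<in>N. \<forall>v\<in>C. \<bar>F y v - F x v\<bar> \<le> e)"
proof -
  obtain X0 where "x \<in> X0" "open X0" "\<forall>y\<in>X0 \<inter> S. \<forall>t\<in>C. dist (case (y, t) of (x, v) \<Rightarrow> F x v) (case (x, t) of (x, v) \<Rightarrow> F x v) \<le> e"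
    using continuous_on_prod_compactE[OF assms(1,3,4,5)] by metis
  then show ?thesis using assms(2,4) by (intro exI[of _ "X0 \<inter> S"]) (auto simp: dist_real_def)
qed

lemma continuous_on_slice:
  assumes "continuous_on (S \<times> T) (\<lambda>(x, v). F x v)" "x \<in> S"
  shows "continuous_on T (F x)"
proof -
  have "continuous_on T (\<lambda>v. (x, v))" by (intro continuous_intros)
  from continuous_on_compose2[OF assms(1) this] show ?thesis using assms(2) by auto
qed

lemma continuous_on_swap_args:
  assumes "continuous_on (S \<times> T) (\<lambda>(x, v). F x v)"
  shows "continuous_on (T \<times> S) (\<lambda>(v, x). F x v)"
proof -
  have "continuous_on (T \<times> S) (\<lambda>z. (\<lambda>(x, v). F x v) (snd z, fst z))"
    by (rule continuous_on_compose2[OF assms]) (auto intro!: continuous_intros)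
  then show ?thesis by (simp add: case_prod_beta)
qed

text \<open>The axioms speak of continuous functions only, because a cluster point of the
  functionals \<open>Q n\<close> is controlled only there; hence the continuity assumptions in all
  rules below.\<close>

locale mean_functional = compact_embedding \<psi> for \<psi> :: "'a::t2_space \<Rightarrow> 'e::euclidean_space" +
  fixes \<Lambda> :: "('a \<Rightarrow> real) \<Rightarrow> real"
  assumes add: "continuous_on UNIV f \<Longrightarrow> continuous_on UNIV g \<Longrightarrow> \<Lambda> (\<lambda>x. f x + g x) = \<Lambda> f + \<Lambda> g"
    and scale: "continuous_on UNIV f \<Longrightarrow> \<Lambda> (\<lambda>x. c * f x) = c * \<Lambda> f"
    and nonneg: "continuous_on UNIV f \<Longrightarrow> (\<And>x. 0 \<le> f x) \<Longrightarrow> 0 \<le> \<Lambda> f"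
    and one: "\<Lambda> (\<lambda>x. 1) = 1"
begin

lemma const: "\<Lambda> (\<lambda>x. c) = c"
  using scale[of "\<lambda>_. 1" c] one by simp

lemma diff: "continuous_on UNIV f \<Longrightarrow> continuous_on UNIV g \<Longrightarrow> \<Lambda> (\<lambda>x. f x - g x) = \<Lambda> f - \<Lambda> g"
  using add[of f "\<lambda>x. (-1) * g x"] scale[of g "-1"] by (simp add: continuous_on_minus)

lemma sum: "(\<And>i. i \<in> I \<Longrightarrow> continuous_on UNIV (f i)) \<Longrightarrow> \<Lambda> (\<lambda>x. \<Sum>i\<in>I. f i x) = (\<Sum>i\<in>I. \<Lambda> (f i))"
  by (induction I rule: infinite_finite_induct) (simp_all add: const add continuous_on_sum)

lemma mono: "continuous_on UNIV f \<Longrightarrow> continuous_on UNIV g \<Longrightarrow> (\<And>x. f x \<le> g x) \<Longrightarrow> \<Lambda> f \<le> \<Lambda> g"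
  using nonneg[of "\<lambda>x. g x - f x"] diff[of g f] by (simp add: continuous_on_diff)

lemma abs_le:
  assumes "continuous_on UNIV f" "\<And>x. \<bar>f x\<bar> \<le> e" shows "\<bar>\<Lambda> f\<bar> \<le> e"
proof -
  have "\<Lambda> f \<le> \<Lambda> (\<lambda>_. e)" "\<Lambda> (\<lambda>_. - e) \<le> \<Lambda> f"
    using assms by (auto intro!: mono simp: abs_le_iff) (meson minus_le_iff)
  then show ?thesis by (simp add: const abs_le_iff)
qed

lemma abs_diff_le:
  assumes "continuous_on UNIV f" "continuous_on UNIV g" "\<And>x. \<bar>f x - g x\<bar> \<le> e"
  shows "\<bar>\<Lambda> f - \<Lambda> g\<bar> \<le> e"
  using abs_le[of "\<lambda>x. f x - g x" e] diff assms by (simp add: continuous_on_diff)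

lemma continuous_param:
  fixes F :: "'v::t2_space \<Rightarrow> 'a \<Rightarrow> real"
  assumes F: "continuous_on (S \<times> UNIV) (\<lambda>(v, x). F v x)" and S: "open S"
  shows "continuous_on S (\<lambda>v. \<Lambda> (F v))"
proof -
  have "\<exists>N. open N \<and> v \<in> N \<and> (\<forall>w\<in>N. \<bar>\<Lambda> (F w) - \<Lambda> (F v)\<bar> < e)" if v: "v \<in> S" "0 < e" for v e
  proof -
    obtain N where N: "open N" "v \<in> N" "N \<subseteq> S" "\<forall>w\<in>N. \<forall>x\<in>UNIV. \<bar>F w x - F v x\<bar> \<le> e / 2"
      using tube_nbhd[OF F S compact_space v(1), of "e/2"] v(2) by auto
    have "\<bar>\<Lambda> (F w) - \<Lambda> (F v)\<bar> \<le> e / 2" if "w \<in> N" for w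
      using N that \<open>v \<in> S\<close> by (intro abs_diff_le continuous_on_slice[OF F]) auto
    then show ?thesis using N \<open>0 < e\<close> by (intro exI[of _ N]) fastforce
  qed
  then have "isCont (\<lambda>v. \<Lambda> (F v)) v" if "v \<in> S" for v
    using that unfolding continuous_at tendsto_iff eventually_at_topological dist_real_def by (meson)
  then show ?thesis by (simp add: continuous_at_imp_continuous_on)
qed

text \<open>Differentiation under the functional: the mean value theorem bounds the linearisation
  error by \<open>\<bar>s - t\<bar> * (e / 2)\<close>, and compactness makes this uniform in
  \<open>x\<close>, the part that domination plays for measures.\<close>

lemma deriv_param:
  fixes F :: "real \<Rightarrow> 'a \<Rightarrow> real"
  assumes T: "open T" "t \<in> T"
    and D: "\<And>s x. s \<in> T \<Longrightarrow> ((\<lambda>s. F s x) has_real_derivative F' s x) (at s)"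
    and F': "continuous_on (T \<times> UNIV) (\<lambda>(s, x). F' s x)"
    and Fc: "\<And>s. s \<in> T \<Longrightarrow> continuous_on UNIV (F s)"
  shows "((\<lambda>s. \<Lambda> (F s)) has_real_derivative \<Lambda> (F' t)) (at t)"
  unfolding has_field_derivative_iff LIM_def
proof (intro allI impI)
  fix e :: real assume e: "0 < e"
  obtain N where N: "open N" "t \<in> N" "N \<subseteq> T" "\<forall>w\<in>N. \<forall>x\<in>UNIV. \<bar>F' w x - F' t x\<bar> \<le> e / 2"
    using tube_nbhd[OF F' T(1) compact_space T(2), of "e/2"] e by auto
  then obtain d where d: "d > 0" "ball t d \<subseteq> N" by (meson openE)
  have F't: "continuous_on UNIV (F' t)" by (rule continuous_on_slice[OF F' T(2)])
  show "\<exists>d>0. \<forall>s. s \<noteq> t \<and> dist s t < d \<longrightarrow> dist ((\<Lambda> (F s) - \<Lambda> (F t)) / (s - t)) (\<Lambda> (F' t)) < e"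
  proof (intro exI[of _ d] conjI d(1) allI impI)
    fix s assume s: "s \<noteq> t \<and> dist s t < d"
    then have sN: "s \<in> N" using d by (auto simp: dist_commute)
    have seg: "z \<in> N" if "min s t \<le> z" "z \<le> max s t" for z
    proof -
      have "dist t z < d" using that s by (auto simp: dist_real_def)
      then show ?thesis using d by auto
    qed
    have "\<bar>F s x - F t x - (s - t) * F' t x\<bar> \<le> \<bar>s - t\<bar> * (e / 2)" for x
    proof -
      have "\<exists>z. z > min s t \<and> z < max s t \<and> F (max s t) x - F (min s t) x = (max s t - min s t) * F' z x"
        by (rule MVT2) (use s seg N(3) D in \<open>auto simp: min_def max_def\<close>)
      then obtain z where z: "min s t < z" "z < max s t" "F s x - F t x = (s - t) * F' z x"
        by (auto simp: min_def max_def algebra_simps split: if_splits)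
      then have "\<bar>F s x - F t x - (s - t) * F' t x\<bar> = \<bar>s - t\<bar> * \<bar>F' z x - F' t x\<bar>"
        by (simp add: right_diff_distrib[symmetric] abs_mult)
      also have "\<dots> \<le> \<bar>s - t\<bar> * (e / 2)" using seg[of z] z N(4) by (intro mult_left_mono) auto
      finally show ?thesis .
    qed
    then have "\<bar>\<Lambda> (\<lambda>x. F s x - F t x - (s - t) * F' t x)\<bar> \<le> \<bar>s - t\<bar> * (e / 2)"
      using sN N T by (intro abs_le continuous_intros Fc F't) auto
    also have "\<Lambda> (\<lambda>x. F s x - F t x - (s - t) * F' t x) = \<Lambda> (F s) - \<Lambda> (F t) - (s - t) * \<Lambda> (F' t)"
      using sN N T by (subst diff; (subst diff)?; (subst scale)?) (auto intro!: continuous_intros Fc F't)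
    finally have *: "\<bar>\<Lambda> (F s) - \<Lambda> (F t) - (s - t) * \<Lambda> (F' t)\<bar> \<le> \<bar>s - t\<bar> * (e / 2)" .
    have "(\<Lambda> (F s) - \<Lambda> (F t)) / (s - t) - \<Lambda> (F' t) = (\<Lambda> (F s) - \<Lambda> (F t) - (s - t) * \<Lambda> (F' t)) / (s - t)"
      using s by (simp add: diff_divide_distrib)
    also have "\<bar>\<dots>\<bar> \<le> e / 2" using * s by (simp add: abs_divide divide_le_eq mult.commute)
    finally show "dist ((\<Lambda> (F s) - \<Lambda> (F t)) / (s - t)) (\<Lambda> (F' t)) < e" using e by (simp add: dist_real_def)
  qed
qed

text \<open>For combinations of point masses this is the definition of positive semi-definiteness.
  Up to small errors \<open>\<Lambda>\<close> acts on \<open>G\<close> like such a combination, with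
  weights \<open>\<Lambda> (\<theta> i)\<close> at the points \<open>i\<close> of a partition of
  unity.\<close>

lemma psd_nonneg:
  fixes G :: "'a \<Rightarrow> 'a \<Rightarrow> real"
  assumes G: "continuous_on UNIV (\<lambda>(x, y). G x y)" and psd: "psd_kernel G"
  shows "0 \<le> \<Lambda> (\<lambda>y. \<Lambda> (\<lambda>x. G x y))"
proof (rule field_le_epsilon[of 0])
  fix e :: real assume e: "0 < e"
  have G': "continuous_on (UNIV \<times> UNIV) (\<lambda>(x, y). G x y)" using G by simp
  have sym: "G x y = G y x" for x y using psd by (simp add: psd_kernel_def)
  have "\<exists>N. open N \<and> x \<in> N \<and> (\<forall>y\<in>N. \<forall>v\<in>UNIV. \<bar>G y v - G x v\<bar> \<le> e / 2)" for x
    using tube_nbhd[OF G' open_UNIV compact_space UNIV_I, of "e/2" x] e by auto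
  note nbh = this
  obtain X \<theta> where X: "finite X" and c: "\<And>x. x \<in> X \<Longrightarrow> continuous_on UNIV (\<theta> x)" and nn: "\<And>x y. 0 \<le> \<theta> x y"
    and s1: "\<And>y. (\<Sum>x\<in>X. \<theta> x y) = 1" and app: "\<And>y v. v \<in> UNIV \<Longrightarrow> \<bar>G y v - (\<Sum>x\<in>X. \<theta> x y * G x v)\<bar> \<le> e / 2"
    by (rule equicontinuous_approx[of UNIV G "e/2"]) (rule nbh | rule that; assumption)+
  have sl: "continuous_on UNIV (G x)" for x by (rule continuous_on_slice[OF G']) simp
  have sl': "continuous_on UNIV (\<lambda>x. G x y)" for y using sl[of y] sym by (simp cong: continuous_on_cong)
  have q1: "(\<Sum>x\<in>X. \<Lambda> (\<theta> x)) = 1" using sum[of X \<theta>] c s1 one by simp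
  \<comment> \<open>The estimate is used twice, under the outer functional and at the points
    \<open>i\<close>; the weights are nonnegative with sum 1, so each use costs
    \<open>e / 2\<close>.\<close>
  have a1: "\<bar>\<Lambda> (\<lambda>x. G x y) - (\<Sum>i\<in>X. \<Lambda> (\<theta> i) * G i y)\<bar> \<le> e / 2" for y
  proof -
    have "\<Lambda> (\<lambda>x. \<Sum>i\<in>X. \<theta> i x * G i y) = (\<Sum>i\<in>X. \<Lambda> (\<theta> i) * G i y)"
      using c by (subst sum) (auto intro!: continuous_intros sum.cong simp: scale mult.commute[of "\<theta> _ _"] mult.commute[of _ "G _ _"])
    moreover have "\<bar>\<Lambda> (\<lambda>x. G x y) - \<Lambda> (\<lambda>x. \<Sum>i\<in>X. \<theta> i x * G i y)\<bar> \<le> e / 2"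
      by (intro abs_diff_le sl' app[OF UNIV_I] continuous_intros c)
    ultimately show ?thesis by simp
  qed
  have cc: "continuous_on UNIV (\<lambda>y. \<Lambda> (\<lambda>x. G x y))"
    by (rule continuous_param) (use continuous_on_swap_args[OF G'] in auto)
  have "\<bar>\<Lambda> (\<lambda>y. \<Lambda> (\<lambda>x. G x y)) - \<Lambda> (\<lambda>y. \<Sum>i\<in>X. \<Lambda> (\<theta> i) * G i y)\<bar> \<le> e / 2"
    by (intro abs_diff_le a1 cc continuous_intros sl)
  moreover have "\<Lambda> (\<lambda>y. \<Sum>i\<in>X. \<Lambda> (\<theta> i) * G i y) = (\<Sum>i\<in>X. \<Lambda> (\<theta> i) * \<Lambda> (G i))"
    by (subst sum) (auto intro!: continuous_intros sl simp: scale[OF sl])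
  moreover have "\<bar>(\<Sum>i\<in>X. \<Lambda> (\<theta> i) * \<Lambda> (G i)) - (\<Sum>i\<in>X. \<Lambda> (\<theta> i) * (\<Sum>j\<in>X. \<Lambda> (\<theta> j) * G i j))\<bar> \<le> e / 2"
  proof -
    have "\<bar>\<Lambda> (\<theta> i) * (\<Lambda> (G i) - (\<Sum>j\<in>X. \<Lambda> (\<theta> j) * G i j))\<bar> \<le> \<Lambda> (\<theta> i) * (e / 2)" if "i \<in> X" for i
    proof -
      have "\<bar>\<Lambda> (G i) - (\<Sum>j\<in>X. \<Lambda> (\<theta> j) * G i j)\<bar> \<le> e / 2"
      proof -
        have "(\<lambda>x. G x i) = G i" by (rule ext) (rule sym)
        moreover have "(\<Sum>j\<in>X. \<Lambda> (\<theta> j) * G j i) = (\<Sum>j\<in>X. \<Lambda> (\<theta> j) * G i j)"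
          by (rule sum.cong) (auto intro: sym)
        ultimately show ?thesis using a1[of i] by simp
      qed
      then show ?thesis using nonneg[OF c[OF that] nn] by (simp only: abs_mult abs_of_nonneg mult_left_mono)
    qed
    then have "\<bar>\<Sum>i\<in>X. \<Lambda> (\<theta> i) * (\<Lambda> (G i) - (\<Sum>j\<in>X. \<Lambda> (\<theta> j) * G i j))\<bar> \<le> (\<Sum>i\<in>X. \<Lambda> (\<theta> i) * (e / 2))"
      by (intro order_trans[OF sum_abs sum_mono]) auto
    then show ?thesis by (simp only: sum_distrib_right[symmetric] q1 right_diff_distrib sum_subtractf)
  qed
  moreover have "0 \<le> (\<Sum>i\<in>X. \<Lambda> (\<theta> i) * (\<Sum>j\<in>X. \<Lambda> (\<theta> j) * G i j))"
    using psd X unfolding psd_kernel_def by (simp add: sum_distrib_left mult.assoc)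
  ultimately show "0 \<le> \<Lambda> (\<lambda>y. \<Lambda> (\<lambda>x. G x y)) + e" by linarith
qed

text \<open>Both orders agree exactly on the finite sums supplied by
  \<open>equicontinuous_approx\<close>. Replacing \<open>F\<close> by such a sum costs at most
  \<open>e * M\<close> on each side, where \<open>M\<close> is the volume of the common support
  \<open>K\<close>.\<close>

lemma fubini_lborel:
  fixes F :: "'a \<Rightarrow> 'v::euclidean_space \<Rightarrow> real"
  assumes F: "continuous_on UNIV (\<lambda>(x, v). F x v)" and K: "compact K" "\<And>x v. v \<notin> K \<Longrightarrow> F x v = 0"
  shows "\<Lambda> (\<lambda>x. \<integral>v. F x v \<partial>lborel) = (\<integral>v. \<Lambda> (\<lambda>x. F x v) \<partial>lborel)"
    and "continuous_on UNIV (\<lambda>x. \<integral>v. F x v \<partial>lborel)"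
    and "continuous_on UNIV (\<lambda>v. \<Lambda> (\<lambda>x. F x v))"
proof -
  have F': "continuous_on (UNIV \<times> UNIV) (\<lambda>(x, y). F x y)" using F by simp
  have FK: "continuous_on (UNIV \<times> K) (\<lambda>(x, y). F x y)" using F by (rule continuous_on_subset) simp
  define M where "M = measure lborel K"
  have slx: "continuous_on UNIV (F x)" for x by (rule continuous_on_slice[OF F']) simp
  have slv: "continuous_on UNIV (\<lambda>x. F x v)" for v
    by (rule continuous_on_slice[OF continuous_on_swap_args[OF F']]) simp
  have int: "integrable lborel (F x)" for x using slx K by (intro integrable_compact_support[of _ K]) auto
  have bnd: "\<bar>(\<integral>v. f v \<partial>lborel) - (\<integral>v. g v \<partial>lborel)\<bar> \<le> e * M"
    if "integrable lborel f" "integrable lborel g" "\<And>v. \<bar>f v - g v\<bar> \<le> e" "\<And>v. v \<notin> K \<Longrightarrow> f v = g v" for f g :: "'v \<Rightarrow> real" and e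
  proof -
    have ind: "integrable lborel (\<lambda>v. indicator K v * e)"
      using borel_integrable_compact[OF K(1), of "\<lambda>_. e"] by simp
    have "\<bar>\<integral>v. f v - g v \<partial>lborel\<bar> \<le> (\<integral>v. indicator K v * e \<partial>lborel)"
    proof (rule order_trans[OF integral_abs_bound integral_mono])
      show "\<bar>f v - g v\<bar> \<le> indicator K v * e" for v using that(3,4)[of v] by (cases "v \<in> K") auto
    qed (use that ind in auto)
    also have "\<dots> = e * M" using K(1) by (simp add: M_def mult.commute compact_imp_closed borel_closed)
    finally show ?thesis using that by simp
  qed
  have M: "0 \<le> M" by (simp add: M_def)
  have nb: "\<exists>N. open N \<and> x \<in> N \<and> (\<forall>y\<in>N. \<forall>v\<in>UNIV. \<bar>F y v - F x v\<bar> \<le> e)" if e: "e > 0" for x e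
  proof -
    obtain N where "open N" "x \<in> N" "\<forall>y\<in>N. \<forall>v\<in>K. \<bar>F y v - F x v\<bar> \<le> e"
      using tube_nbhd[OF FK open_UNIV K(1) UNIV_I e, of x] by blast
    then show ?thesis using K(2) e by (intro exI[of _ N]) (metis abs_zero diff_self less_imp_le)
  qed
  show c1: "continuous_on UNIV (\<lambda>x. \<integral>v. F x v \<partial>lborel)"
  proof -
    have "\<exists>N. open N \<and> x \<in> N \<and> (\<forall>y\<in>N. \<bar>(\<integral>v. F y v \<partial>lborel) - (\<integral>v. F x v \<partial>lborel)\<bar> < e)" if e: "0 < e" for x e
    proof -
      \<comment> \<open>The summand 1 keeps the quotient positive when \<open>K\<close> is a null
        set.\<close>
      have "e / (M + 1) > 0" using e M by simp
      from nb[OF this, of x] obtain N where N: "open N" "x \<in> N" "\<And>y v. y \<in> N \<Longrightarrow> \<bar>F y v - F x v\<bar> \<le> e / (M + 1)" by auto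
      have lt: "e / (M + 1) * M < e" using e M by (simp add: field_simps)
      show ?thesis
      proof (intro exI[of _ N] conjI N(1,2) ballI)
        fix y assume "y \<in> N"
        then have "\<bar>(\<integral>v. F y v \<partial>lborel) - (\<integral>v. F x v \<partial>lborel)\<bar> \<le> e / (M + 1) * M"
          using N(3) K(2) by (intro bnd int) auto
        then show "\<bar>(\<integral>v. F y v \<partial>lborel) - (\<integral>v. F x v \<partial>lborel)\<bar> < e" using lt by linarith
      qed
    qed
    then have "isCont (\<lambda>x. \<integral>v. F x v \<partial>lborel) x" for x
      unfolding continuous_at tendsto_iff eventually_at_topological dist_real_def by meson
    then show ?thesis by (simp add: continuous_at_imp_continuous_on)
  qed
  show c2: "continuous_on UNIV (\<lambda>v. \<Lambda> (\<lambda>x. F x v))"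
    by (rule continuous_param) (use continuous_on_swap_args[OF F'] in auto)
  have c2i: "integrable lborel (\<lambda>v. \<Lambda> (\<lambda>x. F x v))"
    using c2 K by (intro integrable_compact_support[of _ K]) (auto simp: const)
  show "\<Lambda> (\<lambda>x. \<integral>v. F x v \<partial>lborel) = (\<integral>v. \<Lambda> (\<lambda>x. F x v) \<partial>lborel)"
  proof -
    have le2: "\<bar>\<Lambda> (\<lambda>x. \<integral>v. F x v \<partial>lborel) - (\<integral>v. \<Lambda> (\<lambda>x. F x v) \<partial>lborel)\<bar> \<le> e * M + e * M" if e: "e > 0" for e
    proof -
      obtain X \<theta> where X: "finite X" and c: "\<And>x. x \<in> X \<Longrightarrow> continuous_on UNIV (\<theta> x)" and nn: "\<And>x y. 0 \<le> \<theta> x y"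
        and s1: "\<And>y. (\<Sum>x\<in>X. \<theta> x y) = 1" and app: "\<And>y v. v \<in> UNIV \<Longrightarrow> \<bar>F y v - (\<Sum>x\<in>X. \<theta> x y * F x v)\<bar> \<le> e"
        by (rule equicontinuous_approx[of UNIV F e]) (rule nb[OF e] | rule that; assumption)+
      have app0: "(\<Sum>x\<in>X. \<theta> x y * F x v) = 0" if "v \<notin> K" for y v using K(2) that by simp
      have "\<bar>(\<integral>v. F y v \<partial>lborel) - (\<Sum>x\<in>X. \<theta> x y * (\<integral>v. F x v \<partial>lborel))\<bar> \<le> e * M" for y
      proof -
        have "\<bar>(\<integral>v. F y v \<partial>lborel) - (\<integral>v. (\<Sum>x\<in>X. \<theta> x y * F x v) \<partial>lborel)\<bar> \<le> e * M"
          using int app app0 K(2) by (intro bnd) auto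
        also have "(\<integral>v. (\<Sum>x\<in>X. \<theta> x y * F x v) \<partial>lborel) = (\<Sum>x\<in>X. \<theta> x y * (\<integral>v. F x v \<partial>lborel))"
          using int by (subst Bochner_Integration.integral_sum) auto
        finally show ?thesis .
      qed
      then have "\<bar>\<Lambda> (\<lambda>x. \<integral>v. F x v \<partial>lborel) - \<Lambda> (\<lambda>y. \<Sum>x\<in>X. \<theta> x y * (\<integral>v. F x v \<partial>lborel))\<bar> \<le> e * M"
        by (intro abs_diff_le c1) (auto intro!: continuous_intros c)
      moreover have "\<Lambda> (\<lambda>y. \<Sum>x\<in>X. \<theta> x y * (\<integral>v. F x v \<partial>lborel)) = (\<Sum>x\<in>X. \<Lambda> (\<theta> x) * (\<integral>v. F x v \<partial>lborel))"
        using c by (subst sum) (auto intro!: continuous_intros sum.cong simp: scale mult.commute[of "\<theta> _ _"] mult.commute[of _ "integral\<^sup>L _ _"])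
      moreover have "(\<Sum>x\<in>X. \<Lambda> (\<theta> x) * (\<integral>v. F x v \<partial>lborel)) = (\<integral>v. (\<Sum>x\<in>X. \<Lambda> (\<theta> x) * F x v) \<partial>lborel)"
        using int by (subst Bochner_Integration.integral_sum) auto
      moreover have "\<bar>(\<integral>v. \<Lambda> (\<lambda>x. F x v) \<partial>lborel) - (\<integral>v. (\<Sum>x\<in>X. \<Lambda> (\<theta> x) * F x v) \<partial>lborel)\<bar> \<le> e * M"
      proof (rule bnd[OF c2i])
        show "integrable lborel (\<lambda>v. \<Sum>x\<in>X. \<Lambda> (\<theta> x) * F x v)" using int by auto
        fix v
        have "\<Lambda> (\<lambda>y. \<Sum>x\<in>X. \<theta> x y * F x v) = (\<Sum>x\<in>X. \<Lambda> (\<theta> x) * F x v)"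
          using c by (subst sum) (auto intro!: continuous_intros sum.cong simp: scale mult.commute[of "\<theta> _ _"] mult.commute[of _ "F _ _"])
        moreover have "\<bar>\<Lambda> (\<lambda>x. F x v) - \<Lambda> (\<lambda>y. \<Sum>x\<in>X. \<theta> x y * F x v)\<bar> \<le> e"
          by (intro abs_diff_le slv app[OF UNIV_I]) (auto intro!: continuous_intros c)
        ultimately show "\<bar>\<Lambda> (\<lambda>x. F x v) - (\<Sum>x\<in>X. \<Lambda> (\<theta> x) * F x v)\<bar> \<le> e" by simp
      qed (use K(2) in \<open>auto simp: const\<close>)
      ultimately show ?thesis by linarith
    qed
    have "\<bar>\<Lambda> (\<lambda>x. \<integral>v. F x v \<partial>lborel) - (\<integral>v. \<Lambda> (\<lambda>x. F x v) \<partial>lborel)\<bar> \<le> 0 + d" if "d > 0" for d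
    proof -
      have "d / (2 * M + 1) > 0" using that M by simp
      from le2[OF this] have "\<bar>\<Lambda> (\<lambda>x. \<integral>v. F x v \<partial>lborel) - (\<integral>v. \<Lambda> (\<lambda>x. F x v) \<partial>lborel)\<bar> \<le> d / (2 * M + 1) * (2 * M)"
        by (simp add: algebra_simps)
      also have "\<dots> \<le> d" using that M by (simp add: field_simps)
      finally show ?thesis by simp
    qed
    then have "\<bar>\<Lambda> (\<lambda>x. \<integral>v. F x v \<partial>lborel) - (\<integral>v. \<Lambda> (\<lambda>x. F x v) \<partial>lborel)\<bar> \<le> 0" by (rule field_le_epsilon)
    then show ?thesis by simp
  qed
qed

end

section \<open>Kernels\<close>

lemma integral_pos_continuous:
  fixes f :: "'v::euclidean_space \<Rightarrow> real"
  assumes f: "continuous_on UNIV f" "integrable lborel f" "\<And>x. 0 \<le> f x" "0 < f y"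
  shows "0 < (\<integral>x. f x \<partial>lborel)"
proof -
  have "open {x. f y / 2 < f x}" by (intro open_Collect_less continuous_intros f(1))
  then obtain r where r: "r > 0" "ball y r \<subseteq> {x. f y / 2 < f x}"
    using f(4) by (metis (mono_tags, lifting) field_sum_of_halves less_add_same_cancel1 mem_Collect_eq openE half_gt_zero)
  have fin: "emeasure lborel (ball y r) < \<infinity>" using emeasure_bounded_finite[of "ball y r"] by simp
  have "0 < f y / 2 * measure lborel (ball y r)" using f(4) content_ball_pos[OF r(1), of y] by simp
  also have "\<dots> = (\<integral>x. indicator (ball y r) x * (f y / 2) \<partial>lborel)" using fin by simp
  also have "\<dots> \<le> (\<integral>x. f x \<partial>lborel)"
  proof (rule integral_mono)
    show "integrable lborel (\<lambda>x. indicator (ball y r) x * (f y / 2))" using fin by simp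
    show "indicator (ball y r) x * (f y / 2) \<le> f x" for x
      using r(2) f(3)[of x] by (cases "x \<in> ball y r") (auto simp: less_imp_le)
  qed (rule f(2))
  finally show ?thesis .
qed

text \<open>Covers both signs of \<open>t\<close> and \<open>t = 0\<close>, so that two-sided
  difference quotients need a single argument.\<close>

lemma MVT_zero:
  fixes f :: "real \<Rightarrow> real"
  assumes "\<And>z. \<bar>z\<bar> \<le> \<bar>t\<bar> \<Longrightarrow> (f has_real_derivative f' z) (at z)"
  obtains z where "\<bar>z\<bar> \<le> \<bar>t\<bar>" "f t - f 0 = t * f' z"
proof -
  consider "t = 0" | "t > 0" | "t < 0" by linarith
  then show ?thesis
  proof cases
    case 1 then show ?thesis using that[of 0] by simp
  next
    case 2
    have "\<exists>z. z > 0 \<and> z < t \<and> f t - f 0 = (t - 0) * f' z" by (rule MVT2) (use 2 assms in auto)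
    then obtain z where "0 < z" "z < t" "f t - f 0 = t * f' z" by auto
    then show ?thesis using that[of z] by simp
  next
    case 3
    have "\<exists>z. z > t \<and> z < 0 \<and> f 0 - f t = (0 - t) * f' z" by (rule MVT2) (use 3 assms in auto)
    then obtain z where "z > t" "z < 0" "f 0 - f t = (0 - t) * f' z" by blast
    then show ?thesis using that[of z] 3 by (simp add: algebra_simps)
  qed
qed

section \<open>Positive semi-definite kernels built from a given one\<close>

text \<open>The definition sums over distinct points, whereas \<open>q\<close> may repeat them; the
  coefficients of each fibre are merged into \<open>c\<close>.\<close>

lemma psd_kernel_indexed:
  assumes K: "psd_kernel K" and I: "finite I"
  shows "0 \<le> (\<Sum>i\<in>I. \<Sum>j\<in>I. a i * a j * K (q i) (q j))"
proof -
  define c where "c x = (\<Sum>i | i \<in> I \<and> q i = x. a i)" for x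
  have g: "(\<Sum>i\<in>I. a i * h (q i)) = (\<Sum>x\<in>q ` I. c x * h x)" for h :: "'a \<Rightarrow> real"
    unfolding c_def sum_distrib_right by (subst sum.image_gen[OF I, of _ q]) (auto intro!: sum.cong)
  have "(\<Sum>i\<in>I. \<Sum>j\<in>I. a i * a j * K (q i) (q j)) = (\<Sum>i\<in>I. a i * (\<Sum>j\<in>I. a j * K (q i) (q j)))"
    by (simp add: sum_distrib_left mult.assoc)
  also have "\<dots> = (\<Sum>i\<in>I. a i * (\<Sum>y\<in>q ` I. c y * K (q i) y))" by (simp only: g)
  also have "\<dots> = (\<Sum>x\<in>q ` I. c x * (\<Sum>y\<in>q ` I. c y * K x y))" by (rule g)
  also have "\<dots> = (\<Sum>x\<in>q ` I. \<Sum>y\<in>q ` I. c x * c y * K x y)" by (simp add: sum_distrib_left mult.assoc)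
  also have "\<dots> \<ge> 0" using K I unfolding psd_kernel_def by blast
  finally show ?thesis .
qed

text \<open>This is the Gram kernel of the combinations of point masses with weights
  \<open>c i x\<close> at \<open>q i x\<close>; its quadratic form over \<open>F\<close> is that of
  \<open>K\<close> indexed by \<open>F \<times> I\<close>.\<close>

lemma psd_kernel_combination:
  fixes c :: "'i \<Rightarrow> 'x \<Rightarrow> real"
  assumes K: "psd_kernel K" and I: "finite I"
  shows "psd_kernel (\<lambda>x y. \<Sum>i\<in>I. \<Sum>j\<in>I. c i x * c j y * K (q i x) (q j y))"
  unfolding psd_kernel_def
proof (intro conjI allI impI)
  fix x y
  have "K u v = K v u" for u v using K by (simp add: psd_kernel_def)
  then have "(\<Sum>i\<in>I. \<Sum>j\<in>I. c i x * c j y * K (q i x) (q j y)) = (\<Sum>i\<in>I. \<Sum>j\<in>I. c j y * c i x * K (q j y) (q i x))"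
    by (simp add: mult.commute)
  also have "\<dots> = (\<Sum>i\<in>I. \<Sum>j\<in>I. c i y * c j x * K (q i y) (q j x))" by (rule sum.swap)
  finally show "(\<Sum>i\<in>I. \<Sum>j\<in>I. c i x * c j y * K (q i x) (q j y)) = (\<Sum>i\<in>I. \<Sum>j\<in>I. c i y * c j x * K (q i y) (q j x))" .
next
  fix F :: "'x set" and a :: "'x \<Rightarrow> real" assume F: "finite F"
  have "0 \<le> (\<Sum>p\<in>F \<times> I. \<Sum>r\<in>F \<times> I. (a (fst p) * c (snd p) (fst p)) * (a (fst r) * c (snd r) (fst r))
      * K (q (snd p) (fst p)) (q (snd r) (fst r)))"
    by (rule psd_kernel_indexed[OF K]) (use F I in auto)
  also have "\<dots> = (\<Sum>x\<in>F. \<Sum>i\<in>I. \<Sum>y\<in>F. \<Sum>j\<in>I. (a x * c i x) * (a y * c j y) * K (q i x) (q j y))"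
    by (simp add: sum.cartesian_product')
  also have "\<dots> = (\<Sum>x\<in>F. \<Sum>y\<in>F. \<Sum>i\<in>I. \<Sum>j\<in>I. (a x * c i x) * (a y * c j y) * K (q i x) (q j y))"
    by (intro sum.cong refl sum.swap)
  also have "\<dots> = (\<Sum>x\<in>F. \<Sum>y\<in>F. a x * a y * (\<Sum>i\<in>I. \<Sum>j\<in>I. c i x * c j y * K (q i x) (q j y)))"
    by (simp add: sum_distrib_left mult_ac)
  finally show "0 \<le> (\<Sum>x\<in>F. \<Sum>y\<in>F. a x * a y * (\<Sum>i\<in>I. \<Sum>j\<in>I. c i x * c j y * K (q i x) (q j y)))" .
qed

lemma psd_kernel_limit:
  fixes G :: "real \<Rightarrow> 'x \<Rightarrow> 'x \<Rightarrow> real"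
  assumes "\<And>e. e \<noteq> 0 \<Longrightarrow> psd_kernel (G e)" and lim: "\<And>x y. ((\<lambda>e::real. G e x y) \<longlongrightarrow> G0 x y) (at 0)"
  shows "psd_kernel G0"
  unfolding psd_kernel_def
proof (intro conjI allI impI)
  have ev: "\<forall>\<^sub>F e in at (0::real). e \<noteq> 0" by (simp add: eventually_at_filter)
  fix x y
  have "\<forall>\<^sub>F e in at 0. G e x y = G e y x" using ev by eventually_elim (use assms(1) in \<open>simp add: psd_kernel_def\<close>)
  then have "((\<lambda>e. G e x y) \<longlongrightarrow> G0 y x) (at 0)" using lim[of y x] by (simp cong: tendsto_cong)
  then show "G0 x y = G0 y x" using lim[of x y] tendsto_unique trivial_limit_at by blast
next
  have ev: "\<forall>\<^sub>F e in at (0::real). e \<noteq> 0" by (simp add: eventually_at_filter)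
  fix F :: "'x set" and a :: "'x \<Rightarrow> real" assume F: "finite F"
  have "((\<lambda>e. \<Sum>x\<in>F. \<Sum>y\<in>F. a x * a y * G e x y) \<longlongrightarrow> (\<Sum>x\<in>F. \<Sum>y\<in>F. a x * a y * G0 x y)) (at 0)"
    by (intro tendsto_intros lim)
  moreover have "\<forall>\<^sub>F e in at 0. 0 \<le> (\<Sum>x\<in>F. \<Sum>y\<in>F. a x * a y * G e x y)"
    using ev by eventually_elim (use assms(1) F in \<open>auto simp: psd_kernel_def\<close>)
  ultimately show "0 \<le> (\<Sum>x\<in>F. \<Sum>y\<in>F. a x * a y * G0 x y)"
    by (rule tendsto_lowerbound) simp
qed

section \<open>Derivatives of a kernel of class C^(1,1)\<close>

locale C11_kernel =
  fixes \<kappa> :: "'e::euclidean_space \<Rightarrow> 'e \<Rightarrow> real"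
  assumes psd: "psd_kernel \<kappa>" and C11: "C11 \<kappa>"
begin

abbreviation d1 where "d1 v x y \<equiv> deriv_fst v \<kappa> x y"
abbreviation d12 where "d12 v w x y \<equiv> deriv_snd w (deriv_fst v \<kappa>) x y"

lemma kernel_sym: "\<kappa> x y = \<kappa> y x"
  using psd by (simp add: psd_kernel_def)

lemma has_derivative_fst: "((\<lambda>x'. \<kappa> x' y) has_derivative (\<lambda>v. d1 v x y)) (at x)"
  using C11 unfolding C11_def deriv_fst_def frechet_derivative_works by blast

lemma has_derivative_snd: "((\<lambda>y'. d1 v x y') has_derivative (\<lambda>w. d12 v w x y)) (at y)"
  using C11 unfolding C11_def deriv_snd_def frechet_derivative_works by blast

lemma d1_expand: "d1 v x y = (\<Sum>b\<in>Basis. (v \<bullet> b) * d1 b x y)"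
  using linear_expand[OF has_derivative_linear[OF has_derivative_fst], of v] unfolding real_scaleR_def .

lemma d12_expand_snd: "d12 v w x y = (\<Sum>c\<in>Basis. (w \<bullet> c) * d12 v c x y)"
  using linear_expand[OF has_derivative_linear[OF has_derivative_snd], of w] unfolding real_scaleR_def .

text \<open>Linearity in the first direction is not built into \<open>d12\<close>, which
  differentiates \<open>d1 v\<close> in its second argument; it follows by differentiating the
  expansion of \<open>d1 v\<close> termwise.\<close>

lemma d12_expand_fst: "d12 v w x y = (\<Sum>b\<in>Basis. (v \<bullet> b) * d12 b w x y)"
proof -
  have "((\<lambda>y'. \<Sum>b\<in>Basis. (v \<bullet> b) * d1 b x y') has_derivative (\<lambda>w. \<Sum>b\<in>Basis. (v \<bullet> b) * d12 b w x y)) (at y)"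
    by (intro has_derivative_sum has_derivative_mult_right has_derivative_snd)
  then have "((\<lambda>y'. d1 v x y') has_derivative (\<lambda>w. \<Sum>b\<in>Basis. (v \<bullet> b) * d12 b w x y)) (at y)"
    by (simp only: d1_expand[symmetric])
  from has_derivative_unique[OF has_derivative_snd this] show ?thesis by (rule fun_cong)
qed

lemma d12_expand: "d12 v w x y = (\<Sum>b\<in>Basis. \<Sum>c\<in>Basis. (v \<bullet> b) * ((w \<bullet> c) * d12 b c x y))"
proof -
  have "d12 v w x y = (\<Sum>b\<in>Basis. (v \<bullet> b) * (\<Sum>c\<in>Basis. (w \<bullet> c) * d12 b c x y))"
    by (rule trans[OF d12_expand_fst]) (rule sum.cong[OF refl], subst d12_expand_snd[of w], rule refl)
  then show ?thesis by (simp add: sum_distrib_left)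
qed

lemma d1_linear: "linear (\<lambda>v. d1 v x y)" by (rule has_derivative_linear[OF has_derivative_fst])

lemma continuous_kernel [continuous_intros]:
  assumes "continuous_on S f" "continuous_on S g" shows "continuous_on S (\<lambda>s. \<kappa> (f s) (g s))"
proof -
  have c: "continuous_on UNIV (\<lambda>(x, y). \<kappa> x y)" using C11 by (simp add: C11_def)
  show ?thesis using continuous_on_compose2[OF c continuous_on_Pair[OF assms]] by simp
qed

lemma continuous_d1 [continuous_intros]:
  assumes "continuous_on S v" "continuous_on S f" "continuous_on S g"
  shows "continuous_on S (\<lambda>s. d1 (v s) (f s) (g s))"
proof -
  have c: "continuous_on UNIV (\<lambda>(x, y). d1 b x y)" for b using C11 by (simp add: C11_def)
  have "continuous_on S (\<lambda>s. d1 b (f s) (g s))" for b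
    using continuous_on_compose2[OF c continuous_on_Pair[OF assms(2,3)]] by simp
  then have "continuous_on S (\<lambda>s. \<Sum>b\<in>Basis. (v s \<bullet> b) * d1 b (f s) (g s))" by (intro continuous_intros assms)
  moreover have "(\<lambda>s. \<Sum>b\<in>Basis. (v s \<bullet> b) * d1 b (f s) (g s)) = (\<lambda>s. d1 (v s) (f s) (g s))"
    by (rule ext) (rule d1_expand[symmetric])
  ultimately show ?thesis by (rule back_subst[of "continuous_on S"])
qed

lemma continuous_d12 [continuous_intros]:
  assumes "continuous_on S v" "continuous_on S w" "continuous_on S f" "continuous_on S g"
  shows "continuous_on S (\<lambda>s. d12 (v s) (w s) (f s) (g s))"
proof -
  have c: "continuous_on UNIV (\<lambda>(x, y). d12 b c x y)" for b c using C11 by (simp add: C11_def)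
  have "continuous_on S (\<lambda>s. d12 b c (f s) (g s))" for b c
    using continuous_on_compose2[OF c continuous_on_Pair[OF assms(3,4)]] by simp
  then have "continuous_on S (\<lambda>s. \<Sum>b\<in>Basis. \<Sum>c\<in>Basis. (v s \<bullet> b) * ((w s \<bullet> c) * d12 b c (f s) (g s)))"
    by (intro continuous_intros assms)
  moreover have "(\<lambda>s. \<Sum>b\<in>Basis. \<Sum>c\<in>Basis. (v s \<bullet> b) * ((w s \<bullet> c) * d12 b c (f s) (g s))) =
      (\<lambda>s. d12 (v s) (w s) (f s) (g s))"
    by (rule ext) (rule d12_expand[symmetric])
  ultimately show ?thesis by (rule back_subst[of "continuous_on S"])
qed

lemma curve_fst:
  assumes "(\<alpha> has_vector_derivative a) (at t)"
  shows "((\<lambda>t. \<kappa> (\<alpha> t) y) has_real_derivative d1 a (\<alpha> t) y) (at t)"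
  using has_derivative_compose[OF assms[unfolded has_vector_derivative_def] has_derivative_fst[of y "\<alpha> t"]]
  by (simp add: has_field_derivative_def linear_cmul[OF d1_linear] mult_commute_abs)

lemma curve_snd:
  assumes "(\<beta> has_vector_derivative b) (at t)"
  shows "((\<lambda>t. d1 v x (\<beta> t)) has_real_derivative d12 v b x (\<beta> t)) (at t)"
  using has_derivative_compose[OF assms[unfolded has_vector_derivative_def] has_derivative_snd[of v x "\<beta> t"]]
  by (simp add: has_field_derivative_def linear_cmul[OF has_derivative_linear[OF has_derivative_snd]] mult_commute_abs)

text \<open>Two mean value steps, in \<open>t\<close> and then in \<open>s\<close>, write the mixed
  quotient as the mixed derivative at a nearby pair of parameters. The limit must be joint in
  \<open>(t, s)\<close>: a limit along \<open>t = s\<close> would not show that difference quotients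
  are Cauchy in the Hilbert space.\<close>

lemma mixed_difference:
  assumes \<delta>: "\<delta> > 0"
    and \<alpha>: "\<And>t. \<bar>t\<bar> < \<delta> \<Longrightarrow> (\<alpha> has_vector_derivative \<alpha>' t) (at t)" "continuous_on {-\<delta><..<\<delta>} \<alpha>'"
    and \<beta>: "\<And>t. \<bar>t\<bar> < \<delta> \<Longrightarrow> (\<beta> has_vector_derivative \<beta>' t) (at t)" "continuous_on {-\<delta><..<\<delta>} \<beta>'"
    and e: "e > 0"
  shows "\<exists>\<eta>>0. \<forall>t s. t \<noteq> 0 \<and> s \<noteq> 0 \<and> \<bar>t\<bar> < \<eta> \<and> \<bar>s\<bar> < \<eta> \<longrightarrow>
    \<bar>(\<kappa> (\<alpha> t) (\<beta> s) - \<kappa> (\<alpha> t) (\<beta> 0) - \<kappa> (\<alpha> 0) (\<beta> s) + \<kappa> (\<alpha> 0) (\<beta> 0)) / (t * s)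
      - d12 (\<alpha>' 0) (\<beta>' 0) (\<alpha> 0) (\<beta> 0)\<bar> < e"
proof -
  define I where "I = {-\<delta><..<\<delta>}"
  have I: "open I" "0 \<in> I" using \<delta> by (auto simp: I_def)
  have ac: "continuous_on I \<alpha>" "continuous_on I \<beta>"
    by (auto intro!: continuous_at_imp_continuous_on simp: I_def abs_less_iff)
       (metis \<alpha>(1) \<beta>(1) abs_less_iff has_vector_derivative_continuous minus_less_iff)+
  define M where "M p = d12 (\<alpha>' (fst p)) (\<beta>' (snd p)) (\<alpha> (fst p)) (\<beta> (snd p))" for p
  have "continuous_on (I \<times> I) M"
    unfolding M_def[abs_def] using \<alpha>(2) \<beta>(2) ac unfolding I_def[symmetric]
    by (intro continuous_intros) (auto intro: continuous_on_compose2[OF _ continuous_on_fst[OF continuous_on_id]]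
      continuous_on_compose2[OF _ continuous_on_snd[OF continuous_on_id]])
  then have "continuous (at (0, 0)) M" using I by (simp add: continuous_on_eq_continuous_at open_Times)
  then obtain d where d: "d > 0" "\<And>p. dist p (0, 0) < d \<Longrightarrow> \<bar>M p - M (0, 0)\<bar> < e"
    using e unfolding continuous_at_eps_delta dist_real_def by blast
  \<comment> \<open>Half of \<open>d\<close> suffices, because the distance of a pair from the
    origin is at most the sum of the two moduli.\<close>
  define \<eta> where "\<eta> = min \<delta> (d / 2)"
  show ?thesis
  proof (intro exI[of _ \<eta>] conjI allI impI)
    show "\<eta> > 0" using \<delta> d by (simp add: \<eta>_def)
    fix t s assume ts: "t \<noteq> 0 \<and> s \<noteq> 0 \<and> \<bar>t\<bar> < \<eta> \<and> \<bar>s\<bar> < \<eta>"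
    define g where "g \<tau> = \<kappa> (\<alpha> \<tau>) (\<beta> s) - \<kappa> (\<alpha> \<tau>) (\<beta> 0)" for \<tau>
    obtain \<xi> where xi: "\<bar>\<xi>\<bar> \<le> \<bar>t\<bar>" "g t - g 0 = t * (d1 (\<alpha>' \<xi>) (\<alpha> \<xi>) (\<beta> s) - d1 (\<alpha>' \<xi>) (\<alpha> \<xi>) (\<beta> 0))"
    proof (rule MVT_zero[of t g "\<lambda>\<tau>. d1 (\<alpha>' \<tau>) (\<alpha> \<tau>) (\<beta> s) - d1 (\<alpha>' \<tau>) (\<alpha> \<tau>) (\<beta> 0)"])
      fix z assume "\<bar>z\<bar> \<le> \<bar>t\<bar>"
      then have "\<bar>z\<bar> < \<delta>" using ts by (simp add: \<eta>_def)
      then show "(g has_real_derivative d1 (\<alpha>' z) (\<alpha> z) (\<beta> s) - d1 (\<alpha>' z) (\<alpha> z) (\<beta> 0)) (at z)"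
        unfolding g_def[abs_def] by (intro DERIV_diff curve_fst \<alpha>(1))
    qed (rule that)
    obtain \<zeta> where ze: "\<bar>\<zeta>\<bar> \<le> \<bar>s\<bar>" "d1 (\<alpha>' \<xi>) (\<alpha> \<xi>) (\<beta> s) - d1 (\<alpha>' \<xi>) (\<alpha> \<xi>) (\<beta> 0) = s * M (\<xi>, \<zeta>)"
    proof (rule MVT_zero[of s "\<lambda>s. d1 (\<alpha>' \<xi>) (\<alpha> \<xi>) (\<beta> s)" "\<lambda>\<zeta>. M (\<xi>, \<zeta>)"])
      fix z assume "\<bar>z\<bar> \<le> \<bar>s\<bar>"
      then have "\<bar>z\<bar> < \<delta>" using ts by (simp add: \<eta>_def)
      then show "((\<lambda>s. d1 (\<alpha>' \<xi>) (\<alpha> \<xi>) (\<beta> s)) has_real_derivative M (\<xi>, z)) (at z)"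
        unfolding M_def fst_conv snd_conv by (intro curve_snd \<beta>(1))
    qed (rule that)
    have "(\<kappa> (\<alpha> t) (\<beta> s) - \<kappa> (\<alpha> t) (\<beta> 0) - \<kappa> (\<alpha> 0) (\<beta> s) + \<kappa> (\<alpha> 0) (\<beta> 0)) / (t * s) = M (\<xi>, \<zeta>)"
      using xi(2) ze(2) ts by (simp add: g_def field_simps)
    moreover have "dist (\<xi>, \<zeta>) (0, 0) < d"
    proof -
      have "dist (\<xi>, \<zeta>) (0, 0) \<le> \<bar>\<xi>\<bar> + \<bar>\<zeta>\<bar>" by (simp add: dist_Pair_Pair sqrt_sum_squares_le_sum_abs)
      also have "\<dots> < d" using xi(1) ze(1) ts by (simp add: \<eta>_def)
      finally show ?thesis .
    qed
    ultimately show "\<bar>(\<kappa> (\<alpha> t) (\<beta> s) - \<kappa> (\<alpha> t) (\<beta> 0) - \<kappa> (\<alpha> 0) (\<beta> s) + \<kappa> (\<alpha> 0) (\<beta> 0)) / (t * s)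
      - d12 (\<alpha>' 0) (\<beta>' 0) (\<alpha> 0) (\<beta> 0)\<bar> < e" using d(2)[of "(\<xi>, \<zeta>)"] by (simp add: M_def)
  qed
qed

text \<open>Let \<ell>_x send G to DG(q x)(V x) + b(x) G(q x). The expression is the Gram kernel of
  the functionals \<ell>_x + t \<delta>_z, obtained as a limit of combinations of three point
  masses, for which positivity is known.\<close>

lemma extended_psd:
  fixes q V :: "'x \<Rightarrow> 'e" and b :: "'x \<Rightarrow> real"
  shows "psd_kernel (\<lambda>x y. d12 (V x) (V y) (q x) (q y) + b y * d1 (V x) (q x) (q y) + b x * d1 (V y) (q y) (q x)
      + b x * b y * \<kappa> (q x) (q y) + t * (d1 (V x) (q x) z + b x * \<kappa> (q x) z)
      + t * (d1 (V y) (q y) z + b y * \<kappa> (q y) z) + t\<^sup>2 * \<kappa> z z)"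
proof (rule psd_kernel_limit)
  \<comment> \<open>The masses \<open>1 / e\<close> at the shifted point and \<open>- 1 / e\<close>
    at \<open>q x\<close> form the difference quotient; \<open>b x\<close> is added at
    \<open>q x\<close>, and \<open>t\<close> sits at \<open>z\<close>.\<close>
  define c where "c e i x = (if i = 0 then 1 / e else if i = Suc 0 then b x - 1 / e else t)" for e :: real and i :: nat and x
  define p where "p e i x = (if i = 0 then q x + e *\<^sub>R V x else if i = Suc 0 then q x else z)" for e :: real and i :: nat and x
  show "psd_kernel (\<lambda>x y. \<Sum>i\<in>{..<3}. \<Sum>j\<in>{..<3}. c e i x * c e j y * \<kappa> (p e i x) (p e j y))" for e
    by (rule psd_kernel_combination[OF psd]) simp
  fix x y
  have line: "((\<lambda>e. q x + e *\<^sub>R V x) has_vector_derivative V x) (at s)" for x s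
    by (auto intro!: derivative_eq_intros)
  have l1: "((\<lambda>e. (\<kappa> (q x + e *\<^sub>R V x) w - \<kappa> (q x) w) / e) \<longlongrightarrow> d1 (V x) (q x) w) (at 0)" for x w
    using curve_fst[OF line[of x 0], of w] by (simp add: has_field_derivative_iff)
  have l2: "((\<lambda>e. (\<kappa> (q x + e *\<^sub>R V x) (q y + e *\<^sub>R V y) - \<kappa> (q x + e *\<^sub>R V x) (q y) - \<kappa> (q x) (q y + e *\<^sub>R V y) + \<kappa> (q x) (q y)) / (e * e))
     \<longlongrightarrow> d12 (V x) (V y) (q x) (q y)) (at 0)"
    unfolding LIM_def dist_real_def
  proof (intro allI impI)
    fix r :: real assume "0 < r"
    from mixed_difference[of 1 "\<lambda>e. q x + e *\<^sub>R V x" "\<lambda>_. V x" "\<lambda>e. q y + e *\<^sub>R V y" "\<lambda>_. V y", OF _ line _ line _ this]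
    obtain \<eta> where "\<eta> > 0" "\<And>t s. t \<noteq> 0 \<and> s \<noteq> 0 \<and> \<bar>t\<bar> < \<eta> \<and> \<bar>s\<bar> < \<eta> \<longrightarrow>
      \<bar>(\<kappa> (q x + t *\<^sub>R V x) (q y + s *\<^sub>R V y) - \<kappa> (q x + t *\<^sub>R V x) (q y) - \<kappa> (q x) (q y + s *\<^sub>R V y) + \<kappa> (q x) (q y)) / (t * s)
       - d12 (V x) (V y) (q x) (q y)\<bar> < r" by auto
    then show "\<exists>s>0. \<forall>e. e \<noteq> 0 \<and> \<bar>e - 0\<bar> < s \<longrightarrow>
      \<bar>(\<kappa> (q x + e *\<^sub>R V x) (q y + e *\<^sub>R V y) - \<kappa> (q x + e *\<^sub>R V x) (q y) - \<kappa> (q x) (q y + e *\<^sub>R V y) + \<kappa> (q x) (q y)) / (e * e)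
       - d12 (V x) (V y) (q x) (q y)\<bar> < r" by (intro exI[of _ \<eta>]) auto
  qed
  define L where "L e = (\<kappa> (q x + e *\<^sub>R V x) (q y + e *\<^sub>R V y) - \<kappa> (q x + e *\<^sub>R V x) (q y) - \<kappa> (q x) (q y + e *\<^sub>R V y) + \<kappa> (q x) (q y)) / (e * e)
     + b y * ((\<kappa> (q x + e *\<^sub>R V x) (q y) - \<kappa> (q x) (q y)) / e) + b x * ((\<kappa> (q y + e *\<^sub>R V y) (q x) - \<kappa> (q y) (q x)) / e)
     + b x * b y * \<kappa> (q x) (q y) + t * ((\<kappa> (q x + e *\<^sub>R V x) z - \<kappa> (q x) z) / e + b x * \<kappa> (q x) z)
     + t * ((\<kappa> (q y + e *\<^sub>R V y) z - \<kappa> (q y) z) / e + b y * \<kappa> (q y) z) + t\<^sup>2 * \<kappa> z z" for e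
  have "(L \<longlongrightarrow> d12 (V x) (V y) (q x) (q y) + b y * d1 (V x) (q x) (q y) + b x * d1 (V y) (q y) (q x)
      + b x * b y * \<kappa> (q x) (q y) + t * (d1 (V x) (q x) z + b x * \<kappa> (q x) z)
      + t * (d1 (V y) (q y) z + b y * \<kappa> (q y) z) + t\<^sup>2 * \<kappa> z z) (at 0)"
    unfolding L_def[abs_def] by (intro tendsto_intros l1 l2)
  moreover have "\<forall>\<^sub>F e in at 0. L e = (\<Sum>i\<in>{..<3}. \<Sum>j\<in>{..<3}. c e i x * c e j y * \<kappa> (p e i x) (p e j y))"
  proof -
    have "L e = (\<Sum>i\<in>{..<3}. \<Sum>j\<in>{..<3}. c e i x * c e j y * \<kappa> (p e i x) (p e j y))" if "e \<noteq> 0" for e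
    proof -
      have s: "\<kappa> (q y + e *\<^sub>R V y) (q x) = \<kappa> (q x) (q y + e *\<^sub>R V y)" "\<kappa> (q y) (q x) = \<kappa> (q x) (q y)"
        "\<kappa> (q y + e *\<^sub>R V y) z = \<kappa> z (q y + e *\<^sub>R V y)" "\<kappa> (q y) z = \<kappa> z (q y)" by (rule kernel_sym)+
      define i where "i = 1 / e"
      have "(\<Sum>i\<in>{..<3}. \<Sum>j\<in>{..<3}. c e i x * c e j y * \<kappa> (p e i x) (p e j y)) =
         i * i * \<kappa> (q x + e *\<^sub>R V x) (q y + e *\<^sub>R V y) + i * (b y - i) * \<kappa> (q x + e *\<^sub>R V x) (q y) + i * t * \<kappa> (q x + e *\<^sub>R V x) z
         + ((b x - i) * i * \<kappa> (q x) (q y + e *\<^sub>R V y) + (b x - i) * (b y - i) * \<kappa> (q x) (q y) + (b x - i) * t * \<kappa> (q x) z)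
         + (t * i * \<kappa> z (q y + e *\<^sub>R V y) + t * (b y - i) * \<kappa> z (q y) + t * t * \<kappa> z z)"
        by (simp add: eval_nat_numeral lessThan_Suc c_def p_def i_def)
      also have "\<dots> = L e"
        unfolding L_def s divide_inverse mult_1 i_def inverse_mult_distrib power2_eq_square by (simp add: algebra_simps)
      finally show ?thesis by simp
    qed
    then show ?thesis by (simp add: eventually_at_filter)
  qed
  ultimately show "((\<lambda>e. \<Sum>i\<in>{..<3}. \<Sum>j\<in>{..<3}. c e i x * c e j y * \<kappa> (p e i x) (p e j y)) \<longlongrightarrow>
      d12 (V x) (V y) (q x) (q y) + b y * d1 (V x) (q x) (q y) + b x * d1 (V y) (q y) (q x)
      + b x * b y * \<kappa> (q x) (q y) + t * (d1 (V x) (q x) z + b x * \<kappa> (q x) z)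
      + t * (d1 (V y) (q y) z + b y * \<kappa> (q y) z) + t\<^sup>2 * \<kappa> z z) (at 0)"
    by (simp cong: tendsto_cong)
qed

end

section \<open>Characteristic kernels and signed densities\<close>

text \<open>The characteristic property compares probability measures. Total mass zero gives the
  positive and the negative part of \<open>w\<close> the same mass \<open>c\<close>, so both
  normalise to probability densities, with equal mean embeddings.\<close>

lemma characteristic_kernel_mass_zero:
  fixes \<kappa> :: "'e::euclidean_space \<Rightarrow> 'e \<Rightarrow> real"
  assumes char: "characteristic_kernel \<kappa>" and \<kappa>: "\<And>z. continuous_on UNIV (\<kappa> z)"
    and w: "continuous_on UNIV w" and K: "compact K" "\<And>y. y \<notin> K \<Longrightarrow> w y = 0"
    and mass: "(\<integral>y. w y \<partial>lborel) = 0" and emb: "\<And>z. (\<integral>y. \<kappa> z y * w y \<partial>lborel) = 0"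
  shows "w y = 0"
proof (rule ccontr)
  assume ne: "w y \<noteq> 0"
  define wp where "wp y = max 0 (w y)" for y
  define wn where "wn y = max 0 (- w y)" for y
  have cp: "continuous_on UNIV wp" and cn: "continuous_on UNIV wn"
    unfolding wp_def[abs_def] wn_def[abs_def] by (intro continuous_intros w)+
  have int: "integrable lborel (\<lambda>y. f y * h y)" if "continuous_on UNIV f" "continuous_on UNIV h" "h = wp \<or> h = wn \<or> h = w" for f h :: "'e \<Rightarrow> real"
    using that K by (intro integrable_compact_support[of _ K] continuous_intros) (auto simp: wp_def wn_def)
  have int1: "integrable lborel wp" "integrable lborel wn"
    using int[of "\<lambda>_. 1" wp] int[of "\<lambda>_. 1" wn] cp cn by auto
  have weq: "w y = wp y - wn y" for y by (auto simp: wp_def wn_def)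
  define c where "c = (\<integral>y. wp y \<partial>lborel)"
  have c': "(\<integral>y. wn y \<partial>lborel) = c" using mass int1 unfolding weq c_def by simp
  have cpos: "c > 0"
  proof (cases "w y > 0")
    case True
    then show ?thesis unfolding c_def by (intro integral_pos_continuous[OF cp int1(1), of y]) (auto simp: wp_def)
  next
    case False
    then show ?thesis unfolding c'[symmetric] using ne
      by (intro integral_pos_continuous[OF cn int1(2), of y]) (auto simp: wn_def)
  qed
  define R where "R h = density lborel (\<lambda>y. ennreal (h y / c))" for h :: "'e \<Rightarrow> real"
  have meas: "wp \<in> borel_measurable borel" "wn \<in> borel_measurable borel"
    using cp cn by (auto intro: borel_measurable_continuous_onI)
  have R: "R h \<in> {R. prob_space R \<and> sets R = sets borel}" if "h = wp \<or> h = wn" for h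
  proof -
    have h: "h \<in> borel_measurable borel" "integrable lborel h" "(\<integral>y. h y \<partial>lborel) = c"
      using that meas int1 c_def c' by auto
    have h0: "\<And>y. 0 \<le> h y" using that by (auto simp: wp_def wn_def)
    have "emeasure (R h) (space (R h)) = (\<integral>\<^sup>+ y. ennreal (h y / c) \<partial>lborel)"
      unfolding R_def using h(1) by (subst emeasure_density) auto
    also have "\<dots> = ennreal (\<integral>y. h y / c \<partial>lborel)"
      using h h0 cpos by (intro nn_integral_eq_integral) auto
    also have "\<dots> = 1" using h(3) cpos by simp
    finally show ?thesis by (auto intro: prob_spaceI simp: R_def)
  qed
  have intR: "(\<integral>y. f y \<partial>R h) = (\<integral>y. f y * h y \<partial>lborel) / c" if "h = wp \<or> h = wn" "continuous_on UNIV f" for f :: "'e \<Rightarrow> real" and h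
  proof -
    have "(\<integral>y. f y \<partial>R h) = (\<integral>y. (h y / c) *\<^sub>R f y \<partial>lborel)" unfolding R_def
    proof (rule integral_density)
      have h: "h \<in> borel_measurable borel" "\<And>y. 0 \<le> h y" using that(1) meas by (auto simp: wp_def wn_def)
      then show "(\<lambda>y. h y / c) \<in> borel_measurable lborel" "AE y in lborel. 0 \<le> h y / c" using cpos by auto
      show "f \<in> borel_measurable lborel" using that(2) borel_measurable_continuous_onI by auto
    qed
    also have "\<dots> = (\<integral>y. (f y * h y) / c \<partial>lborel)" by (simp add: mult.commute)
    finally show ?thesis by simp
  qed
  have "(\<lambda>x. \<integral>y. \<kappa> x y \<partial>R wp) = (\<lambda>x. \<integral>y. \<kappa> x y \<partial>R wn)"
  proof
    fix x
    have "(\<integral>y. \<kappa> x y * wp y \<partial>lborel) - (\<integral>y. \<kappa> x y * wn y \<partial>lborel) = (\<integral>y. \<kappa> x y * w y \<partial>lborel)"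
      unfolding weq right_diff_distrib by (rule Bochner_Integration.integral_diff[symmetric]) (intro int \<kappa> cp cn; simp)+
    then show "(\<integral>y. \<kappa> x y \<partial>R wp) = (\<integral>y. \<kappa> x y \<partial>R wn)" using emb by (simp add: intR \<kappa>)
  qed
  moreover have "inj_on (\<lambda>R x. \<integral>y. \<kappa> x y \<partial>R) {R. prob_space R \<and> sets R = sets borel}"
    using char by (simp add: characteristic_kernel_def)
  ultimately have "R wp = R wn" using R[of wp] R[of wn] by (auto dest: inj_onD)
  \<comment> \<open>The two equal measures are tested on \<open>wp\<close> itself: since
    \<open>wp\<close> and \<open>wn\<close> have product zero, the integral of the square of
    \<open>wp\<close> must vanish.\<close>
  then have "(\<integral>y. wp y * wp y \<partial>lborel) / c = (\<integral>y. wp y * wn y \<partial>lborel) / c" using intR[OF _ cp] by metis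
  moreover have "wp y * wn y = 0" for y by (auto simp: wp_def wn_def max_def)
  ultimately have z: "(\<integral>y. wp y * wp y \<partial>lborel) = 0" using cpos by simp
  have "wp y = 0" for y
  proof (rule ccontr)
    assume "wp y \<noteq> 0"
    then have "0 < (\<integral>y. wp y * wp y \<partial>lborel)"
      by (intro integral_pos_continuous[of _ y] continuous_intros cp int) (auto simp: zero_less_mult_iff)
    then show False using z by simp
  qed
  then show False using cpos by (simp add: c_def)
qed

text \<open>The difference of \<open>w\<close> and a translate of it has mass zero and is annihilated as well, so \<open>w\<close>
  agrees with all its translates; having compact support, it vanishes.\<close>

lemma characteristic_translation_invariant:
  fixes \<kappa> :: "'e::euclidean_space \<Rightarrow> 'e \<Rightarrow> real"
  assumes char: "characteristic_kernel \<kappa>" and \<kappa>: "\<And>z. continuous_on UNIV (\<kappa> z)" and tr: "translation_invariant \<kappa>"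
    and w: "continuous_on UNIV w" and K: "compact K" "\<And>y. y \<notin> K \<Longrightarrow> w y = 0"
    and emb: "\<And>z. (\<integral>y. \<kappa> z y * w y \<partial>lborel) = 0"
  shows "w y = 0"
proof (cases "y \<in> K")
  case True
  obtain B where B: "\<And>x. x \<in> K \<Longrightarrow> norm x \<le> B" using compact_imp_bounded[OF K(1)] bounded_iff by metis
  \<comment> \<open>Long enough to make \<open>K\<close> and its translate disjoint, so that at a
    point of \<open>K\<close> the translate of \<open>w\<close> vanishes.\<close>
  obtain a :: 'e where a: "norm a = 2 * \<bar>B\<bar> + 1" using vector_choose_size[of "2 * \<bar>B\<bar> + 1"] by auto
  define w' where "w' y = w y - w (- a + y)" for y
  have ya: "- a + y \<notin> K"
  proof
    assume "- a + y \<in> K"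
    then have "norm (- a + y) \<le> B" "norm y \<le> B" using B True by auto
    moreover have "norm a \<le> norm y + norm (- a + y)" using norm_triangle_ineq4[of y "- a + y"] by simp
    ultimately show False using a by simp
  qed
  have wa: "continuous_on UNIV (\<lambda>y. w (- a + y))" by (intro continuous_on_compose2[OF w] continuous_intros) auto
  define K' where "K' = K \<union> (+) a ` K"
  have K': "compact K'" unfolding K'_def using K(1) by (auto intro: compact_Un compact_translation)
  have z1: "w (- a + y) = 0" if "y \<notin> K'" for y
  proof (rule K(2))
    show "- a + y \<notin> K" using that unfolding K'_def by (auto simp: image_iff)
  qed
  have z2: "w y = 0" if "y \<notin> K'" for y using that K(2) by (auto simp: K'_def)
  have i1: "integrable lborel (\<lambda>y. f y * w y)" if "continuous_on UNIV f" for f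
    using that w z2 by (intro integrable_compact_support[OF _ K'] continuous_intros) auto
  have i2: "integrable lborel (\<lambda>y. f y * w (- a + y))" if "continuous_on UNIV f" for f
    using that wa z1 by (intro integrable_compact_support[OF _ K'] continuous_intros) auto
  have "w' y = 0"
  proof (rule characteristic_kernel_mass_zero[OF char \<kappa> _ K'])
    show "continuous_on UNIV w'" unfolding w'_def[abs_def] by (intro continuous_intros w wa)
    show "w' y = 0" if "y \<notin> K'" for y using z1 z2 that by (simp add: w'_def)
    show "(\<integral>y. w' y \<partial>lborel) = 0"
      using i1[of "\<lambda>_. 1"] i2[of "\<lambda>_. 1"] integral_translate[of w "- a"] borel_measurable_continuous_onI[OF w]
      by (simp add: w'_def)
    fix z
    \<comment> \<open>Translation invariance moves the shift from \<open>w\<close> to the base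
      point; the hypothesis then applies at \<open>z - a\<close>.\<close>
    have "(\<integral>y. \<kappa> z y * w (- a + y) \<partial>lborel) = (\<integral>y. \<kappa> z (a + y) * w (- a + (a + y)) \<partial>lborel)"
      by (rule integral_translate[symmetric])
        (intro borel_measurable_continuous_onI continuous_intros wa \<kappa>)
    also have "\<dots> = (\<integral>y. \<kappa> (z - a) y * w y \<partial>lborel)"
    proof -
      have "\<kappa> (z - a + a) (y + a) = \<kappa> (z - a) y" for y using tr unfolding translation_invariant_def by blast
      then have "\<kappa> z (a + y) = \<kappa> (z - a) y" for y by (simp add: add.commute[of a])
      then show ?thesis by simp
    qed
    also have "\<dots> = 0" by (rule emb)
    finally show "(\<integral>y. \<kappa> z y * w' y \<partial>lborel) = 0"
      unfolding w'_def right_diff_distrib using emb[of z] i1[OF \<kappa>] i2[OF \<kappa>] by simp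
  qed
  then show ?thesis using K(2)[OF ya] by (simp add: w'_def)
qed (use K(2) in simp)

section \<open>Reproducing kernel Hilbert spaces\<close>

locale rkhs =
  fixes K :: "'a \<Rightarrow> 'a \<Rightarrow> real" and H :: "('a \<Rightarrow> real) set" and ip :: "('a \<Rightarrow> real) \<Rightarrow> ('a \<Rightarrow> real) \<Rightarrow> real"
  assumes is_rkhs: "is_rkhs K H ip"
begin

lemma zeroH: "(\<lambda>x. 0) \<in> H"
  and addH: "f \<in> H \<Longrightarrow> h \<in> H \<Longrightarrow> (\<lambda>x. f x + h x) \<in> H"
  and scaleH: "f \<in> H \<Longrightarrow> (\<lambda>x. r * f x) \<in> H"
  and ip_sym: "f \<in> H \<Longrightarrow> h \<in> H \<Longrightarrow> ip f h = ip h f"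
  and ip_add: "f \<in> H \<Longrightarrow> h \<in> H \<Longrightarrow> k \<in> H \<Longrightarrow> ip (\<lambda>x. f x + h x) k = ip f k + ip h k"
  and ip_scale: "f \<in> H \<Longrightarrow> h \<in> H \<Longrightarrow> ip (\<lambda>x. r * f x) h = r * ip f h"
  and ip_pos: "f \<in> H \<Longrightarrow> f \<noteq> (\<lambda>x. 0) \<Longrightarrow> 0 < ip f f"
  and KH: "(\<lambda>y. K y x) \<in> H"
  and reproducing: "f \<in> H \<Longrightarrow> ip f (\<lambda>y. K y x) = f x"
  using is_rkhs unfolding is_rkhs_def by blast+

lemma complete:
  assumes "\<And>n. F n \<in> H" "\<And>e. e > 0 \<Longrightarrow> \<exists>N. \<forall>i\<ge>N. \<forall>j\<ge>N. sqrt (ip (\<lambda>x. F i x - F j x) (\<lambda>x. F i x - F j x)) < e"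
  obtains f where "f \<in> H" "(\<lambda>n. sqrt (ip (\<lambda>x. F n x - f x) (\<lambda>x. F n x - f x))) \<longlonglongrightarrow> 0"
proof -
  have "\<forall>F :: nat \<Rightarrow> 'a \<Rightarrow> real.
        (\<forall>n. F n \<in> H) \<and>
        (\<forall>e>0. \<exists>N. \<forall>i\<ge>N. \<forall>j\<ge>N.
           sqrt (ip (\<lambda>x. F i x - F j x) (\<lambda>x. F i x - F j x)) < e) \<longrightarrow>
        (\<exists>f\<in>H. (\<lambda>n. sqrt (ip (\<lambda>x. F n x - f x) (\<lambda>x. F n x - f x))) \<longlonglongrightarrow> 0)"
    using is_rkhs unfolding is_rkhs_def by (elim conjE)
  from this[rule_format, of F] assms show ?thesis by (auto intro: that)
qed

lemma diffH: "f \<in> H \<Longrightarrow> h \<in> H \<Longrightarrow> (\<lambda>x. f x - h x) \<in> H"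
  using addH[OF _ scaleH[of h "-1"], of f] by simp

lemma ip_diff: "f \<in> H \<Longrightarrow> h \<in> H \<Longrightarrow> k \<in> H \<Longrightarrow> ip (\<lambda>x. f x - h x) k = ip f k - ip h k"
  using ip_add[of f "\<lambda>x. (-1) * h x" k] scaleH[of h "-1"] ip_scale[of h k "-1"] by simp

lemma ip_add2:
  assumes "f \<in> H" "h \<in> H" "k \<in> H" shows "ip k (\<lambda>x. f x + h x) = ip k f + ip k h"
  using ip_add[OF assms] ip_sym[OF addH[OF assms(1,2)] assms(3)] ip_sym[OF assms(1,3)] ip_sym[OF assms(2,3)] by simp

lemma ip_scale2:
  assumes "f \<in> H" "h \<in> H" shows "ip h (\<lambda>x. r * f x) = r * ip h f"
  using ip_scale[OF assms] ip_sym[OF scaleH[OF assms(1)] assms(2)] ip_sym[OF assms] by simp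

lemma ip_diff2:
  assumes "f \<in> H" "h \<in> H" "k \<in> H" shows "ip k (\<lambda>x. f x - h x) = ip k f - ip k h"
  using ip_diff[OF assms] ip_sym[OF diffH[OF assms(1,2)] assms(3)] ip_sym[OF assms(1,3)] ip_sym[OF assms(2,3)] by simp

lemma ip_zero: "h \<in> H \<Longrightarrow> ip (\<lambda>x. 0) h = 0"
  using ip_scale[OF zeroH, of h 0] by simp

lemma ip_nonneg: "f \<in> H \<Longrightarrow> 0 \<le> ip f f"
  using ip_pos ip_zero by (cases "f = (\<lambda>x. 0)") (auto simp: less_imp_le)

lemma ip_diff_self: "f \<in> H \<Longrightarrow> h \<in> H \<Longrightarrow> ip (\<lambda>x. f x - h x) (\<lambda>x. f x - h x) = ip f f - 2 * ip f h + ip h h"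
  by (simp add: ip_diff ip_diff2 diffH ip_sym[of h f])

lemma Cauchy_Schwarz: assumes "f \<in> H" "h \<in> H" shows "\<bar>ip f h\<bar> \<le> sqrt (ip f f) * sqrt (ip h h)"
proof (cases "h = (\<lambda>x. 0)")
  case True then show ?thesis using ip_zero[OF assms(1)] ip_zero[OF zeroH] ip_sym assms by simp
next
  case False
  then have p: "0 < ip h h" using ip_pos assms by blast
  define t where "t = ip f h / ip h h"
  have "0 \<le> ip (\<lambda>x. f x - t * h x) (\<lambda>x. f x - t * h x)" by (intro ip_nonneg diffH scaleH assms)
  also have "\<dots> = ip f f - 2 * (t * ip f h) + t * (t * ip h h)"
    using assms by (simp add: ip_diff_self scaleH ip_scale2 ip_scale)
  also have "\<dots> = ip f f - (ip f h)\<^sup>2 / ip h h" using p by (simp add: t_def power2_eq_square)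
  finally have "(ip f h)\<^sup>2 \<le> ip f f * ip h h" using p by (simp add: field_simps)
  then have "sqrt ((ip f h)\<^sup>2) \<le> sqrt (ip f f * ip h h)" by (rule real_sqrt_le_mono)
  then show ?thesis by (simp add: real_sqrt_mult)
qed

text \<open>Convergence of all inner products to one number makes \<open>q t\<close> Cauchy in norm,
  because the squared distance is
  \<open>ip (q t) (q t) - 2 * ip (q t) (q s) + ip (q s) (q s)\<close>. Of the resulting norm limit
  only the consequence for inner products is recorded.\<close>

lemma weak_limit:
  fixes q :: "real \<Rightarrow> 'a \<Rightarrow> real"
  assumes q: "\<And>t. t \<noteq> 0 \<Longrightarrow> q t \<in> H"
    and lim: "\<And>e. e > 0 \<Longrightarrow> \<exists>\<eta>>0. \<forall>t s. t \<noteq> 0 \<and> s \<noteq> 0 \<and> \<bar>t\<bar> < \<eta> \<and> \<bar>s\<bar> < \<eta> \<longrightarrow> \<bar>ip (q t) (q s) - L\<bar> < e"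
  obtains \<eta> where "\<eta> \<in> H" "\<And>f. f \<in> H \<Longrightarrow> ((\<lambda>t. ip f (q t)) \<longlongrightarrow> ip f \<eta>) (at 0)"
proof -
  have cau: "\<exists>\<eta>>0. \<forall>t s. t \<noteq> 0 \<and> s \<noteq> 0 \<and> \<bar>t\<bar> < \<eta> \<and> \<bar>s\<bar> < \<eta> \<longrightarrow> sqrt (ip (\<lambda>x. q t x - q s x) (\<lambda>x. q t x - q s x)) < e"
    if e: "e > 0" for e
  proof -
    \<comment> \<open>The three inner products enter with weights 1, 2 and 1, so that errors below a
      quarter add up to less than \<open>e\<^sup>2\<close>.\<close>
    have "e\<^sup>2 / 4 > 0" using e by simp
    from lim[OF this] obtain \<eta> where \<eta>: "\<eta> > 0"
      "\<And>t s. t \<noteq> 0 \<Longrightarrow> s \<noteq> 0 \<Longrightarrow> \<bar>t\<bar> < \<eta> \<Longrightarrow> \<bar>s\<bar> < \<eta> \<Longrightarrow> \<bar>ip (q t) (q s) - L\<bar> < e\<^sup>2 / 4" by auto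
    have "sqrt (ip (\<lambda>x. q t x - q s x) (\<lambda>x. q t x - q s x)) < e" if ts: "t \<noteq> 0" "s \<noteq> 0" "\<bar>t\<bar> < \<eta>" "\<bar>s\<bar> < \<eta>" for t s
    proof -
      have "ip (\<lambda>x. q t x - q s x) (\<lambda>x. q t x - q s x) < e\<^sup>2"
        using \<eta>(2)[OF ts(1,1,3,3)] \<eta>(2)[OF ts] \<eta>(2)[OF ts(2,2,4,4)] ip_diff_self[OF q[OF ts(1)] q[OF ts(2)]]
        by linarith
      then show ?thesis using e by (metis less_le real_sqrt_less_mono real_sqrt_unique)
    qed
    then show ?thesis using \<eta>(1) by blast
  qed
  \<comment> \<open>Completeness is formulated for sequences: the limit is built along the
    reciprocals \<open>1 / (n + 1)\<close> and then shown to serve every \<open>t\<close> near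
    0.\<close>
  define F where "F n = q (inverse (real (Suc n)))" for n
  have FH: "F n \<in> H" for n unfolding F_def by (intro q) simp
  have inv: "\<exists>N. \<forall>i\<ge>N. \<bar>inverse (real (Suc i))\<bar> < \<eta>" if "\<eta> > 0" for \<eta> :: real
  proof -
    have "\<forall>\<^sub>F i in sequentially. inverse (real (Suc i)) < \<eta>"
      using order_tendstoD(2)[OF LIMSEQ_inverse_real_of_nat that] .
    then show ?thesis unfolding eventually_sequentially by simp
  qed
  have inz: "inverse (real (Suc i)) \<noteq> 0" for i by simp
  obtain \<eta> where \<eta>: "\<eta> \<in> H" "(\<lambda>n. sqrt (ip (\<lambda>x. F n x - \<eta> x) (\<lambda>x. F n x - \<eta> x))) \<longlonglongrightarrow> 0"
  proof (rule complete[OF FH])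
    fix e :: real assume "0 < e"
    from cau[OF this] obtain d where "d > 0" and d: "\<forall>t s. t \<noteq> 0 \<and> s \<noteq> 0 \<and> \<bar>t\<bar> < d \<and> \<bar>s\<bar> < d \<longrightarrow>
        sqrt (ip (\<lambda>x. q t x - q s x) (\<lambda>x. q t x - q s x)) < e" by blast
    then obtain N where "\<forall>i\<ge>N. \<bar>inverse (real (Suc i))\<bar> < d" using inv by blast
    then show "\<exists>N. \<forall>i\<ge>N. \<forall>j\<ge>N. sqrt (ip (\<lambda>x. F i x - F j x) (\<lambda>x. F i x - F j x)) < e"
      unfolding F_def using d inz by (intro exI[of _ N]) blast
  qed (rule that)
  show ?thesis
  proof (rule that[OF \<eta>(1)])
    fix f assume f: "f \<in> H"
    show "((\<lambda>t. ip f (q t)) \<longlongrightarrow> ip f \<eta>) (at 0)"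
      unfolding LIM_def dist_real_def
    proof (intro allI impI)
      fix e :: real assume e: "0 < e"
      define N where "N = sqrt (ip f f) + 1"
      have N: "N > 0" "sqrt (ip f f) \<le> N" using ip_nonneg[OF f] by (simp_all add: N_def add_nonneg_pos)
      have e2: "e / (2 * N) > 0" using e N by simp
      from cau[OF this] obtain d where d: "d > 0" "\<And>t s. t \<noteq> 0 \<Longrightarrow> s \<noteq> 0 \<Longrightarrow> \<bar>t\<bar> < d \<Longrightarrow> \<bar>s\<bar> < d \<Longrightarrow>
        sqrt (ip (\<lambda>x. q t x - q s x) (\<lambda>x. q t x - q s x)) < e / (2 * N)" by auto
      obtain N1 where N1: "\<forall>i\<ge>N1. \<bar>inverse (real (Suc i))\<bar> < d" using inv[OF d(1)] by blast
      obtain N2 where N2: "\<forall>n\<ge>N2. \<bar>sqrt (ip (\<lambda>x. F n x - \<eta> x) (\<lambda>x. F n x - \<eta> x)) - 0\<bar> < e / (2 * N)"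
        using \<eta>(2) e2 unfolding LIMSEQ_def dist_real_def by blast
      define n where "n = max N1 N2"
      show "\<exists>s>0. \<forall>t. t \<noteq> 0 \<and> \<bar>t - 0\<bar> < s \<longrightarrow> \<bar>ip f (q t) - ip f \<eta>\<bar> < e"
      proof (intro exI[of _ d] conjI d(1) allI impI)
        fix t :: real assume t: "t \<noteq> 0 \<and> \<bar>t - 0\<bar> < d"
        have qt: "q t \<in> H" using q t by simp
        have "\<bar>ip f (q t) - ip f \<eta>\<bar> = \<bar>ip f (\<lambda>x. q t x - F n x) + ip f (\<lambda>x. F n x - \<eta> x)\<bar>"
          using f qt \<eta>(1) FH by (simp add: ip_diff2)
        also have "\<dots> \<le> \<bar>ip f (\<lambda>x. q t x - F n x)\<bar> + \<bar>ip f (\<lambda>x. F n x - \<eta> x)\<bar>" by (rule abs_triangle_ineq)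
        also have "\<dots> \<le> sqrt (ip f f) * sqrt (ip (\<lambda>x. q t x - F n x) (\<lambda>x. q t x - F n x))
            + sqrt (ip f f) * sqrt (ip (\<lambda>x. F n x - \<eta> x) (\<lambda>x. F n x - \<eta> x))"
          by (intro add_mono Cauchy_Schwarz diffH f qt \<eta>(1) FH)
        also have "\<dots> \<le> N * sqrt (ip (\<lambda>x. q t x - F n x) (\<lambda>x. q t x - F n x))
            + N * sqrt (ip (\<lambda>x. F n x - \<eta> x) (\<lambda>x. F n x - \<eta> x))"
          using N by (intro add_mono mult_right_mono real_sqrt_ge_zero ip_nonneg diffH f qt \<eta>(1) FH) auto
        also have "\<dots> < N * (e / (2 * N)) + N * (e / (2 * N))"
        proof (intro add_strict_mono mult_strict_left_mono N(1))
          show "sqrt (ip (\<lambda>x. q t x - F n x) (\<lambda>x. q t x - F n x)) < e / (2 * N)"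
            unfolding F_def using t N1 inz by (intro d(2)) (auto simp: n_def)
          show "sqrt (ip (\<lambda>x. F n x - \<eta> x) (\<lambda>x. F n x - \<eta> x)) < e / (2 * N)"
            using N2[rule_format, of n] by (simp add: n_def)
        qed
        also have "\<dots> = e" using N by simp
        finally show "\<bar>ip f (q t) - ip f \<eta>\<bar> < e" .
      qed
    qed
  qed
qed

end

section \<open>Derivatives along curves as elements of the Hilbert space\<close>

text \<open>Only the ambient velocity is recorded, because the kernel sees the curve through
  \<open>\<psi>\<close>; the notion thus makes sense before charts enter.\<close>

definition smooth_curve :: "('a \<Rightarrow> 'e::real_normed_vector) \<Rightarrow> (real \<Rightarrow> 'a) \<Rightarrow> 'e \<Rightarrow> bool" where
  "smooth_curve \<psi> \<gamma> V \<longleftrightarrow> (\<exists>\<delta> \<alpha>'. \<delta> > 0 \<and> (\<forall>t. \<bar>t\<bar> < \<delta> \<longrightarrow> ((\<lambda>t. \<psi> (\<gamma> t)) has_vector_derivative \<alpha>' t) (at t)) \<and>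
     continuous_on {-\<delta><..<\<delta>} \<alpha>' \<and> \<alpha>' 0 = V)"

locale embedded_rkhs = C11_kernel \<kappa> + rkhs "\<lambda>x y. \<kappa> (\<psi> x) (\<psi> y)" H ip
  for \<kappa> :: "'e::euclidean_space \<Rightarrow> 'e \<Rightarrow> real" and \<psi> :: "'a \<Rightarrow> 'e" and H ip
begin

definition eta :: "'a \<Rightarrow> 'e \<Rightarrow> 'a \<Rightarrow> real" where
  "eta x V = (\<lambda>y. d1 V (\<psi> x) (\<psi> y))"

text \<open>Difference quotients of kernel sections along the curve are Cauchy by
  \<open>mixed_difference\<close>. Their limit represents the derivative, and its values are found
  by pairing it with kernel sections.\<close>

lemma curve_representer:
  assumes "smooth_curve \<psi> \<gamma> V"
  shows "eta (\<gamma> 0) V \<in> H" "\<And>f. f \<in> H \<Longrightarrow> ((\<lambda>t. f (\<gamma> t)) has_real_derivative ip f (eta (\<gamma> 0) V)) (at 0)"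
proof -
  obtain \<delta> \<alpha>' where \<delta>: "\<delta> > 0" and a: "\<And>t. \<bar>t\<bar> < \<delta> \<Longrightarrow> ((\<lambda>t. \<psi> (\<gamma> t)) has_vector_derivative \<alpha>' t) (at t)"
    and c: "continuous_on {-\<delta><..<\<delta>} \<alpha>'" and V: "\<alpha>' 0 = V"
    using assms unfolding smooth_curve_def by blast
  let ?K = "\<lambda>x y. \<kappa> (\<psi> y) (\<psi> x)"
  \<comment> \<open>Since \<open>inverse 0 = 0\<close>, the case \<open>t = 0\<close> gives the zero
    function, and membership in \<open>H\<close> holds for all \<open>t\<close>.\<close>
  define q where "q t = (\<lambda>y. inverse t * (?K (\<gamma> t) y - ?K (\<gamma> 0) y))" for t
  have qH: "q t \<in> H" for t unfolding q_def by (intro scaleH diffH KH)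
  have ipq: "ip f (q t) = (f (\<gamma> t) - f (\<gamma> 0)) / t" if "f \<in> H" for f t
    unfolding q_def using that by (simp add: ip_scale2 ip_diff2 diffH KH reproducing divide_inverse mult.commute)
  have "\<exists>\<eta>>0. \<forall>t s. t \<noteq> 0 \<and> s \<noteq> 0 \<and> \<bar>t\<bar> < \<eta> \<and> \<bar>s\<bar> < \<eta> \<longrightarrow> \<bar>ip (q t) (q s) - d12 V V (\<psi> (\<gamma> 0)) (\<psi> (\<gamma> 0))\<bar> < e"
    if "e > 0" for e
  proof -
    from mixed_difference[OF \<delta> a c a c that]
    obtain \<eta> where "\<eta> > 0" and \<eta>: "\<And>t s. t \<noteq> 0 \<and> s \<noteq> 0 \<and> \<bar>t\<bar> < \<eta> \<and> \<bar>s\<bar> < \<eta> \<Longrightarrow>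
      \<bar>(?K (\<gamma> s) (\<gamma> t) - ?K (\<gamma> 0) (\<gamma> t) - ?K (\<gamma> s) (\<gamma> 0) + ?K (\<gamma> 0) (\<gamma> 0)) / (t * s)
      - d12 (\<alpha>' 0) (\<alpha>' 0) (\<psi> (\<gamma> 0)) (\<psi> (\<gamma> 0))\<bar> < e" by auto
    moreover have "ip (q t) (q s) = (?K (\<gamma> s) (\<gamma> t) - ?K (\<gamma> 0) (\<gamma> t) - ?K (\<gamma> s) (\<gamma> 0) + ?K (\<gamma> 0) (\<gamma> 0)) / (t * s)"
      if "t \<noteq> 0" "s \<noteq> 0" for t s
      using that by (simp add: ipq[OF qH]) (simp add: q_def kernel_sym[of "\<psi> (\<gamma> s)"] kernel_sym[of "\<psi> (\<gamma> 0)" "\<psi> (\<gamma> t)"] field_simps)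
    ultimately show ?thesis using V by (intro exI[of _ \<eta>]) auto
  qed
  then obtain \<eta> where \<eta>: "\<eta> \<in> H" "\<And>f. f \<in> H \<Longrightarrow> ((\<lambda>t. ip f (q t)) \<longlongrightarrow> ip f \<eta>) (at 0)"
    by (rule weak_limit[OF qH]) (assumption | (rule that; assumption))+
  have D: "((\<lambda>t. f (\<gamma> t)) has_real_derivative ip f \<eta>) (at 0)" if "f \<in> H" for f
    using \<eta>(2)[OF that] unfolding has_field_derivative_iff by (simp add: ipq[OF that])
  have "\<eta> y = eta (\<gamma> 0) V y" for y
  proof -
    have "((\<lambda>t. ?K y (\<gamma> t)) has_real_derivative ip (?K y) \<eta>) (at 0)" by (rule D[OF KH])
    moreover have "((\<lambda>t. ?K y (\<gamma> t)) has_real_derivative d1 V (\<psi> (\<gamma> 0)) (\<psi> y)) (at 0)"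
      using curve_fst[OF a[of 0], of "\<psi> y"] \<delta> V by simp
    ultimately have "ip (?K y) \<eta> = d1 V (\<psi> (\<gamma> 0)) (\<psi> y)" by (rule DERIV_unique)
    then show ?thesis using reproducing[OF \<eta>(1), of y] ip_sym[OF \<eta>(1) KH] by (simp add: eta_def)
  qed
  then have "\<eta> = eta (\<gamma> 0) V" by blast
  then show "eta (\<gamma> 0) V \<in> H" "\<And>f. f \<in> H \<Longrightarrow> ((\<lambda>t. f (\<gamma> t)) has_real_derivative ip f (eta (\<gamma> 0) V)) (at 0)"
    using \<eta>(1) D by auto
qed

text \<open>The first representer is itself an element of \<open>H\<close>. Its derivative along the
  second curve is known twice: from \<open>curve_representer\<close>, and by differentiating the
  formula for \<open>eta\<close>.\<close>

lemma ip_eta: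
  assumes "smooth_curve \<psi> \<gamma> V" "smooth_curve \<psi> \<gamma>' V'"
  shows "ip (eta (\<gamma> 0) V) (eta (\<gamma>' 0) V') = d12 V V' (\<psi> (\<gamma> 0)) (\<psi> (\<gamma>' 0))"
proof -
  have "((\<lambda>t. eta (\<gamma> 0) V (\<gamma>' t)) has_real_derivative ip (eta (\<gamma> 0) V) (eta (\<gamma>' 0) V')) (at 0)"
    by (rule curve_representer(2)[OF assms(2) curve_representer(1)[OF assms(1)]])
  moreover have "((\<lambda>t. \<psi> (\<gamma>' t)) has_vector_derivative V') (at 0)"
    using assms(2) unfolding smooth_curve_def by (metis abs_zero)
  from curve_snd[OF this] have "((\<lambda>t. eta (\<gamma> 0) V (\<gamma>' t)) has_real_derivative d12 V V' (\<psi> (\<gamma> 0)) (\<psi> (\<gamma>' 0))) (at 0)"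
    unfolding eta_def .
  ultimately show ?thesis by (rule DERIV_unique)
qed

end

section \<open>Charts and vector fields\<close>

text \<open>Convex combinations of \<open>M\<close> with the identity stay positive definite, hence
  invertible, so the determinant cannot change sign on its way from 1 to
  \<open>det M\<close>.\<close>

lemma posdef_det_pos:
  fixes M :: "real ^ 'n ^ 'n"
  assumes pd: "\<And>y. y \<noteq> 0 \<Longrightarrow> 0 < y \<bullet> (M *v y)" shows "0 < det M"
proof -
  have nz: "det N \<noteq> 0" if "\<And>y. y \<noteq> 0 \<Longrightarrow> 0 < y \<bullet> (N *v y)" for N :: "real ^ 'n ^ 'n"
  proof
    assume "det N = 0"
    then have "\<not> invertible N" by (simp add: invertible_det_nz)
    then obtain y where "y \<noteq> 0" "N *v y = 0"
      by (metis invertible_left_inverse matrix_left_invertible_ker)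
    then show False using that by force
  qed
  define N where "N t = t *\<^sub>R M + (1 - t) *\<^sub>R mat 1" for t :: real
  have comp: "N t $ i $ j = t * M $ i $ j + (1 - t) * mat 1 $ i $ j" for t i j by (simp add: N_def)
  have c: "continuous_on {0..1} (\<lambda>t. det (N t))"
    unfolding det_def comp by (intro continuous_intros)
  have nzt: "det (N t) \<noteq> 0" if t: "0 \<le> t" "t \<le> 1" for t
  proof (rule nz)
    fix y :: "real ^ 'n" assume y: "y \<noteq> 0"
    have "N t *v y = t *\<^sub>R (M *v y) + (1 - t) *\<^sub>R y"
      unfolding N_def by (simp add: matrix_vector_mult_add_rdistrib scaleR_matrix_vector_assoc[symmetric])
    then have eq: "y \<bullet> (N t *v y) = t * (y \<bullet> (M *v y)) + (1 - t) * (y \<bullet> y)" by (simp add: inner_right_distrib)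
    show "0 < y \<bullet> (N t *v y)"
    proof (cases "t = 0")
      case True then show ?thesis using eq y by simp
    next
      case False
      then have "0 < t * (y \<bullet> (M *v y))" using t pd[OF y] by simp
      moreover have "0 \<le> (1 - t) * (y \<bullet> y)" using t by simp
      ultimately show ?thesis using eq by linarith
    qed
  qed
  have N01: "N 0 = mat 1" "N 1 = M" by (simp_all add: N_def)
  show ?thesis
  proof (rule ccontr)
    assume "\<not> 0 < det M"
    then have "\<exists>t\<ge>0. t \<le> 1 \<and> det (N t) = 0"
      using c by (intro IVT2') (auto simp: N01)
    then show False using nzt by blast
  qed
qed

locale smooth_manifold =
  fixes A :: "('a::{t2_space, second_countable_topology}, 'n::finite) chart set"
  assumes atlas: "smooth_atlas A"
begin

abbreviation img where "img c \<equiv> snd c ` fst c"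

lemma is_chart: "c \<in> A \<Longrightarrow> is_chart c"
  and charts_cover: "\<exists>c\<in>A. x \<in> fst c"
  and smooth_transition: "c \<in> A \<Longrightarrow> c' \<in> A \<Longrightarrow> smooth_on (snd c ` (fst c \<inter> fst c')) (snd c' \<circ> chart_inv c)"
  using atlas unfolding smooth_atlas_def by blast+

lemma open_dom: "c \<in> A \<Longrightarrow> open (fst c)"
  and open_img: "c \<in> A \<Longrightarrow> open (img c)"
  and cont_coord: "c \<in> A \<Longrightarrow> continuous_on (fst c) (snd c)"
  and cont_inv: "c \<in> A \<Longrightarrow> continuous_on (img c) (chart_inv c)"
  and inv_coord: "c \<in> A \<Longrightarrow> x \<in> fst c \<Longrightarrow> chart_inv c (snd c x) = x"
  and coord_inv: "c \<in> A \<Longrightarrow> u \<in> img c \<Longrightarrow> snd c (chart_inv c u) = u"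
  and inv_dom: "c \<in> A \<Longrightarrow> u \<in> img c \<Longrightarrow> chart_inv c u \<in> fst c"
  using is_chart[of c] unfolding is_chart_def homeomorphism_def by auto

lemma chart_at: "chart_at A x \<in> A" "x \<in> fst (chart_at A x)"
  using someI_ex[of "\<lambda>c. c \<in> A \<and> x \<in> fst c"] charts_cover[of x] unfolding chart_at_def by blast+

lemma img_restrict:
  assumes c: "c \<in> A" shows "snd c ` (fst c \<inter> W) = img c \<inter> chart_inv c -` W"
proof (intro equalityI subsetI)
  fix u assume "u \<in> snd c ` (fst c \<inter> W)"
  then show "u \<in> img c \<inter> chart_inv c -` W" using inv_coord[OF c] by auto
next
  fix u assume u: "u \<in> img c \<inter> chart_inv c -` W"
  then have "chart_inv c u \<in> fst c \<inter> W" "u = snd c (chart_inv c u)" using coord_inv[OF c, of u] inv_dom[OF c, of u] by auto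
  then show "u \<in> snd c ` (fst c \<inter> W)" by (rule rev_image_eqI)
qed

lemma open_img_restrict: "c \<in> A \<Longrightarrow> open W \<Longrightarrow> open (snd c ` (fst c \<inter> W))"
  using img_restrict cont_inv open_img continuous_open_preimage by metis

lemma open_inv_image:
  assumes c: "c \<in> A" and U: "open U" "U \<subseteq> img c"
  shows "open (chart_inv c ` U)"
proof -
  have "chart_inv c ` U = fst c \<inter> snd c -` U"
  proof (intro equalityI subsetI)
    fix x assume "x \<in> fst c \<inter> snd c -` U"
    then show "x \<in> chart_inv c ` U" using inv_coord[OF c, of x] by (intro image_eqI[of _ _ "snd c x"]) auto
  qed (use coord_inv[OF c] inv_dom[OF c] U(2) in auto)
  then show ?thesis using continuous_open_preimage[OF cont_coord[OF c] open_dom[OF c] U(1)] by simp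
qed

lemma continuous_chartwise:
  fixes f :: "'a \<Rightarrow> 'w::t2_space"
  assumes "\<And>c. c \<in> A \<Longrightarrow> continuous_on (img c) (f \<circ> chart_inv c)"
  shows "continuous_on UNIV f"
proof -
  have "isCont f x" for x
  proof -
    obtain c where c: "c \<in> A" "x \<in> fst c" using charts_cover by blast
    have "continuous_on (fst c) (\<lambda>x. (f \<circ> chart_inv c) (snd c x))"
      by (rule continuous_on_compose2[OF assms[OF c(1)] cont_coord[OF c(1)]]) auto
    then have "continuous_on (fst c) f" using inv_coord[OF c(1)] by (simp cong: continuous_on_cong)
    then show ?thesis using c open_dom by (simp add: continuous_on_eq_continuous_at)
  qed
  then show ?thesis by (simp add: continuous_at_imp_continuous_on)
qed

definition chart_deriv :: "('a, 'n) chart \<Rightarrow> ('a \<Rightarrow> 'w::real_normed_vector) \<Rightarrow> 'a \<Rightarrow> real ^ 'n \<Rightarrow> 'w" where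
  "chart_deriv c f x = frechet_derivative (f \<circ> chart_inv c) (at (snd c x))"

lemma coord_change_has_derivative:
  assumes "c \<in> A" "c' \<in> A" "x \<in> fst c" "x \<in> fst c'"
  shows "((snd c' \<circ> chart_inv c) has_derivative coord_change c c' x) (at (snd c x))"
  unfolding coord_change_def
  by (rule C1_on_has_derivative[OF smooth_on_imp_C1_on[OF smooth_transition[OF assms(1,2)]]]) (use assms in auto)

lemma chart_deriv_change:
  assumes c: "c \<in> A" "c' \<in> A" "x \<in> fst c" "x \<in> fst c'"
    and f: "(f \<circ> chart_inv c') differentiable (at (snd c' x))"
  shows "((f \<circ> chart_inv c) has_derivative (\<lambda>v. chart_deriv c' f x (coord_change c c' x v))) (at (snd c x))"
proof -
  have "((f \<circ> chart_inv c') has_derivative chart_deriv c' f x) (at ((snd c' \<circ> chart_inv c) (snd c x)))"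
    using f c inv_coord[OF c(1,3)] unfolding chart_deriv_def by (simp add: frechet_derivative_works)
  from diff_chain_at[OF coord_change_has_derivative[OF c] this]
  have "((f \<circ> chart_inv c') \<circ> (snd c' \<circ> chart_inv c) has_derivative chart_deriv c' f x \<circ> coord_change c c' x) (at (snd c x))" .
  moreover have "((f \<circ> chart_inv c') \<circ> (snd c' \<circ> chart_inv c)) u = (f \<circ> chart_inv c) u" if "u \<in> snd c ` (fst c \<inter> fst c')" for u
    using that inv_coord[OF c(1)] inv_coord[OF c(2)] by auto
  ultimately show ?thesis
    using has_derivative_transform_within_open[of _ _ "snd c x" UNIV "snd c ` (fst c \<inter> fst c')" "f \<circ> chart_inv c"]
      open_img_restrict[OF c(1) open_dom[OF c(2)]] c(3,4) by (auto simp: o_def)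
qed

lemma chart_deriv_change_eq:
  assumes "c \<in> A" "c' \<in> A" "x \<in> fst c" "x \<in> fst c'" "(f \<circ> chart_inv c') differentiable (at (snd c' x))"
  shows "chart_deriv c f x v = chart_deriv c' f x (coord_change c c' x v)"
  unfolding chart_deriv_def[of c] using frechet_derivative_at[OF chart_deriv_change[OF assms]] by (rule fun_cong[symmetric])

text \<open>The chain rule for \<open>chart_deriv\<close>, with the coordinate map
  \<open>snd c''\<close> as the function on the manifold.\<close>

lemma coord_change_cocycle:
  assumes "c \<in> A" "c' \<in> A" "c'' \<in> A" "x \<in> fst c" "x \<in> fst c'" "x \<in> fst c''"
  shows "coord_change c c'' x v = coord_change c' c'' x (coord_change c c' x v)"
proof -
  have "(snd c'' \<circ> chart_inv c') differentiable (at (snd c' x))"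
    by (rule differentiableI[OF coord_change_has_derivative[OF assms(2,3,5,6)]])
  from chart_deriv_change_eq[OF assms(1,2,4,5) this, of v] show ?thesis
    unfolding chart_deriv_def coord_change_def .
qed

lemma coord_change_self:
  assumes "c \<in> A" "x \<in> fst c" shows "coord_change c c x v = v"
proof -
  have "frechet_derivative (snd c \<circ> chart_inv c) (at (snd c x)) = frechet_derivative (\<lambda>u. u) (at (snd c x))"
    by (rule frechet_derivative_cong_open[OF open_img[OF assms(1)]]) (use assms coord_inv in auto)
  then show ?thesis unfolding coord_change_def by (simp add: frechet_derivative_ident)
qed

lemma tangent_change:
  assumes "v \<in> tangent_space A x" "c \<in> A" "c' \<in> A" "x \<in> fst c" "x \<in> fst c'"
  shows "v c' = coord_change c c' x (v c)"
  using assms unfolding tangent_space_def by blast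

lemma tangent_outside: "v \<in> tangent_space A x \<Longrightarrow> c \<notin> A \<or> x \<notin> fst c \<Longrightarrow> v c = 0"
  unfolding tangent_space_def by blast

lemma tangent_spaceI:
  assumes "\<And>c c'. c \<in> A \<Longrightarrow> c' \<in> A \<Longrightarrow> x \<in> fst c \<Longrightarrow> x \<in> fst c' \<Longrightarrow> v c' = coord_change c c' x (v c)"
    and "\<And>c. c \<notin> A \<or> x \<notin> fst c \<Longrightarrow> v c = 0"
  shows "v \<in> tangent_space A x"
  unfolding tangent_space_def
proof (intro CollectI conjI ballI allI impI)
  fix c c' assume "c \<in> A" "c' \<in> A" "x \<in> fst c \<inter> fst c'"
  then show "v c' = coord_change c c' x (v c)" by (intro assms(1)) simp_all
qed (rule assms(2))

lemma coord_change_linear: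
  "c \<in> A \<Longrightarrow> c' \<in> A \<Longrightarrow> x \<in> fst c \<Longrightarrow> x \<in> fst c' \<Longrightarrow> linear (coord_change c c' x)"
  by (rule has_derivative_linear[OF coord_change_has_derivative])

lemma tangent_vector_exists:
  assumes c: "c \<in> A" "x \<in> fst c"
  shows "(\<lambda>c'. if c' \<in> A \<and> x \<in> fst c' then coord_change c c' x e else 0) \<in> tangent_space A x"
proof (rule tangent_spaceI)
  fix c1 c2 assume "c1 \<in> A" "c2 \<in> A" "x \<in> fst c1" "x \<in> fst c2"
  then show "(if c2 \<in> A \<and> x \<in> fst c2 then coord_change c c2 x e else 0) =
      coord_change c1 c2 x (if c1 \<in> A \<and> x \<in> fst c1 then coord_change c c1 x e else 0)"
    using coord_change_cocycle[of c c1 c2 x e] c by (simp only: if_True simp_thms)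
qed auto

lemma coord_vector_tangent: "c \<in> A \<Longrightarrow> x \<in> fst c \<Longrightarrow> coord_vector A c i x \<in> tangent_space A x"
  unfolding coord_vector_def by (rule tangent_vector_exists)

lemma coord_vector_self: "c \<in> A \<Longrightarrow> x \<in> fst c \<Longrightarrow> coord_vector A c i x c = axis i 1"
  unfolding coord_vector_def by (simp add: coord_change_self)

lemma spans_chart:
  assumes "spans_tangent_space A x I V" "c \<in> A" "x \<in> fst c"
  obtains a where "e = (\<Sum>l\<in>I. a l *\<^sub>R V l c)"
proof -
  obtain a where "(\<lambda>c'. if c' \<in> A \<and> x \<in> fst c' then coord_change c c' x e else 0) = (\<lambda>c. \<Sum>l\<in>I. a l *\<^sub>R V l c)"
    using assms(1) tangent_vector_exists[OF assms(2,3)] unfolding spans_tangent_space_def by blast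
  from fun_cong[OF this, of c] show ?thesis using assms(2,3) that by (simp add: coord_change_self)
qed

section \<open>C1 functions and derivatives along vector fields\<close>

definition C1_fun :: "('a \<Rightarrow> 'w::real_normed_vector) \<Rightarrow> bool" where
  "C1_fun f \<longleftrightarrow> (\<forall>c\<in>A. C1_on (img c) (f \<circ> chart_inv c))"

lemma Ck_manifold_imp_C1_fun: "Ck_manifold A (Suc k) f \<Longrightarrow> C1_fun f"
  unfolding Ck_manifold_def C1_fun_def using Ck_on_Suc_imp_C1_on by blast

lemma C1_fun_continuous: "C1_fun f \<Longrightarrow> continuous_on UNIV f"
  unfolding C1_fun_def by (intro continuous_chartwise C1_on_imp_continuous_on) auto

lemma C1_funD: "C1_fun f \<Longrightarrow> c \<in> A \<Longrightarrow> C1_on (img c) (f \<circ> chart_inv c)"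
  unfolding C1_fun_def by blast

lemma C1_fun_has_derivative:
  "C1_fun f \<Longrightarrow> c \<in> A \<Longrightarrow> x \<in> fst c \<Longrightarrow> ((f \<circ> chart_inv c) has_derivative chart_deriv c f x) (at (snd c x))"
  unfolding chart_deriv_def by (rule C1_on_has_derivative[OF C1_funD]) auto

lemma C1_fun_differentiable:
  "C1_fun f \<Longrightarrow> c \<in> A \<Longrightarrow> x \<in> fst c \<Longrightarrow> (f \<circ> chart_inv c) differentiable (at (snd c x))"
  using C1_fun_has_derivative differentiable_def by blast

lemma C1_fun_compose:
  fixes f :: "'a \<Rightarrow> 'v::euclidean_space"
  assumes "C1_on T F" "C1_fun f" "range f \<subseteq> T" shows "C1_fun (\<lambda>x. F (f x))"
  unfolding C1_fun_def
proof
  fix c assume c: "c \<in> A"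
  have "C1_on (img c) (\<lambda>u. F ((f \<circ> chart_inv c) u))"
    by (rule C1_on_compose[OF assms(1) C1_funD[OF assms(2) c]]) (use assms(3) in auto)
  then show "C1_on (img c) ((\<lambda>x. F (f x)) \<circ> chart_inv c)" by (simp add: o_def)
qed

lemma C1_fun_mult:
  fixes f h :: "'a \<Rightarrow> real"
  assumes "C1_fun f" "C1_fun h" shows "C1_fun (\<lambda>x. f x * h x)"
  using assms unfolding C1_fun_def o_def by (auto intro: C1_on_mult)

lemma C1_fun_const: "C1_fun (\<lambda>x. c)"
  unfolding C1_fun_def o_def by simp

lemma vf_deriv_chart:
  assumes X: "X x \<in> tangent_space A x" and c: "c \<in> A" "x \<in> fst c"
    and f: "(f \<circ> chart_inv c) differentiable (at (snd c x))"
  shows "vf_deriv A X f x = chart_deriv c f x (X x c)"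
proof -
  let ?c = "chart_at A x"
  have "vf_deriv A X f x = chart_deriv ?c f x (X x ?c)" by (simp add: vf_deriv_def chart_deriv_def Let_def)
  also have "\<dots> = chart_deriv c f x (coord_change ?c c x (X x ?c))"
    by (rule chart_deriv_change_eq[OF chart_at(1) c(1) chart_at(2) c(2) f])
  also have "coord_change ?c c x (X x ?c) = X x c"
    using tangent_change[OF X chart_at(1) c(1) chart_at(2) c(2)] by simp
  finally show ?thesis .
qed

lemma vf_deriv_C1:
  "X x \<in> tangent_space A x \<Longrightarrow> C1_fun f \<Longrightarrow> c \<in> A \<Longrightarrow> x \<in> fst c \<Longrightarrow> vf_deriv A X f x = chart_deriv c f x (X x c)"
  by (intro vf_deriv_chart C1_fun_differentiable)

lemma vector_field_tangent: "smooth_vector_field A X \<Longrightarrow> X x \<in> tangent_space A x"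
  and vector_field_C1: "smooth_vector_field A X \<Longrightarrow> c \<in> A \<Longrightarrow> C1_on (img c) (\<lambda>u. X (chart_inv c u) c)"
  unfolding smooth_vector_field_def using smooth_on_imp_C1_on by blast+

text \<open>The differential of \<open>f\<close> applied to \<open>X\<close>. For
  \<open>f = \<psi>\<close> it is the ambient velocity field, through which derivatives along
  \<open>X\<close> meet the kernel.\<close>

definition push :: "('a \<Rightarrow> 'w::real_normed_vector) \<Rightarrow> ('a \<Rightarrow> ('a, 'n) tvec) \<Rightarrow> 'a \<Rightarrow> 'w" where
  "push f X x = chart_deriv (chart_at A x) f x (X x (chart_at A x))"

lemma push_chart:
  assumes X: "X x \<in> tangent_space A x" and f: "C1_fun f" and c: "c \<in> A" "x \<in> fst c"
  shows "push f X x = chart_deriv c f x (X x c)"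
  unfolding push_def
    chart_deriv_change_eq[OF chart_at(1) c(1) chart_at(2) c(2) C1_fun_differentiable[OF f c]]
  using tangent_change[OF X chart_at(1) c(1) chart_at(2) c(2)] by simp

lemma vf_deriv_push: "X x \<in> tangent_space A x \<Longrightarrow> C1_fun f \<Longrightarrow> vf_deriv A X f x = push f X x"
  using vf_deriv_C1[OF _ _ chart_at, of X x f] unfolding push_def by simp

lemma continuous_push:
  fixes f :: "'a \<Rightarrow> 'w::real_normed_vector"
  assumes X: "smooth_vector_field A X" and f: "C1_fun f" shows "continuous_on UNIV (push f X)"
proof (rule continuous_chartwise)
  fix c assume c: "c \<in> A"
  have "continuous_on (img c) (\<lambda>u. frechet_derivative (f \<circ> chart_inv c) (at u) (X (chart_inv c u) c))"
    by (rule C1_on_joint_continuous[OF C1_funD[OF f c]])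
      (auto intro: continuous_on_id C1_on_imp_continuous_on vector_field_C1[OF X c])
  then show "continuous_on (img c) (push f X \<circ> chart_inv c)"
    using c coord_inv[OF c] inv_dom[OF c]
    by (simp add: push_chart[OF vector_field_tangent[OF X] f c] chart_deriv_def cong: continuous_on_cong_simp)
qed

lemma vf_deriv_compose:
  fixes f :: "'a \<Rightarrow> 'w::real_normed_vector"
  assumes X: "X x \<in> tangent_space A x" and f: "C1_fun f" and F: "(F has_derivative F') (at (f x))"
  shows "vf_deriv A X (\<lambda>y. F (f y)) x = F' (push f X x)"
proof -
  let ?c = "chart_at A x"
  have "((\<lambda>y. F (f y)) \<circ> chart_inv ?c has_derivative (\<lambda>v. F' (chart_deriv ?c f x v))) (at (snd ?c x))"
    unfolding o_def
    by (rule has_derivative_compose[OF C1_fun_has_derivative[OF f chart_at, unfolded o_def]])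
      (simp add: F inv_coord[OF chart_at])
  from frechet_derivative_at[OF this] show ?thesis
    by (simp add: vf_deriv_def Let_def push_def) metis
qed

lemma vf_deriv_mult:
  fixes f h :: "'a \<Rightarrow> real"
  assumes X: "X x \<in> tangent_space A x" and f: "C1_fun f" and h: "C1_fun h"
  shows "vf_deriv A X (\<lambda>y. f y * h y) x = f x * vf_deriv A X h x + vf_deriv A X f x * h x"
proof -
  let ?c = "chart_at A x"
  have "((\<lambda>u. (f \<circ> chart_inv ?c) u * (h \<circ> chart_inv ?c) u) has_derivative
      (\<lambda>v. (f \<circ> chart_inv ?c) (snd ?c x) * chart_deriv ?c h x v + chart_deriv ?c f x v * (h \<circ> chart_inv ?c) (snd ?c x))) (at (snd ?c x))"
    by (intro has_derivative_mult C1_fun_has_derivative f h chart_at)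
  then have "((\<lambda>y. f y * h y) \<circ> chart_inv ?c has_derivative
      (\<lambda>v. f x * chart_deriv ?c h x v + chart_deriv ?c f x v * h x)) (at (snd ?c x))"
    by (simp add: o_def inv_coord[OF chart_at])
  from frechet_derivative_at[OF this] have "chart_deriv ?c (\<lambda>y. f y * h y) x = (\<lambda>v. f x * chart_deriv ?c h x v + chart_deriv ?c f x v * h x)"
    by (simp add: chart_deriv_def)
  then show ?thesis
    using vf_deriv_C1[of X x f, OF X f chart_at] vf_deriv_C1[of X x h, OF X h chart_at]
      vf_deriv_C1[of X x, OF X C1_fun_mult[OF f h] chart_at] by simp
qed

end

section \<open>Volume and divergence\<close>

locale riemannian_manifold = smooth_manifold A
  for A :: "('a::{t2_space, second_countable_topology}, 'n::finite) chart set" +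
  fixes g :: "'a \<Rightarrow> ('a, 'n) tvec \<Rightarrow> ('a, 'n) tvec \<Rightarrow> real" and vol :: "'a measure"
  assumes metric: "riemannian_metric A g" and volume: "is_riemannian_volume A g vol"
begin

lemma metric_props:
  assumes "u \<in> tangent_space A x" "v \<in> tangent_space A x" "w \<in> tangent_space A x"
  shows "g x u v = g x v u" "g x (\<lambda>c. u c + v c) w = g x u w + g x v w"
    "g x (\<lambda>c. r *\<^sub>R u c) w = r * g x u w" "u \<noteq> (\<lambda>c. 0) \<Longrightarrow> 0 < g x u u"
  using metric[unfolded riemannian_metric_def, THEN conjunct1, THEN spec[of _ x], THEN bspec[OF _ assms(1)],
    THEN bspec[OF _ assms(2)], THEN bspec[OF _ assms(3)], THEN spec[of _ r]] by simp_all

text \<open>Tangency of the partial sums is proved together with the formula, because the metric is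
  linear on tangent spaces only.\<close>

lemma metric_sum_left:
  assumes "finite I" "\<And>i. i \<in> I \<Longrightarrow> E i \<in> tangent_space A x" "w \<in> tangent_space A x"
  shows "(\<lambda>c. \<Sum>i\<in>I. y i *\<^sub>R E i c) \<in> tangent_space A x \<and>
    g x (\<lambda>c. \<Sum>i\<in>I. y i *\<^sub>R E i c) w = (\<Sum>i\<in>I. y i * g x (E i) w)"
proof -
  have T0: "(\<lambda>c. 0) \<in> tangent_space A x"
    by (rule tangent_spaceI) (simp_all add: linear_0[OF coord_change_linear])
  have T1: "(\<lambda>c. u c + v c) \<in> tangent_space A x" if uv: "u \<in> tangent_space A x" "v \<in> tangent_space A x" for u v
  proof (rule tangent_spaceI)
    fix c c' assume c: "c \<in> A" "c' \<in> A" "x \<in> fst c" "x \<in> fst c'"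
    show "u c' + v c' = coord_change c c' x (u c + v c)"
      by (simp only: linear_add[OF coord_change_linear[OF c]] tangent_change[OF uv(1) c] tangent_change[OF uv(2) c])
  qed (simp add: tangent_outside[OF uv(1)] tangent_outside[OF uv(2)])
  have T2: "(\<lambda>c. r *\<^sub>R u c) \<in> tangent_space A x" if u: "u \<in> tangent_space A x" for u r
  proof (rule tangent_spaceI)
    fix c c' assume c: "c \<in> A" "c' \<in> A" "x \<in> fst c" "x \<in> fst c'"
    show "r *\<^sub>R u c' = coord_change c c' x (r *\<^sub>R u c)"
      by (simp only: linear_cmul[OF coord_change_linear[OF c]] tangent_change[OF u c])
  qed (simp add: tangent_outside[OF u])
  have g1: "g x (\<lambda>c. u c + v c) w = g x u w + g x v w" if "u \<in> tangent_space A x" "v \<in> tangent_space A x" for u v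
    by (rule metric_props(2)[OF that assms(3)])
  have g2: "g x (\<lambda>c. r *\<^sub>R u c) w = r * g x u w" if "u \<in> tangent_space A x" for u r
    by (rule metric_props(3)[OF that that assms(3)])
  have g0: "g x (\<lambda>c. 0) w = 0" using g2[OF T0, of 0] by simp
  show ?thesis using assms(1,2)
    by (induction I rule: finite_induct) (auto simp: T0 g0 T1 T2 g1 g2)
qed

text \<open>The quadratic form of the Gram matrix at \<open>y\<close> is the metric evaluated at the
  tangent vector with coordinates \<open>y\<close>.\<close>

lemma metric_det_pos:
  assumes c: "c \<in> A" and u: "u \<in> img c"
  shows "0 < det (metric_matrix A g c u)"
proof (rule posdef_det_pos)
  fix y :: "real ^ 'n" assume y: "y \<noteq> 0"
  let ?x = "chart_inv c u"
  let ?E = "\<lambda>i. coord_vector A c i ?x"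
  have x: "?x \<in> fst c" by (rule inv_dom[OF c u])
  have E: "?E i \<in> tangent_space A ?x" for i by (rule coord_vector_tangent[OF c x])
  define v where "v = (\<lambda>c. \<Sum>i\<in>UNIV. (y $ i) *\<^sub>R ?E i c)"
  have v: "v \<in> tangent_space A ?x" unfolding v_def using metric_sum_left[of UNIV ?E, OF _ E E] by auto
  have "v c = y" unfolding v_def coord_vector_self[OF c x]
    by (simp add: vec_eq_iff axis_def if_distrib sum.delta cong: if_cong)
  then have "v \<noteq> (\<lambda>c. 0)" using y by auto
  then have "0 < g ?x v v" by (rule metric_props(4)[OF v v v])
  also have "g ?x v v = (\<Sum>i\<in>UNIV. y $ i * g ?x (?E i) v)"
    using metric_sum_left[of UNIV ?E, OF _ E v] unfolding v_def by simp
  also have "\<dots> = (\<Sum>i\<in>UNIV. y $ i * (\<Sum>j\<in>UNIV. y $ j * g ?x (?E i) (?E j)))"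
  proof (intro sum.cong refl arg_cong2[where f = "(*)"])
    fix i
    have sm: "g ?x a b = g ?x b a" if "a \<in> tangent_space A ?x" "b \<in> tangent_space A ?x" for a b
      by (rule metric_props(1)[OF that that(1)])
    have "g ?x (?E i) v = g ?x v (?E i)" by (rule sm[OF E v])
    also have "\<dots> = (\<Sum>j\<in>UNIV. y $ j * g ?x (?E j) (?E i))"
      using metric_sum_left[of UNIV ?E, OF _ E E] unfolding v_def by simp
    also have "\<dots> = (\<Sum>j\<in>UNIV. y $ j * g ?x (?E i) (?E j))" by (intro sum.cong refl arg_cong2[where f = "(*)"] sm E)
    finally show "g ?x (?E i) v = (\<Sum>j\<in>UNIV. y $ j * g ?x (?E i) (?E j))" .
  qed
  also have "\<dots> = y \<bullet> (metric_matrix A g c u *v y)"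
    by (simp add: inner_vec_def matrix_vector_mult_def metric_matrix_def Let_def mult.commute)
  finally show "0 < y \<bullet> (metric_matrix A g c u *v y)" .
qed

definition vdens :: "('a, 'n) chart \<Rightarrow> real ^ 'n \<Rightarrow> real" where
  "vdens c u = sqrt (det (metric_matrix A g c u))"

lemma vdens_pos: "c \<in> A \<Longrightarrow> u \<in> img c \<Longrightarrow> 0 < vdens c u"
  unfolding vdens_def using metric_det_pos by simp

lemma vdens_C1: "c \<in> A \<Longrightarrow> C1_on (img c) (vdens c)"
  unfolding vdens_def[abs_def]
proof (intro C1_on_sqrt C1_on_det C1_on_mat_nth)
  assume c: "c \<in> A"
  show "C1_on (img c) (metric_matrix A g c)"
    using metric c unfolding riemannian_metric_def by (intro smooth_on_imp_C1_on) blast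
qed (rule metric_det_pos)

lemma sets_vol [simp, measurable_cong]: "sets vol = sets borel"
  using volume unfolding is_riemannian_volume_def by blast

text \<open>The volume measure is given by its values on Borel sets inside a chart. Read as an
  equality of two Borel measures on the whole manifold, this transports integrals and integrability
  together.\<close>

lemma integral_chart:
  fixes f :: "'a \<Rightarrow> real"
  assumes c: "c \<in> A" and f: "f \<in> borel_measurable borel" "\<And>x. x \<notin> fst c \<Longrightarrow> f x = 0"
  shows "(\<integral>x. f x \<partial>vol) = (\<integral>u. (if u \<in> img c then vdens c u * f (chart_inv c u) else 0) \<partial>lborel)" (is ?A)
    and "integrable vol f \<longleftrightarrow> integrable lborel (\<lambda>u. if u \<in> img c then vdens c u * f (chart_inv c u) else 0)" (is ?B)
proof -
  have "?A \<and> ?B"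
  proof (cases "fst c = {}")
  case True
  then have "f = (\<lambda>_. 0)" using f(2) by auto
  then show ?thesis using True by simp
next
  case False
  then obtain x0 where x0: "x0 \<in> fst c" by blast
  \<comment> \<open>A constant value outside the chart image makes the inverse chart a total Borel
    map; the density \<open>d\<close> gives those points no mass.\<close>
  define j where "j u = (if u \<in> img c then chart_inv c u else x0)" for u
  have [measurable]: "img c \<in> sets borel" "fst c \<in> sets borel" using open_img[OF c] open_dom[OF c] by auto
  have jm [measurable]: "j \<in> borel_measurable borel"
    unfolding j_def by (rule borel_measurable_continuous_on_if) (auto intro: cont_inv[OF c])
  define d where "d u = (if u \<in> img c then vdens c u else 0)" for u
  have dm [measurable]: "d \<in> borel_measurable borel"
    unfolding d_def by (rule borel_measurable_continuous_on_if) (auto intro: C1_on_imp_continuous_on vdens_C1[OF c])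
  have d0: "0 \<le> d u" for u using vdens_pos[OF c, of u] by (cases "u \<in> img c") (auto simp: d_def)
  have eq: "distr (density lborel (\<lambda>u. ennreal (d u))) borel j = density vol (\<lambda>x. ennreal (indicator (fst c) x))"
  proof (rule measure_eqI)
    fix B assume "B \<in> sets (distr (density lborel (\<lambda>u. ennreal (d u))) borel j)"
    then have B [measurable]: "B \<in> sets borel" by simp
    have "emeasure (distr (density lborel (\<lambda>u. ennreal (d u))) borel j) B = (\<integral>\<^sup>+u. ennreal (d u) * indicator (j -` B) u \<partial>lborel)"
      using measurable_sets[OF jm B] by (subst emeasure_distr) (auto simp: emeasure_density)
    also have "\<dots> = (\<integral>\<^sup>+u. ennreal (sqrt (det (metric_matrix A g c u))) * indicator (snd c ` (fst c \<inter> B)) u \<partial>lborel)"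
      by (intro nn_integral_cong) (auto simp: img_restrict[OF c] d_def j_def vdens_def indicator_def)
    also have "\<dots> = emeasure vol (fst c \<inter> B)"
    proof -
      have "fst c \<inter> B \<in> sets borel" by measurable
      then have "emeasure vol (fst c \<inter> B) = (\<integral>\<^sup>+u\<in>snd c ` (fst c \<inter> B). ennreal (sqrt (det (metric_matrix A g c u))) \<partial>lborel)"
        using volume c unfolding is_riemannian_volume_def by blast
      then show ?thesis by simp
    qed
    also have "\<dots> = emeasure (density vol (\<lambda>x. ennreal (indicator (fst c) x))) B"
      by (subst emeasure_density) (auto simp: ennreal_indicator indicator_inter_arith[symmetric])
    finally show "emeasure (distr (density lborel (\<lambda>u. ennreal (d u))) borel j) B = emeasure (density vol (\<lambda>x. ennreal (indicator (fst c) x))) B" .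
  qed simp
  have fv [measurable]: "f \<in> borel_measurable vol" using f(1) by simp
  note f(1) [measurable]
  have e1: "f = (\<lambda>x. indicator (fst c) x *\<^sub>R f x)"
    by (rule ext) (use f(2) in \<open>auto simp: indicator_def\<close>)
  have e2: "(\<lambda>u. if u \<in> img c then vdens c u * f (chart_inv c u) else 0) = (\<lambda>u. d u *\<^sub>R f (j u))"
    by (rule ext) (auto simp: d_def j_def)
  have "(\<integral>x. f x \<partial>vol) = (\<integral>x. f x \<partial>density vol (\<lambda>x. ennreal (indicator (fst c) x)))"
    by (subst e1, subst integral_density) auto
  also have "\<dots> = (\<integral>u. f (j u) \<partial>density lborel (\<lambda>u. ennreal (d u)))"
    unfolding eq[symmetric] by (subst integral_distr) auto
  also have "\<dots> = (\<integral>u. d u *\<^sub>R f (j u) \<partial>lborel)"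
    by (subst integral_density) (auto simp: d0)
  finally have 1: "(\<integral>x. f x \<partial>vol) = (\<integral>u. d u *\<^sub>R f (j u) \<partial>lborel)" .
  have "integrable vol f \<longleftrightarrow> integrable (density vol (\<lambda>x. ennreal (indicator (fst c) x))) f"
    by (subst e1, subst integrable_density) auto
  also have "\<dots> \<longleftrightarrow> integrable (density lborel (\<lambda>u. ennreal (d u))) (\<lambda>u. f (j u))"
    unfolding eq[symmetric] by (subst integrable_distr_eq) auto
  also have "\<dots> \<longleftrightarrow> integrable lborel (\<lambda>u. d u *\<^sub>R f (j u))"
    by (subst integrable_density) (auto simp: d0)
  finally show ?thesis using 1 unfolding e2 by simp
  qed
  then show ?A ?B by auto
qed

end

lemma continuous_on_extend_zero:
  fixes f :: "'a::t2_space \<Rightarrow> real"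
  assumes "open S" "continuous_on S f" "closed K" "K \<subseteq> S" "\<And>x. x \<in> S - K \<Longrightarrow> f x = 0"
  shows "continuous_on UNIV (\<lambda>x. if x \<in> S then f x else 0)"
proof -
  have "continuous_on S (\<lambda>x. if x \<in> S then f x else 0)"
    using assms(2) by (simp cong: continuous_on_cong)
  moreover have "continuous_on (-K) (\<lambda>x. if x \<in> S then f x else 0)"
    using continuous_on_const[of "-K" "0::real"] by (rule continuous_on_cong[THEN iffD1, rotated 2]) (use assms(5) in auto)
  ultimately have "continuous_on (S \<union> -K) (\<lambda>x. if x \<in> S then f x else 0)"
    using assms(1,3) by (intro continuous_on_open_Un) auto
  moreover have "S \<union> -K = UNIV" using assms(4) by auto
  ultimately show ?thesis by simp
qed

section \<open>Integration by parts and the divergence\<close>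

locale embedded_manifold = riemannian_manifold A g vol
  for A :: "('a::{t2_space, second_countable_topology}, 'n::finite) chart set" and g and vol +
  fixes \<psi> :: "'a \<Rightarrow> real ^ 'd"
  assumes compact_manifold: "compact (UNIV :: 'a set)" and embedding: "smooth_embedding A \<psi>"

sublocale embedded_manifold \<subseteq> compact_embedding \<psi>
proof
  show "compact (UNIV :: 'a set)" by (rule compact_manifold)
  obtain h where h: "homeomorphism UNIV (range \<psi>) \<psi> h" using embedding unfolding smooth_embedding_def by blast
  then show "continuous_on UNIV \<psi>" by (simp add: homeomorphism_def)
  show "inj \<psi>" using h unfolding homeomorphism_def by (metis UNIV_I injI)
qed

context embedded_manifold
begin

lemma \<psi>_C1: "C1_fun \<psi>"
  using embedding unfolding smooth_embedding_def by (blast intro: Ck_manifold_imp_C1_fun)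

lemma compact_coord_image:
  assumes c: "c \<in> A" and K: "closed K" "K \<subseteq> fst c" shows "compact (snd c ` K)"
proof -
  have "compact K" using K(1) compact_manifold by (metis compact_Int_closed inf_top_left)
  then show ?thesis using cont_coord[OF c] K(2) by (meson compact_continuous_image continuous_on_subset)
qed

lemma chart_support:
  assumes "c \<in> A" "u \<in> img c" "u \<notin> snd c ` K" shows "chart_inv c u \<notin> K"
  using assms coord_inv[OF assms(1,2)] by (metis imageI)

lemma integrable_vol_chart:
  fixes h :: "'a \<Rightarrow> real"
  assumes c: "c \<in> A" and K: "closed K" "K \<subseteq> fst c" and h: "continuous_on UNIV h" "\<And>x. x \<notin> K \<Longrightarrow> h x = 0"
  shows "integrable vol h" and "(\<And>x. 0 \<le> h x) \<Longrightarrow> 0 < h y \<Longrightarrow> 0 < (\<integral>x. h x \<partial>vol)"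
proof -
  let ?f = "\<lambda>u. if u \<in> img c then vdens c u * h (chart_inv c u) else 0"
  have K': "compact (snd c ` K)" by (rule compact_coord_image[OF c K])
  have cf: "continuous_on UNIV ?f"
  proof (rule continuous_on_extend_zero[OF open_img[OF c] _ compact_imp_closed[OF K']])
    show "continuous_on (img c) (\<lambda>u. vdens c u * h (chart_inv c u))"
      using continuous_on_compose2[OF h(1) cont_inv[OF c]] C1_on_imp_continuous_on[OF vdens_C1[OF c]]
      by (intro continuous_intros) auto
    show "vdens c u * h (chart_inv c u) = 0" if "u \<in> img c - snd c ` K" for u
      using that chart_support[OF c] h(2) by auto
  qed (use K(2) in auto)
  have if': "integrable lborel ?f"
    by (rule integrable_compact_support[OF cf K']) (use chart_support[OF c] h(2) in auto)
  have hm: "h \<in> borel_measurable borel" "\<And>x. x \<notin> fst c \<Longrightarrow> h x = 0"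
    using h K(2) by (auto intro: borel_measurable_continuous_onI)
  show "integrable vol h" using if' integral_chart(2)[OF c hm] by simp
  assume pos: "\<And>x. 0 \<le> h x" "0 < h y"
  then have y: "y \<in> fst c" using hm(2) by force
  have "0 < (\<integral>u. ?f u \<partial>lborel)"
  proof (rule integral_pos_continuous[OF cf if', of "snd c y"])
    show "0 \<le> ?f u" for u using pos(1)[of "chart_inv c u"] vdens_pos[OF c, of u] by (auto simp: less_imp_le)
    show "0 < ?f (snd c y)" using y pos(2) vdens_pos[OF c, of "snd c y"] inv_coord[OF c y] by simp
  qed
  then show "0 < (\<integral>x. h x \<partial>vol)" using integral_chart(1)[OF c hm] by simp
qed

text \<open>The coordinate formula in a given chart; \<open>divergence\<close> uses the chart picked
  by \<open>chart_at\<close>, and agreement of the two is proved below by duality.\<close>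

definition div_chart :: "('a, 'n) chart \<Rightarrow> ('a \<Rightarrow> ('a, 'n) tvec) \<Rightarrow> real ^ 'n \<Rightarrow> real" where
  "div_chart c X u = (\<Sum>i\<in>UNIV. frechet_derivative (\<lambda>u. vdens c u * X (chart_inv c u) c $ i) (at u) (axis i 1)) / vdens c u"

lemma flux_C1:
  "smooth_vector_field A X \<Longrightarrow> c \<in> A \<Longrightarrow> C1_on (img c) (\<lambda>u. vdens c u * X (chart_inv c u) c $ i)"
  by (intro C1_on_mult vdens_C1 C1_on_vec_nth vector_field_C1)

lemma continuous_div_chart:
  assumes "smooth_vector_field A X" "c \<in> A" shows "continuous_on (img c) (div_chart c X)"
proof -
  have "vdens c u \<noteq> 0" if "u \<in> img c" for u using vdens_pos[OF assms(2) that] by simp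
  then show ?thesis unfolding div_chart_def[abs_def]
    by (intro continuous_intros C1_on_continuous_derivative flux_C1 assms C1_on_imp_continuous_on[OF vdens_C1]) auto
qed

lemma linear_expand_vec:
  fixes f :: "real ^ 'n \<Rightarrow> real" assumes "linear f" shows "f v = (\<Sum>i\<in>UNIV. v $ i * f (axis i 1))"
proof -
  have "f v = f (\<Sum>i\<in>UNIV. (v $ i) *\<^sub>R axis i 1)" by (simp add: basis_expansion[of v, unfolded scalar_mult_eq_scaleR])
  also have "\<dots> = (\<Sum>i\<in>UNIV. v $ i * f (axis i 1))" using assms by (simp add: linear_sum linear_cmul)
  finally show ?thesis .
qed

text \<open>Product rule for the divergence of \<phi> X, for the function \<phi> called
  \<open>f\<close> here, written with the volume density inside the derivatives so that the left
  side is a plain coordinate divergence.\<close>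

lemma divergence_product:
  assumes X: "smooth_vector_field A X" and c: "c \<in> A" and u: "u \<in> img c" and f: "C1_on (img c) f"
  shows "(\<Sum>i\<in>UNIV. frechet_derivative (\<lambda>u. f u * (vdens c u * X (chart_inv c u) c $ i)) (at u) (axis i 1))
    = vdens c u * (frechet_derivative f (at u) (X (chart_inv c u) c) + f u * div_chart c X u)"
proof -
  let ?F = "\<lambda>i u. vdens c u * X (chart_inv c u) c $ i"
  have d: "frechet_derivative (\<lambda>u. f u * ?F i u) (at u) (axis i 1) =
      f u * frechet_derivative (?F i) (at u) (axis i 1) + frechet_derivative f (at u) (axis i 1) * ?F i u" for i
    by (rule fun_cong[OF frechet_derivative_at[OF has_derivative_mult[OF C1_on_has_derivative[OF f u]
      C1_on_has_derivative[OF flux_C1[OF X c] u]]], symmetric])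
  have fl: "frechet_derivative f (at u) (X (chart_inv c u) c) = (\<Sum>i\<in>UNIV. X (chart_inv c u) c $ i * frechet_derivative f (at u) (axis i 1))"
    by (rule linear_expand_vec[OF has_derivative_linear[OF C1_on_has_derivative[OF f u]]])
  have eq: "vdens c u * (f u * (S / vdens c u)) = f u * S" for S using vdens_pos[OF c u] by simp
  show ?thesis unfolding d fl div_chart_def distrib_left eq
    by (simp add: sum.distrib sum_distrib_left mult_ac)
qed

text \<open>Multiplied by the volume density, the integrand is the coordinate divergence of a
  compactly supported C1 field, whose partial derivatives integrate to zero. Continuity and support
  come along because they give integrability.\<close>

lemma integration_by_parts_chart:
  assumes X: "smooth_vector_field A X" and c: "c \<in> A" and f: "C1_fun f"
    and K: "closed K" "K \<subseteq> fst c" "\<And>x. x \<notin> K \<Longrightarrow> f x = 0"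
  shows "(\<integral>x. (if x \<in> fst c then chart_deriv c f x (X x c) + f x * div_chart c X (snd c x) else 0) \<partial>vol) = 0"
    and "continuous_on UNIV (\<lambda>x. if x \<in> fst c then chart_deriv c f x (X x c) + f x * div_chart c X (snd c x) else 0)"
    and "\<And>x. x \<notin> K \<Longrightarrow> (if x \<in> fst c then chart_deriv c f x (X x c) + f x * div_chart c X (snd c x) else 0) = 0"
proof -
  let ?h = "\<lambda>x. if x \<in> fst c then chart_deriv c f x (X x c) + f x * div_chart c X (snd c x) else 0"
  define \<phi> where "\<phi> = f \<circ> chart_inv c"
  have \<phi>: "C1_on (img c) \<phi>" unfolding \<phi>_def by (rule C1_funD[OF f c])
  have K': "compact (snd c ` K)" by (rule compact_coord_image[OF c K(1,2)])
  have K'S: "snd c ` K \<subseteq> img c" using K(2) by auto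
  have \<phi>0: "\<phi> u = 0" if "u \<in> img c" "u \<notin> snd c ` K" for u
    using chart_support[OF c that] K(3) by (simp add: \<phi>_def)
  have z: "chart_deriv c f x (X x c) + f x * div_chart c X (snd c x) = 0" if x: "x \<in> fst c" "x \<notin> K" for x
  proof -
    have "snd c x \<notin> snd c ` K"
    proof
      assume "snd c x \<in> snd c ` K"
      then obtain y where "y \<in> K" "snd c x = snd c y" by blast
      then have "x = y" using inv_coord[OF c, of x] inv_coord[OF c, of y] x K(2) by auto
      then show False using x(2) \<open>y \<in> K\<close> by simp
    qed
    then have xi: "snd c x \<in> img c - snd c ` K" using x by auto
    have o: "open (img c - snd c ` K)" using open_img[OF c] compact_imp_closed[OF K'] by blast
    have "frechet_derivative \<phi> (at (snd c x)) = frechet_derivative (\<lambda>_. 0) (at (snd c x))"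
      by (rule frechet_derivative_cong_open[OF o xi]) (use \<phi>0 in auto)
    then show ?thesis using K(3)[OF x(2)] by (simp add: chart_deriv_def \<phi>_def)
  qed
  show "\<And>x. x \<notin> K \<Longrightarrow> ?h x = 0" using z by auto
  show hc: "continuous_on UNIV ?h"
  proof (rule continuous_on_extend_zero[OF open_dom[OF c] _ K(1,2)])
    have "continuous_on (img c) (\<lambda>u. frechet_derivative \<phi> (at u) (X (chart_inv c u) c) + \<phi> u * div_chart c X u)"
      by (intro continuous_intros C1_on_joint_continuous[OF \<phi>] C1_on_imp_continuous_on vector_field_C1[OF X c] \<phi>
           continuous_div_chart[OF X c] continuous_on_id) auto
    from continuous_on_compose2[OF this cont_coord[OF c]]
    show "continuous_on (fst c) (\<lambda>x. chart_deriv c f x (X x c) + f x * div_chart c X (snd c x))"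
      by (simp add: chart_deriv_def \<phi>_def inv_coord[OF c] cong: continuous_on_cong_simp)
  qed (use z in auto)
  define G where "G i u = (if u \<in> img c then \<phi> u * (vdens c u * X (chart_inv c u) c $ i) else 0)" for i u
  have GC: "C1_on UNIV (G i)" for i unfolding G_def[abs_def]
    by (rule C1_on_extend_zero[OF open_img[OF c] _ compact_imp_closed[OF K'] K'S])
      (use \<phi>0 in \<open>auto intro: C1_on_mult \<phi> flux_C1[OF X c]\<close>)
  have G0: "G i u = 0" if "u \<notin> snd c ` K" for i u using that \<phi>0 by (simp add: G_def)
  have dG: "frechet_derivative (G i) (at u) = (if u \<in> img c then frechet_derivative (\<lambda>u. \<phi> u * (vdens c u * X (chart_inv c u) c $ i)) (at u) else (\<lambda>v. 0))" for i u
  proof (cases "u \<in> img c")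
    case True
    then show ?thesis using frechet_derivative_cong_open[OF open_img[OF c] True, of "G i" "\<lambda>u. \<phi> u * (vdens c u * X (chart_inv c u) c $ i)"]
      by (simp add: G_def)
  next
    case False
    then have "u \<notin> snd c ` K" using K'S by auto
    then show ?thesis using False frechet_derivative_zero_outside[OF compact_imp_closed[OF K'], of "G i"] G0 by auto
  qed
  have "(\<integral>x. ?h x \<partial>vol) = (\<integral>u. (if u \<in> img c then vdens c u * ?h (chart_inv c u) else 0) \<partial>lborel)"
    by (rule integral_chart(1)[OF c borel_measurable_continuous_onI[OF hc]]) auto
  also have "\<dots> = (\<integral>u. (\<Sum>i\<in>UNIV. frechet_derivative (G i) (at u) (axis i 1)) \<partial>lborel)"
  proof (intro Bochner_Integration.integral_cong refl)
    fix u
    show "(if u \<in> img c then vdens c u * ?h (chart_inv c u) else 0) = (\<Sum>i\<in>UNIV. frechet_derivative (G i) (at u) (axis i 1))"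
    proof (cases "u \<in> img c")
      case True
      then show ?thesis
        using divergence_product[OF X c True \<phi>] inv_dom[OF c True] coord_inv[OF c True] unfolding dG
        by (simp add: chart_deriv_def \<phi>_def)
    qed (simp add: dG)
  qed
  also have "\<dots> = (\<Sum>i\<in>UNIV. (\<integral>u. frechet_derivative (G i) (at u) (axis i 1) \<partial>lborel))"
  proof (rule Bochner_Integration.integral_sum)
    fix i :: 'n
    show "integrable lborel (\<lambda>u. frechet_derivative (G i) (at u) (axis i 1))"
      by (rule integrable_compact_support[OF C1_on_continuous_derivative[OF GC] K'])
        (rule frechet_derivative_zero_outside[OF compact_imp_closed[OF K']], use G0 in auto)
  qed
  also have "\<dots> = 0" using integral_frechet_derivative_zero[OF GC K' G0] by simp
  finally show "(\<integral>x. ?h x \<partial>vol) = 0" .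
qed

lemma bump_C1: "C1_fun (\<lambda>y. bump r (\<psi> y - z))"
proof (rule C1_fun_compose[of UNIV "\<lambda>w. bump r (w - z)"])
  have "C1_on UNIV (\<lambda>w. w - z)" using C1_on_add[OF C1_on_bounded_linear[OF bounded_linear_ident] C1_on_const[of UNIV "- z"]] by simp
  then show "C1_on UNIV (\<lambda>w. bump r (w - z))" by (rule C1_on_compose[OF C1_on_bump[of UNIV]]) auto
qed (auto intro: \<psi>_C1)

text \<open>Chart independence by duality instead of the transformation law of determinants: if the
  two formulas differed at \<open>x\<close>, subtracting the two integrations by parts against a
  bump near \<open>x\<close> would leave a strictly positive integral equal to zero, since the
  derivative terms cancel.\<close>

lemma div_chart_independent:
  assumes X: "smooth_vector_field A X" and c: "c \<in> A" "c' \<in> A" and x: "x \<in> fst c" "x \<in> fst c'"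
  shows "div_chart c X (snd c x) = div_chart c' X (snd c' x)"
proof -
  \<comment> \<open>By symmetry one inequality is enough, and a violation fixes the sign of the
    difference near \<open>x\<close>.\<close>
  have "div_chart c X (snd c x) \<le> div_chart c' X (snd c' x)"
    if c: "c \<in> A" "c' \<in> A" and x: "x \<in> fst c" "x \<in> fst c'" for c c'
  proof (rule ccontr)
    define \<delta> where "\<delta> y = div_chart c X (snd c y) - div_chart c' X (snd c' y)" for y
    assume "\<not> div_chart c X (snd c x) \<le> div_chart c' X (snd c' x)"
    then have \<delta>x: "\<delta> x > 0" by (simp add: \<delta>_def)
    define W where "W = fst c \<inter> fst c'"
    have W: "open W" "x \<in> W" using open_dom[OF c(1)] open_dom[OF c(2)] x by (auto simp: W_def)
    have \<delta>c: "continuous_on W \<delta>" unfolding \<delta>_def[abs_def] W_def using c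
      by (intro continuous_intros continuous_on_compose2[OF continuous_div_chart[OF X]])
        (auto intro: continuous_on_subset[OF cont_coord])
    define N where "N = W \<inter> \<delta> -` {0<..}"
    have N: "open N" "x \<in> N" unfolding N_def using continuous_open_preimage[OF \<delta>c W(1)] W(2) \<delta>x by auto
    obtain r where r: "r > 0" "\<And>y. norm (\<psi> y - \<psi> x) \<le> r \<Longrightarrow> y \<in> N" using embedding_nbhd[OF N] by blast
    define K where "K = {y. norm (\<psi> y - \<psi> x) \<le> r}"
    have Kcl: "closed K" unfolding K_def by (intro closed_Collect_le continuous_intros \<psi>_cont)
    have KN: "K \<subseteq> N" using r(2) by (auto simp: K_def)
    have Kc: "K \<subseteq> fst c" "K \<subseteq> fst c'" using KN by (auto simp: N_def W_def)
    define f where "f y = bump r (\<psi> y - \<psi> x)" for y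
    have f: "C1_fun f" unfolding f_def[abs_def] by (rule bump_C1)
    have f0: "f y = 0" if "y \<notin> K" for y using that r(1) by (simp add: f_def K_def bump_zero_iff)
    let ?h = "\<lambda>c x. if x \<in> fst c then chart_deriv c f x (X x c) + f x * div_chart c X (snd c x) else 0"
    note I = integration_by_parts_chart[OF X c(1) f Kcl Kc(1) f0]
    note I' = integration_by_parts_chart[OF X c(2) f Kcl Kc(2) f0]
    have int1: "integrable vol (?h c)" by (rule integrable_vol_chart(1)[OF c(1) Kcl Kc(1) I(2,3)])
    have int2: "integrable vol (?h c')" by (rule integrable_vol_chart(1)[OF c(2) Kcl Kc(2) I'(2,3)])
    have diff: "?h c y - ?h c' y = f y * \<delta> y" if "y \<in> W" for y
    proof -
      have y: "y \<in> fst c" "y \<in> fst c'" using that by (auto simp: W_def)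
      have "chart_deriv c f y (X y c) = chart_deriv c' f y (X y c')"
        using vf_deriv_C1[of X y f, OF vector_field_tangent[OF X] f c(1) y(1)]
          vf_deriv_C1[of X y f, OF vector_field_tangent[OF X] f c(2) y(2)] by simp
      then show ?thesis using y by (simp add: \<delta>_def right_diff_distrib)
    qed
    define k where "k y = ?h c y - ?h c' y" for y
    have k0: "k y = 0" if "y \<notin> K" for y using I(3)[OF _ that] I'(3)[OF _ that] by (simp add: k_def)
    have kpos: "0 \<le> k y" for y
    proof (cases "y \<in> K")
      case True
      then have "y \<in> W" "\<delta> y > 0" using KN by (auto simp: N_def)
      then show ?thesis using diff[of y] by (simp add: k_def f_def)
    qed (simp add: k0)
    have kx: "0 < k x" using diff[OF W(2)] \<delta>x r(1) by (simp add: k_def f_def bump_pos_iff)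
    have kc: "continuous_on UNIV k" unfolding k_def[abs_def] by (intro continuous_on_diff I(2) I'(2))
    have "0 < (\<integral>y. k y \<partial>vol)" by (rule integrable_vol_chart(2)[OF c(1) Kcl Kc(1) kc k0 kpos kx])
    moreover have "(\<integral>y. k y \<partial>vol) = 0"
      unfolding k_def using Bochner_Integration.integral_diff[OF int1 int2] I(1) I'(1) by simp
    ultimately show False by simp
  qed
  then show ?thesis using c x by (intro antisym) auto
qed

lemma divergence_chart:
  assumes X: "smooth_vector_field A X" and c: "c \<in> A" "x \<in> fst c"
  shows "divergence A g X x = div_chart c X (snd c x)"
proof -
  have "divergence A g X x = div_chart (chart_at A x) X (snd (chart_at A x) x)"
    by (simp add: divergence_def div_chart_def vdens_def[abs_def] Let_def)
  also have "\<dots> = div_chart c X (snd c x)" by (rule div_chart_independent[OF X chart_at(1) c(1) chart_at(2) c(2)])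
  finally show ?thesis .
qed

lemma continuous_divergence:
  assumes X: "smooth_vector_field A X" shows "continuous_on UNIV (divergence A g X)"
proof (rule continuous_chartwise)
  fix c assume c: "c \<in> A"
  show "continuous_on (img c) (divergence A g X \<circ> chart_inv c)"
    using continuous_div_chart[OF X c]
    by (simp add: divergence_chart[OF X c] inv_dom[OF c] coord_inv[OF c] cong: continuous_on_cong_simp)
qed

text \<open>Off the chart both terms vanish, because \<open>K\<close> is closed and so
  \<open>f\<close> is zero in a whole neighbourhood.\<close>

lemma integration_by_parts:
  assumes X: "smooth_vector_field A X" and c: "c \<in> A" and f: "C1_fun f"
    and K: "closed K" "K \<subseteq> fst c" "\<And>x. x \<notin> K \<Longrightarrow> f x = 0"
  shows "(\<integral>x. vf_deriv A X f x + f x * divergence A g X x \<partial>vol) = 0"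
proof -
  note I = integration_by_parts_chart[OF X c f K]
  have "vf_deriv A X f x + f x * divergence A g X x =
      (if x \<in> fst c then chart_deriv c f x (X x c) + f x * div_chart c X (snd c x) else 0)" for x
  proof (cases "x \<in> fst c")
    case True
    then show ?thesis
      using vf_deriv_C1[of X x f, OF vector_field_tangent[OF X] f c True] divergence_chart[OF X c True] by simp
  next
    case False
    then have x: "x \<notin> K" using K(2) by auto
    obtain c' where c': "c' \<in> A" "x \<in> fst c'" using charts_cover by blast
    have o: "open (snd c' ` (fst c' \<inter> - K))" using K(1) by (intro open_img_restrict[OF c'(1)]) auto
    have "chart_deriv c' f x = frechet_derivative (\<lambda>_. 0) (at (snd c' x))"
      unfolding chart_deriv_def
      by (rule frechet_derivative_cong_open[OF o]) (use x c' K(3) inv_coord[OF c'(1)] in auto)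
    then show ?thesis using vf_deriv_C1[of X x f, OF vector_field_tangent[OF X] f c'] False K(3)[OF x] by simp
  qed
  then show ?thesis using I(1) by simp
qed

end

section \<open>Functionals annihilating a Stein kernel\<close>

text \<open>At \<open>t = - u / K\<close> with \<open>K = \<bar>k\<bar> + 1\<close> the polynomial
  is at most \<open>- u\<^sup>2 / K\<close>; the summand 1 keeps \<open>K\<close> positive.\<close>

lemma quadratic_nonneg_imp_zero:
  fixes u k :: real assumes "\<And>t. 0 \<le> 2 * (t * u) + t\<^sup>2 * k" shows "u = 0"
proof (rule ccontr)
  assume u: "u \<noteq> 0"
  define K where "K = \<bar>k\<bar> + 1"
  have K: "K > 0" "k \<le> K" by (auto simp: K_def)
  have "0 \<le> 2 * ((- u / K) * u) + (- u / K)\<^sup>2 * k" by (rule assms)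
  also have "\<dots> \<le> 2 * ((- u / K) * u) + (- u / K)\<^sup>2 * K" using K by (intro add_left_mono mult_left_mono) auto
  also have "\<dots> = - (u\<^sup>2 / K)" using K by (simp add: power2_eq_square)
  also have "\<dots> < 0" using u K by simp
  finally show False by simp
qed

text \<open>\<open>V\<close> and \<open>b\<close> stand for the pushed field and the Stein drift.
  Together with \<open>\<Lambda>\<close> they define a distribution of order one on the ambient
  space.\<close>

locale kernel_functional = mean_functional \<psi> \<Lambda> + C11_kernel \<kappa>
  for \<psi> :: "'a::t2_space \<Rightarrow> 'e::euclidean_space" and \<Lambda> and \<kappa> :: "'e \<Rightarrow> 'e \<Rightarrow> real" +
  fixes V :: "'a \<Rightarrow> 'e" and b :: "'a \<Rightarrow> real"
  assumes V_cont: "continuous_on UNIV V" and b_cont: "continuous_on UNIV b"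
begin

lemma compose_fst_continuous: "continuous_on UNIV f \<Longrightarrow> continuous_on S (\<lambda>z. f (fst z))"
  by (rule continuous_on_compose2[of UNIV f]) (auto intro: continuous_intros)

lemma compose_snd_continuous: "continuous_on UNIV f \<Longrightarrow> continuous_on S (\<lambda>z. f (snd z))"
  by (rule continuous_on_compose2[of UNIV f]) (auto intro: continuous_intros)

lemmas snd_intros = compose_snd_continuous[OF V_cont] compose_snd_continuous[OF b_cont] compose_snd_continuous[OF \<psi>_cont]
  compose_fst_continuous[OF V_cont] compose_fst_continuous[OF b_cont] compose_fst_continuous[OF \<psi>_cont]

text \<open>The hypothesis holds at points of the embedded space only, so it may be differentiated
  in \<open>y\<close> only along curves inside it; \<open>V y\<close> is the velocity of such a
  curve.\<close>

lemma derivative_annihilated: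
  assumes ann: "\<And>y. \<Lambda> (\<lambda>x. d1 (V x) (\<psi> x) (\<psi> y) + b x * \<kappa> (\<psi> x) (\<psi> y)) = 0"
    and \<gamma>: "\<gamma> 0 = y" "smooth_curve \<psi> \<gamma> (V y)"
  shows "\<Lambda> (\<lambda>x. d12 (V x) (V y) (\<psi> x) (\<psi> y) + b x * d1 (V y) (\<psi> y) (\<psi> x)) = 0"
proof -
  obtain \<delta> \<alpha>' where \<delta>: "\<delta> > 0" and a: "\<And>t. \<bar>t\<bar> < \<delta> \<Longrightarrow> ((\<lambda>t. \<psi> (\<gamma> t)) has_vector_derivative \<alpha>' t) (at t)"
    and c: "continuous_on {-\<delta><..<\<delta>} \<alpha>'" and V: "\<alpha>' 0 = V y"
    using \<gamma>(2) unfolding smooth_curve_def by blast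
  define T where "T = {-\<delta><..<\<delta>}"
  have T: "open T" "0 \<in> T" using \<delta> by (auto simp: T_def)
  have aT: "((\<lambda>t. \<psi> (\<gamma> t)) has_vector_derivative \<alpha>' t) (at t)" if "t \<in> T" for t
    using that by (intro a) (auto simp: T_def)
  have ac: "continuous_on T (\<lambda>t. \<psi> (\<gamma> t))"
    using aT by (auto intro!: continuous_at_imp_continuous_on intro: has_vector_derivative_continuous)
  define F where "F t x = d1 (V x) (\<psi> x) (\<psi> (\<gamma> t)) + b x * \<kappa> (\<psi> x) (\<psi> (\<gamma> t))" for t x
  define F' where "F' t x = d12 (V x) (\<alpha>' t) (\<psi> x) (\<psi> (\<gamma> t)) + b x * d1 (\<alpha>' t) (\<psi> (\<gamma> t)) (\<psi> x)" for t x
  have "((\<lambda>t. \<Lambda> (F t)) has_real_derivative \<Lambda> (F' 0)) (at 0)"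
  proof (rule deriv_param[OF T])
    fix t x assume t: "t \<in> T"
    have "((\<lambda>t. \<kappa> (\<psi> x) (\<psi> (\<gamma> t))) has_real_derivative d1 (\<alpha>' t) (\<psi> (\<gamma> t)) (\<psi> x)) (at t)"
      using curve_fst[OF aT[OF t], of "\<psi> x"] by (simp only: kernel_sym[of "\<psi> x"])
    then show "((\<lambda>t. F t x) has_real_derivative F' t x) (at t)"
      unfolding F_def F'_def by (intro DERIV_add DERIV_cmult curve_snd aT t)
    show "continuous_on UNIV (F t)" unfolding F_def[abs_def] by (intro continuous_intros V_cont b_cont \<psi>_cont)
  next
    have "continuous_on (T \<times> UNIV) (\<lambda>z. \<alpha>' (fst z))" "continuous_on (T \<times> UNIV) (\<lambda>z. \<psi> (\<gamma> (fst z)))"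
      by (rule continuous_on_compose2[OF c[folded T_def]] continuous_on_compose2[OF ac]; auto intro: continuous_intros)+
    then show "continuous_on (T \<times> UNIV) (\<lambda>(s, x). F' s x)"
      unfolding F'_def case_prod_beta by (intro continuous_intros snd_intros)
  qed
  moreover have "(\<lambda>t. \<Lambda> (F t)) = (\<lambda>t. 0)" unfolding F_def using ann by simp
  ultimately have "\<Lambda> (F' 0) = 0" using DERIV_unique[of "\<lambda>t. 0" _ 0 0] by simp
  then show ?thesis by (simp add: F'_def[abs_def] V \<gamma>(1))
qed

text \<open>A Cauchy-Schwarz argument for energies: the distribution plus \<open>t\<close> times a
  point mass at \<open>z\<close> has nonnegative energy, a quadratic polynomial in \<open>t\<close>
  whose constant term vanishes.\<close>

lemma annihilated_everywhere:
  assumes ann: "\<And>y. \<Lambda> (\<lambda>x. d1 (V x) (\<psi> x) (\<psi> y) + b x * \<kappa> (\<psi> x) (\<psi> y)) = 0"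
    and curves: "\<And>y. \<exists>\<gamma>. \<gamma> 0 = y \<and> smooth_curve \<psi> \<gamma> (V y)"
  shows "\<Lambda> (\<lambda>x. d1 (V x) (\<psi> x) z + b x * \<kappa> (\<psi> x) z) = 0"
proof -
  define h where "h x = d1 (V x) (\<psi> x) z + b x * \<kappa> (\<psi> x) z" for x
  have hc: "continuous_on UNIV h" unfolding h_def[abs_def] by (intro continuous_intros V_cont b_cont \<psi>_cont)
  have "0 \<le> 2 * (t * \<Lambda> h) + t\<^sup>2 * \<kappa> z z" for t
  proof -
    define G where "G x y = d12 (V x) (V y) (\<psi> x) (\<psi> y) + b y * d1 (V x) (\<psi> x) (\<psi> y) + b x * d1 (V y) (\<psi> y) (\<psi> x)
      + b x * b y * \<kappa> (\<psi> x) (\<psi> y) + t * h x + t * h y + t\<^sup>2 * \<kappa> z z" for x y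
    have "psd_kernel G" unfolding G_def[abs_def] h_def by (rule extended_psd)
    moreover have "continuous_on UNIV (\<lambda>(x, y). G x y)"
      unfolding G_def h_def case_prod_beta by (intro continuous_intros snd_intros)
    ultimately have "0 \<le> \<Lambda> (\<lambda>y. \<Lambda> (\<lambda>x. G x y))" by (intro psd_nonneg)
    moreover have "\<Lambda> (\<lambda>x. G x y) = t * \<Lambda> h + (t * h y + t\<^sup>2 * \<kappa> z z)" for y
    proof -
      obtain \<gamma> where \<gamma>: "\<gamma> 0 = y" "smooth_curve \<psi> \<gamma> (V y)" using curves by blast
      \<comment> \<open>Here \<open>p\<close> is the derivative of \<open>r\<close> in
        \<open>y\<close> along \<open>V y\<close>. Both are annihilated, so only the terms carrying
        \<open>t\<close> survive.\<close>
      define p where "p x = d12 (V x) (V y) (\<psi> x) (\<psi> y) + b x * d1 (V y) (\<psi> y) (\<psi> x)" for x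
      define r where "r x = d1 (V x) (\<psi> x) (\<psi> y) + b x * \<kappa> (\<psi> x) (\<psi> y)" for x
      have pc: "continuous_on UNIV p" and rc: "continuous_on UNIV r"
        unfolding p_def[abs_def] r_def[abs_def] by (intro continuous_intros V_cont b_cont \<psi>_cont)+
      have "\<Lambda> p = 0" using derivative_annihilated[OF ann \<gamma>] unfolding p_def .
      moreover have "\<Lambda> r = 0" using ann[of y] unfolding r_def .
      moreover have "(\<lambda>x. G x y) = (\<lambda>x. (p x + b y * r x) + (t * h x + (t * h y + t\<^sup>2 * \<kappa> z z)))"
        by (rule ext) (simp add: G_def p_def r_def algebra_simps)
      moreover have "\<Lambda> (\<lambda>x. (p x + b y * r x) + (t * h x + C)) = (\<Lambda> p + b y * \<Lambda> r) + (t * \<Lambda> h + C)" for C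
        by (simp add: add pc rc hc scale[OF rc] scale[OF hc] const continuous_on_add continuous_on_mult_left)
      ultimately show ?thesis by simp
    qed
    moreover have "\<Lambda> (\<lambda>y. t * \<Lambda> h + (t * h y + t\<^sup>2 * \<kappa> z z)) = t * \<Lambda> h + (t * \<Lambda> h + t\<^sup>2 * \<kappa> z z)"
      by (simp add: add hc scale[OF hc] const continuous_on_add continuous_on_mult_left)
    ultimately show ?thesis by simp
  qed
  then have "\<Lambda> h = 0" by (rule quadratic_nonneg_imp_zero)
  then show ?thesis by (simp add: h_def[abs_def])
qed

text \<open>By symmetry and translation invariance the kernel is an even function of
  \<open>x - y\<close>, so its gradient is odd.\<close>

lemma d1_antisym:
  assumes "translation_invariant \<kappa>" shows "d1 v x y = - d1 v y x"
proof -
  have l1: "((\<lambda>t. x + t *\<^sub>R v) has_vector_derivative v) (at 0)" and l2: "((\<lambda>t. y - t *\<^sub>R v) has_vector_derivative - v) (at 0)"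
    by (auto intro!: derivative_eq_intros)
  have "\<kappa> (x + t *\<^sub>R v) y = \<kappa> (y - t *\<^sub>R v) x" for t
  proof -
    have "\<kappa> (x + t *\<^sub>R v) ((y - t *\<^sub>R v) + t *\<^sub>R v) = \<kappa> x (y - t *\<^sub>R v)"
      using assms unfolding translation_invariant_def by blast
    then show ?thesis using kernel_sym by simp
  qed
  then have "((\<lambda>t. \<kappa> (y - t *\<^sub>R v) x) has_real_derivative d1 v x y) (at 0)"
    using curve_fst[OF l1, of y] by simp
  moreover have "((\<lambda>t. \<kappa> (y - t *\<^sub>R v) x) has_real_derivative d1 (- v) y x) (at 0)"
    using curve_fst[OF l2, of x] by simp
  ultimately have "d1 v x y = d1 (- v) y x" by (rule DERIV_unique)
  then show ?thesis using linear_neg[OF d1_linear] by simp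
qed

text \<open>In the proof \<open>w\<close> is, up to a reflection, the convolution of \<open>F\<close> with the distribution
  \<open>G \<mapsto> \<Lambda> (DG(\<psi>) V + b G(\<psi>))\<close>; the kernel annihilates the distribution, hence also \<open>w\<close>.\<close>

lemma test_function_annihilated:
  assumes tr: "translation_invariant \<kappa>" and char: "characteristic_kernel \<kappa>"
    and ann: "\<And>z. \<Lambda> (\<lambda>x. d1 (V x) (\<psi> x) z + b x * \<kappa> (\<psi> x) z) = 0"
    and F: "C1_on UNIV F" and K: "compact K" "\<And>v. v \<notin> K \<Longrightarrow> F v = 0"
  shows "\<Lambda> (\<lambda>x. frechet_derivative F (at (\<psi> x)) (V x) + b x * F (\<psi> x)) = 0"
proof -
  let ?D = "\<lambda>v. frechet_derivative F (at v)"
  have Fc: "continuous_on UNIV F" by (rule C1_on_imp_continuous_on[OF F])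
  have FD: "continuous_on S (\<lambda>s. ?D (h s) (v s))" if "continuous_on S h" "continuous_on S v" for S h v
    by (rule C1_on_joint_continuous[OF F that(1) _ that(2)]) simp
  have FC: "continuous_on S (\<lambda>s. F (h s))" if "continuous_on S h" for S h
    by (rule continuous_on_compose2[OF Fc that]) simp
  have D0: "?D v h = 0" if "v \<notin> K" for v h
    by (rule frechet_derivative_zero_outside[OF compact_imp_closed[OF K(1)] K(2) that])
  define W where "W y x = ?D (\<psi> x - y) (V x) + b x * F (\<psi> x - y)" for y x
  define w where "w y = \<Lambda> (W y)" for y
  \<comment> \<open>Outside these differences of image points and points of \<open>K\<close>, every
    \<open>W y x\<close> vanishes.\<close>
  define K' where "K' = (\<lambda>(x, k). \<psi> x - k) ` (UNIV \<times> K)"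
  have K': "compact K'" unfolding K'_def
    by (intro compact_continuous_image compact_Times K(1) compact_space)
      (auto simp: case_prod_beta intro!: continuous_intros snd_intros)
  have W0: "W y x = 0" if "y \<notin> K'" for y x
  proof -
    have "\<psi> x - y \<notin> K"
    proof
      assume "\<psi> x - y \<in> K"
      then have "y \<in> K'" unfolding K'_def by (intro image_eqI[of _ _ "(x, \<psi> x - y)"]) auto
      then show False using that by simp
    qed
    then show ?thesis using D0 K(2) by (simp add: W_def)
  qed
  have Wc: "continuous_on UNIV (\<lambda>(y, x). W y x)"
    unfolding W_def case_prod_beta by (intro continuous_intros FD FC snd_intros)
  have wc: "continuous_on UNIV w" unfolding w_def[abs_def] by (rule continuous_param) (use Wc in auto)
  have w0: "w y = 0" if "y \<notin> K'" for y
  proof -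
    have "W y = (\<lambda>x. 0)" using W0[OF that] by (rule ext)
    then show ?thesis by (simp add: w_def const)
  qed
  have \<kappa>c: "continuous_on UNIV (\<kappa> z)" for z by (intro continuous_intros)
  have "(\<integral>y. \<kappa> z y * w y \<partial>lborel) = 0" for z
  proof -
    \<comment> \<open>\<open>Q\<close> has the derivative on \<open>F\<close>; \<open>R\<close> has
      it on the kernel, where the annihilation applies. The reflection
      \<open>y = \<psi> x - v\<close> and one integration by parts match their integrals.\<close>
    define Q where "Q x y = \<kappa> z y * W y x" for x y
    define R where "R x v = F v * (d1 (V x) (\<psi> x) (z + v) + b x * \<kappa> (\<psi> x) (z + v))" for x v
    have Qc: "continuous_on UNIV (\<lambda>(x, y). Q x y)"
      unfolding Q_def W_def case_prod_beta by (intro continuous_intros FD FC snd_intros)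
    have Rc: "continuous_on UNIV (\<lambda>(x, v). R x v)"
      unfolding R_def case_prod_beta by (intro continuous_intros FC snd_intros)
    have "(\<integral>y. \<kappa> z y * w y \<partial>lborel) = (\<integral>y. \<Lambda> (\<lambda>x. Q x y) \<partial>lborel)"
    proof (intro Bochner_Integration.integral_cong refl)
      fix y
      have "continuous_on UNIV (W y)" unfolding W_def[abs_def] by (intro continuous_intros FD FC V_cont b_cont \<psi>_cont)
      then show "\<kappa> z y * w y = \<Lambda> (\<lambda>x. Q x y)" unfolding w_def Q_def by (subst scale) auto
    qed
    also have "\<dots> = \<Lambda> (\<lambda>x. \<integral>y. Q x y \<partial>lborel)"
      by (rule fubini_lborel(1)[OF Qc K', symmetric]) (simp add: Q_def W0)
    also have "(\<lambda>x. \<integral>y. Q x y \<partial>lborel) = (\<lambda>x. \<integral>v. R x v \<partial>lborel)"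
    proof
      fix x
      define h where "h v = \<kappa> (\<psi> x) (z + v)" for v
      have hd: "(h has_derivative (\<lambda>u. d1 u (z + v) (\<psi> x))) (at v)" for v
      proof -
        have "((\<lambda>v. z + v) has_derivative (\<lambda>u. u)) (at v)" by (auto intro!: derivative_eq_intros)
        from has_derivative_compose[OF this has_derivative_fst[of "\<psi> x" "z + v"]]
        show ?thesis unfolding h_def[abs_def] kernel_sym[of "\<psi> x"] .
      qed
      have hC: "C1_on UNIV h" by (rule C1_onI[OF hd]) (intro continuous_intros)
      have hc: "continuous_on UNIV h" by (rule C1_on_imp_continuous_on[OF hC])
      \<comment> \<open>The derivative of this product along \<open>V x\<close> integrates to zero,
        which moves the derivative from \<open>F\<close> to the kernel; \<open>d1_antisym\<close>
        accounts for the sign.\<close>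
      define G where "G v = h v * F v" for v
      have GC: "C1_on UNIV G" unfolding G_def[abs_def] by (rule C1_on_mult[OF hC F])
      have G0: "G v = 0" if "v \<notin> K" for v using K(2)[OF that] by (simp add: G_def)
      have dG: "frechet_derivative G (at v) u = h v * ?D v u + d1 u (z + v) (\<psi> x) * F v" for v u
        unfolding G_def[abs_def]
        by (rule fun_cong[OF frechet_derivative_at[OF has_derivative_mult[OF hd C1_on_has_derivative[OF F UNIV_I]], symmetric]])
      have i1: "integrable lborel (\<lambda>v. frechet_derivative G (at v) (V x))"
        by (rule integrable_compact_support[OF C1_on_continuous_derivative[OF GC] K(1)])
          (rule frechet_derivative_zero_outside[OF compact_imp_closed[OF K(1)] G0])
      have i2: "integrable lborel (R x)"
        by (rule integrable_compact_support[OF continuous_on_slice[OF Rc[folded UNIV_Times_UNIV] UNIV_I] K(1)])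
          (simp add: R_def K(2))
      have "(\<integral>y. Q x y \<partial>lborel) = (\<integral>v. Q x (\<psi> x - v) \<partial>lborel)"
        by (rule integral_reflect[symmetric])
          (rule borel_measurable_continuous_onI[OF continuous_on_slice[OF Qc[folded UNIV_Times_UNIV] UNIV_I]])
      also have "\<dots> = (\<integral>v. frechet_derivative G (at v) (V x) + R x v \<partial>lborel)"
      proof (intro Bochner_Integration.integral_cong refl)
        fix v
        have "\<kappa> (z + v) ((\<psi> x - v) + v) = \<kappa> z (\<psi> x - v)" using tr unfolding translation_invariant_def by blast
        then have "\<kappa> z (\<psi> x - v) = h v" unfolding h_def using kernel_sym by simp
        then show "Q x (\<psi> x - v) = frechet_derivative G (at v) (V x) + R x v"
          unfolding Q_def W_def dG R_def d1_antisym[OF tr, of "V x" "\<psi> x" "z + v"]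
          by (simp add: h_def algebra_simps)
      qed
      also have "\<dots> = (\<integral>v. R x v \<partial>lborel)"
        using i1 i2 integral_frechet_derivative_zero[OF GC K(1) G0] by simp
      finally show "(\<integral>y. Q x y \<partial>lborel) = (\<integral>v. R x v \<partial>lborel)" .
    qed
    also have "\<Lambda> (\<lambda>x. \<integral>v. R x v \<partial>lborel) = (\<integral>v. \<Lambda> (\<lambda>x. R x v) \<partial>lborel)"
      by (rule fubini_lborel(1)[OF Rc K(1)]) (simp add: R_def K(2))
    also have "\<dots> = 0"
    proof -
      have "\<Lambda> (\<lambda>x. R x v) = F v * \<Lambda> (\<lambda>x. d1 (V x) (\<psi> x) (z + v) + b x * \<kappa> (\<psi> x) (z + v))" for v
        unfolding R_def by (rule scale) (intro continuous_intros V_cont b_cont \<psi>_cont)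
      then show ?thesis using ann by simp
    qed
    finally show ?thesis .
  qed
  note emb = this
  \<comment> \<open>The value of \<open>w\<close> at the origin is the expression in the
    claim.\<close>
  have "w 0 = 0" by (rule characteristic_translation_invariant[OF char \<kappa>c tr wc K' w0 emb])
  then show ?thesis by (simp add: w_def W_def[abs_def])
qed

end

section \<open>The Stein identity\<close>

lemma (in compact_embedding) mean_functional_prob:
  assumes R: "prob_space R" "sets R = sets borel"
  shows "mean_functional \<psi> (\<lambda>f. \<integral>x. f x \<partial>R)"
proof
  interpret R: prob_space R by (rule R(1))
  have int: "integrable R f" if "continuous_on UNIV f" for f :: "'a \<Rightarrow> real"
  proof -
    have "bounded (range f)" using that compact_space by (intro compact_imp_bounded compact_continuous_image)
    then obtain B where "\<And>x. norm (f x) \<le> B" unfolding bounded_iff by auto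
    moreover have "f \<in> borel_measurable R"
      using borel_measurable_continuous_onI[OF that] measurable_cong_sets[OF R(2) refl] by blast
    ultimately show ?thesis by (intro R.integrable_const_bound[of _ B]) auto
  qed
  fix f h :: "'a \<Rightarrow> real" and c :: real
  assume f: "continuous_on UNIV f"
  show "(\<integral>x. c * f x \<partial>R) = c * (\<integral>x. f x \<partial>R)" by simp
  show "(\<And>x. 0 \<le> f x) \<Longrightarrow> 0 \<le> (\<integral>x. f x \<partial>R)" by simp
  assume h: "continuous_on UNIV h"
  show "(\<integral>x. f x + h x \<partial>R) = (\<integral>x. f x \<partial>R) + (\<integral>x. h x \<partial>R)" using int[OF f] int[OF h] by simp
next
  interpret R: prob_space R by (rule R(1))
  show "(\<integral>x. 1 \<partial>R) = (1::real)" by (simp add: R.prob_space)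
qed

locale stein_setting = embedded_manifold A g vol \<psi>
  for A :: "('a::{t2_space, second_countable_topology}, 'n::finite) chart set" and g and vol
    and \<psi> :: "'a \<Rightarrow> real ^ 'd" +
  fixes P :: "'a measure" and p :: "'a \<Rightarrow> real"
  assumes P_prob: "prob_space P" and P_density: "P = density vol (\<lambda>x. ennreal (p x))"
    and p_pos: "\<And>x. 0 < p x" and p_C1: "C1_fun p"
begin

text \<open>The coefficient of order zero: the divergence of p X divided by p.\<close>

definition stein_drift :: "('a \<Rightarrow> ('a, 'n) tvec) \<Rightarrow> 'a \<Rightarrow> real" where
  "stein_drift X x = vf_deriv A X (\<lambda>y. ln (p y)) x + divergence A g X x"

definition stein :: "('a \<Rightarrow> ('a, 'n) tvec) \<Rightarrow> ('a \<Rightarrow> real) \<Rightarrow> 'a \<Rightarrow> real" where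
  "stein X f x = vf_deriv A X f x + f x * stein_drift X x"

lemma p_cont: "continuous_on UNIV p" by (rule C1_fun_continuous[OF p_C1])

lemma p_borel [measurable]: "p \<in> borel_measurable borel"
  by (rule borel_measurable_continuous_onI[OF p_cont])

lemma sets_P: "sets P = sets borel" by (simp add: P_density)

sublocale P: mean_functional \<psi> "\<lambda>f. \<integral>x. f x \<partial>P"
  by (rule mean_functional_prob[OF P_prob sets_P])

lemma ln_p_C1: "C1_fun (\<lambda>y. ln (p y))"
proof (rule C1_fun_compose[OF _ p_C1])
  show "C1_on {0<..} (ln :: real \<Rightarrow> real)" by (rule C1_on_ln[OF C1_on_bounded_linear[OF bounded_linear_ident]]) simp
qed (use p_pos in auto)

lemma continuous_vf_deriv:
  assumes "smooth_vector_field A X" "C1_fun f" shows "continuous_on UNIV (vf_deriv A X f)"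
proof -
  have "vf_deriv A X f = push f X" using vf_deriv_push[of X] vector_field_tangent[OF assms(1)] assms(2) by blast
  then show ?thesis using continuous_push[OF assms] by simp
qed

lemma continuous_stein_drift: "smooth_vector_field A X \<Longrightarrow> continuous_on UNIV (stein_drift X)"
  unfolding stein_drift_def[abs_def] by (intro continuous_on_add continuous_vf_deriv ln_p_C1 continuous_divergence)

lemma continuous_stein: "smooth_vector_field A X \<Longrightarrow> C1_fun f \<Longrightarrow> continuous_on UNIV (stein X f)"
  unfolding stein_def[abs_def]
  by (intro continuous_on_add continuous_on_mult continuous_vf_deriv C1_fun_continuous continuous_stein_drift)

lemma stein_compose:
  assumes "smooth_vector_field A X" "(F has_derivative F') (at (\<psi> x))"
  shows "stein X (\<lambda>y. F (\<psi> y)) x = F' (push \<psi> X x) + F (\<psi> x) * stein_drift X x"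
  unfolding stein_def using vf_deriv_compose[where X = X and x = x, OF vector_field_tangent[OF assms(1)] \<psi>_C1 assms(2)] by simp

text \<open>The product rule absorbs the logarithmic derivative, so that \<open>p\<close> times the
  Stein operator is the divergence of p f X; the Stein identity thus becomes the divergence
  theorem.\<close>

lemma p_stein:
  assumes X: "smooth_vector_field A X" and f: "C1_fun f"
  shows "p x * stein X f x = vf_deriv A X (\<lambda>y. p y * f y) x + p x * f x * divergence A g X x"
proof -
  have t: "X x \<in> tangent_space A x" by (rule vector_field_tangent[OF X])
  have eq: "(*) (1 / p x) = (\<lambda>d. d / p x)" by auto
  have "vf_deriv A X (\<lambda>y. ln (p y)) x = (\<lambda>d. d / p x) (push p X x)"
    by (rule vf_deriv_compose[where X = X and x = x, OF t p_C1])
      (use DERIV_ln_divide[OF p_pos[of x]] in \<open>simp add: has_field_derivative_def eq\<close>)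
  also have "push p X x = vf_deriv A X p x" using vf_deriv_push[of X, OF t p_C1] by simp
  finally have "p x * vf_deriv A X (\<lambda>y. ln (p y)) x = vf_deriv A X p x" using p_pos[of x] by simp
  then show ?thesis
    using vf_deriv_mult[where X = X and x = x, OF t p_C1 f] by (simp add: stein_def stein_drift_def algebra_simps)
qed

lemma integral_P:
  fixes f :: "'a \<Rightarrow> real"
  assumes "f \<in> borel_measurable borel" shows "(\<integral>x. f x \<partial>P) = (\<integral>x. p x * f x \<partial>vol)"
  unfolding P_density using assms p_pos by (subst integral_density) (auto simp: less_imp_le)

lemma integral_P_chart:
  fixes f :: "'a \<Rightarrow> real"
  assumes c: "c \<in> A" and f: "f \<in> borel_measurable borel" "\<And>x. x \<notin> fst c \<Longrightarrow> f x = 0"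
  shows "(\<integral>x. f x \<partial>P) = (\<integral>u. (if u \<in> img c then vdens c u * p (chart_inv c u) * f (chart_inv c u) else 0) \<partial>lborel)"
  unfolding integral_P[OF f(1)]
  by (subst integral_chart(1)[OF c]) (use f in \<open>auto intro!: Bochner_Integration.integral_cong simp: mult.assoc\<close>)

lemma P_pos:
  fixes h :: "'a \<Rightarrow> real"
  assumes "c \<in> A" "closed K" "K \<subseteq> fst c" "continuous_on UNIV h" "\<And>x. x \<notin> K \<Longrightarrow> h x = 0" "\<And>x. 0 \<le> h x" "0 < h y"
  shows "0 < (\<integral>x. h x \<partial>P)"
  unfolding integral_P[OF borel_measurable_continuous_onI[OF assms(4)]]
proof (rule integrable_vol_chart(2)[OF assms(1-3)])
  show "0 < p y * h y" using assms(7) p_pos by simp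
qed (use assms p_pos p_cont in \<open>auto intro!: continuous_intros simp: less_imp_le\<close>)

lemma stein_identity_local:
  assumes X: "smooth_vector_field A X" and c: "c \<in> A" and f: "C1_fun f"
    and K: "closed K" "K \<subseteq> fst c" "\<And>x. x \<notin> K \<Longrightarrow> f x = 0"
  shows "(\<integral>x. stein X f x \<partial>P) = 0"
proof -
  have "(\<integral>x. stein X f x \<partial>P) = (\<integral>x. vf_deriv A X (\<lambda>y. p y * f y) x + p x * f x * divergence A g X x \<partial>vol)"
    using integral_P[OF borel_measurable_continuous_onI[OF continuous_stein[OF X f]]] p_stein[OF X f] by simp
  also have "\<dots> = 0"
    by (rule integration_by_parts[OF X c C1_fun_mult[OF p_C1 f] K(1,2)]) (simp add: K(3))
  finally show ?thesis .
qed

lemma C1_fun_sum: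
  fixes f :: "'i \<Rightarrow> 'a \<Rightarrow> real"
  assumes "\<And>i. i \<in> I \<Longrightarrow> C1_fun (f i)" shows "C1_fun (\<lambda>x. \<Sum>i\<in>I. f i x)"
  unfolding C1_fun_def
proof
  fix c assume c: "c \<in> A"
  have "C1_on (img c) (\<lambda>u. \<Sum>i\<in>I. (f i \<circ> chart_inv c) u)" by (intro C1_on_sum C1_funD[OF assms c])
  then show "C1_on (img c) ((\<lambda>x. \<Sum>i\<in>I. f i x) \<circ> chart_inv c)" by (simp add: o_def)
qed

lemma stein_sum:
  assumes X: "smooth_vector_field A X" and f: "\<And>i. i \<in> I \<Longrightarrow> C1_fun (f i)"
  shows "stein X (\<lambda>x. \<Sum>i\<in>I. f i x) x = (\<Sum>i\<in>I. stein X (f i) x)"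
proof -
  let ?c = "chart_at A x"
  have t: "X x \<in> tangent_space A x" by (rule vector_field_tangent[OF X])
  have "((\<lambda>u. \<Sum>i\<in>I. (f i \<circ> chart_inv ?c) u) has_derivative (\<lambda>v. \<Sum>i\<in>I. chart_deriv ?c (f i) x v)) (at (snd ?c x))"
    by (intro has_derivative_sum C1_fun_has_derivative f chart_at)
  then have "((\<lambda>x. \<Sum>i\<in>I. f i x) \<circ> chart_inv ?c has_derivative (\<lambda>v. \<Sum>i\<in>I. chart_deriv ?c (f i) x v)) (at (snd ?c x))"
    by (simp add: o_def)
  from fun_cong[OF frechet_derivative_at[OF this], of "X x ?c"]
  have "vf_deriv A X (\<lambda>x. \<Sum>i\<in>I. f i x) x = (\<Sum>i\<in>I. vf_deriv A X (f i) x)"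
    using vf_deriv_C1[of X x "\<lambda>x. \<Sum>i\<in>I. f i x", OF t C1_fun_sum[OF f] chart_at] vf_deriv_C1[of X x, OF t f chart_at]
    by (simp add: chart_deriv_def)
  then show ?thesis by (simp add: stein_def sum.distrib sum_distrib_right)
qed

lemma partition_C1:
  fixes \<theta> :: "'a \<Rightarrow> real"
  assumes "\<exists>W F. open W \<and> range \<psi> \<subseteq> W \<and> C1_on W F \<and> \<theta> = (\<lambda>y. F (\<psi> y))" shows "C1_fun \<theta>"
  using assms C1_fun_compose[OF _ \<psi>_C1] by blast

lemma stein_identity:
  assumes X: "smooth_vector_field A X" and f: "C1_fun f"
  shows "(\<integral>x. stein X f x \<partial>P) = 0"
proof -
  define N where "N x = fst (chart_at A x)" for x
  have N: "\<And>x. open (N x)" "\<And>x. x \<in> N x" unfolding N_def using chart_at open_dom by blast+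
  obtain I :: "'a set" and \<theta> where I: "finite I"
    and C: "\<And>x. x \<in> I \<Longrightarrow> \<exists>W F. open W \<and> range \<psi> \<subseteq> W \<and> C1_on W F \<and> \<theta> x = (\<lambda>y. F (\<psi> y))"
    and nn: "\<And>x y. 0 \<le> \<theta> x y" and s1: "\<And>y. (\<Sum>x\<in>I. \<theta> x y) = (1::real)"
    and K: "\<And>x. x \<in> I \<Longrightarrow> \<exists>K. closed K \<and> K \<subseteq> N x \<and> (\<forall>y. y \<notin> K \<longrightarrow> \<theta> x y = 0)"
    by (rule C1_partition_of_unity[OF N]) (rule that; assumption)
  have fC: "C1_fun (\<lambda>y. \<theta> i y * f y)" if "i \<in> I" for i
    by (rule C1_fun_mult[OF partition_C1[OF C[OF that]] f])
  have eq: "(\<lambda>y. \<Sum>i\<in>I. \<theta> i y * f y) = f" by (simp add: sum_distrib_right[symmetric] s1)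
  have "(\<integral>x. stein X f x \<partial>P) = (\<integral>x. (\<Sum>i\<in>I. stein X (\<lambda>y. \<theta> i y * f y) x) \<partial>P)"
    using stein_sum[of X I "\<lambda>i y. \<theta> i y * f y", OF X fC] by (simp only: eq)
  also have "\<dots> = (\<Sum>i\<in>I. \<integral>x. stein X (\<lambda>y. \<theta> i y * f y) x \<partial>P)"
    by (rule P.sum) (rule continuous_stein[OF X fC])
  also have "\<dots> = 0"
  proof (rule sum.neutral, rule ballI)
    fix i assume i: "i \<in> I"
    obtain K where "closed K" "K \<subseteq> N i" "\<And>y. y \<notin> K \<Longrightarrow> \<theta> i y = 0" using K[OF i] by blast
    then show "(\<integral>x. stein X (\<lambda>y. \<theta> i y * f y) x \<partial>P) = 0"
      unfolding N_def by (intro stein_identity_local[OF X chart_at(1) fC[OF i]]) auto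
  qed
  finally show ?thesis .
qed

text \<open>All weights sit inside one coordinate derivative, where a suitable choice of
  \<open>f\<close> can cancel them.\<close>

lemma stein_chart:
  assumes X: "smooth_vector_field A X" and c: "c \<in> A" and x: "x \<in> fst c" and f: "C1_fun f"
  shows "vdens c (snd c x) * p x * stein X f x =
    (\<Sum>i\<in>UNIV. frechet_derivative (\<lambda>u. p (chart_inv c u) * f (chart_inv c u) * (vdens c u * X (chart_inv c u) c $ i)) (at (snd c x)) (axis i 1))"
proof -
  have u: "snd c x \<in> img c" using x by simp
  have "C1_on (img c) (\<lambda>u. p (chart_inv c u) * f (chart_inv c u))"
    using C1_funD[OF C1_fun_mult[OF p_C1 f] c] by (simp add: o_def)
  from divergence_product[OF X c u this]
  show ?thesis
    using vf_deriv_C1[of X x, OF vector_field_tangent[OF X] C1_fun_mult[OF p_C1 f] c x] divergence_chart[OF X c x]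
    by (simp add: p_stein[OF X f] mult.assoc inv_coord[OF c x] chart_deriv_def o_def)
qed

end

section \<open>Uniqueness of the annihilating functional\<close>

text \<open>Cramer's rule writes the solution as quotients of determinants, which inherit the
  regularity of the entries.\<close>

lemma C1_on_solve:
  fixes M :: "'u::real_normed_vector \<Rightarrow> real ^ 'n ^ 'n"
  assumes M: "\<And>i j. C1_on S (\<lambda>s. M s $ i $ j)" and d: "\<And>s. s \<in> S \<Longrightarrow> det (M s) \<noteq> 0"
  shows "\<exists>h. C1_on S h \<and> (\<forall>s\<in>S. M s *v h s = e)"
proof -
  define h where "h s = (\<chi> k. det (\<chi> i j. if j = k then e $ i else M s $ i $ j) / det (M s))" for s
  have "M s *v h s = e" if "s \<in> S" for s using cramer[OF d[OF that]] unfolding h_def by blast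
  moreover have "C1_on S h"
  proof (rule C1_on_vec)
    fix k
    have "C1_on S (\<lambda>s. det (\<chi> i j. if j = k then e $ i else M s $ i $ j))"
    proof (rule C1_on_det)
      show "C1_on S (\<lambda>s. (\<chi> i j. if j = k then e $ i else M s $ i $ j) $ i $ j)" for i j
        by (cases "j = k") (simp_all add: M)
    qed
    then show "C1_on S (\<lambda>s. h s $ k)" unfolding h_def by (simp add: C1_on_divide C1_on_det M d)
  qed
  ultimately show ?thesis by blast
qed

text \<open>A given pointwise solution is unique and hence equals Cramer's formula. Applied to the
  derivative of a local inverse, this gives C1 regularity of that inverse.\<close>

lemma continuous_on_solve:
  fixes M :: "'u::topological_space \<Rightarrow> real ^ 'n ^ 'n"
  assumes M: "\<And>i j. continuous_on S (\<lambda>s. M s $ i $ j)" and d: "\<And>s. s \<in> S \<Longrightarrow> det (M s) \<noteq> 0"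
    and h: "\<And>s. s \<in> S \<Longrightarrow> M s *v h s = e"
  shows "continuous_on S h"
proof -
  define h' where "h' s = (\<chi> k. det (\<chi> i j. if j = k then e $ i else M s $ i $ j) / det (M s))" for s
  have "h s = h' s" if "s \<in> S" for s using cramer[OF d[OF that]] h[OF that] unfolding h'_def by blast
  moreover have "continuous_on S h'"
  proof -
    have det: "continuous_on S (\<lambda>s. det (N s))" if "\<And>i j. continuous_on S (\<lambda>s. N s $ i $ j)" for N :: "'u \<Rightarrow> real ^ 'n ^ 'n"
      unfolding det_def by (intro continuous_intros that)
    have "continuous_on S (\<lambda>s. det (\<chi> i j. if j = k then e $ i else M s $ i $ j))" for k
    proof (rule det)
      show "continuous_on S (\<lambda>s. (\<chi> i j. if j = k then e $ i else M s $ i $ j) $ i $ j)" for i j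
        by (cases "j = k") (simp_all add: M)
    qed
    then show ?thesis unfolding h'_def[abs_def]
      by (intro continuous_on_vec_lambda continuous_on_divide det[OF M] ballI d)
  qed
  ultimately show ?thesis by (simp cong: continuous_on_cong)
qed

lemma matrix_vector_nonzero_det:
  fixes M :: "real ^ 'n ^ 'n" assumes "\<And>y. M *v y = 0 \<Longrightarrow> y = 0" shows "det M \<noteq> 0"
proof
  assume "det M = 0"
  then have "\<not> invertible M" by (simp add: invertible_det_nz)
  then obtain y where "y \<noteq> 0" "M *v y = 0"
    by (metis invertible_left_inverse matrix_left_invertible_ker)
  then show False using assms by blast
qed

text \<open>A linear left inverse \<open>\<pi>\<close> of the derivative at \<open>u0\<close> turns
  \<open>\<pi> \<circ> q\<close> into a local diffeomorphism. Its inverse composed with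
  \<open>\<pi>\<close> is a left inverse of \<open>q\<close> on an open set of the target space, not
  merely on the image.\<close>

lemma C1_immersion_left_inverse:
  fixes q :: "real ^ 'n \<Rightarrow> real ^ 'd"
  assumes S: "open S" "u0 \<in> S" and q: "C1_on S q" and inj: "inj (frechet_derivative q (at u0))"
  obtains U W \<sigma> where "open U" "u0 \<in> U" "U \<subseteq> S" "open W" "C1_on W \<sigma>" "\<And>u. u \<in> U \<Longrightarrow> q u \<in> W \<and> \<sigma> (q u) = u"
proof -
  let ?D = "\<lambda>u. frechet_derivative q (at u)"
  have lin: "linear (?D u)" if "u \<in> S" for u using C1_on_has_derivative[OF q that] by (rule has_derivative_linear)
  obtain \<pi> where \<pi>: "linear \<pi>" "\<pi> \<circ> ?D u0 = id" using linear_injective_left_inverse[OF lin[OF S(2)] inj] by blast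
  have \<pi>b: "bounded_linear \<pi>" using \<pi>(1) by (simp add: linear_conv_bounded_linear)
  define f where "f u = \<pi> (q u)" for u
  have fC: "C1_on S f" unfolding f_def[abs_def] by (rule C1_on_bounded_linear_compose[OF \<pi>b q])
  have fd: "(f has_derivative (\<lambda>h. \<pi> (?D u h))) (at u)" if "u \<in> S" for u
    unfolding f_def[abs_def] by (rule bounded_linear.has_derivative[OF \<pi>b C1_on_has_derivative[OF q that]])
  define f' where "f' u = Blinfun (\<lambda>h. \<pi> (?D u h))" for u
  have f': "blinfun_apply (f' u) = (\<lambda>h. \<pi> (?D u h))" if "u \<in> S" for u
    unfolding f'_def by (rule bounded_linear_Blinfun_apply[OF has_derivative_bounded_linear[OF fd[OF that]]])
  have cD: "continuous_on S (\<lambda>u. \<pi> (?D u h))" for h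
    by (intro bounded_linear.continuous_on[OF \<pi>b] C1_on_continuous_derivative[OF q])
  have cf': "continuous_on S f'"
    by (rule continuous_on_blinfun_componentwise) (use cD in \<open>simp add: f' cong: continuous_on_cong\<close>)
  have id0: "id_blinfun o\<^sub>L f' u0 = id_blinfun"
    by (rule blinfun_eqI) (use \<pi>(2) in \<open>simp add: f'[OF S(2)] fun_eq_iff\<close>)
  obtain U V \<tau> \<tau>' where U: "open U" "U \<subseteq> S" "u0 \<in> U" and V: "open V" and hom: "homeomorphism U V f \<tau>"
    and \<tau>: "\<And>y. y \<in> V \<Longrightarrow> (\<tau> has_derivative (\<tau>' y)) (at y)" "\<And>y. y \<in> V \<Longrightarrow> \<tau>' y = inv (blinfun_apply (f' (\<tau> y)))"
    "\<And>y. y \<in> V \<Longrightarrow> bij (blinfun_apply (f' (\<tau> y)))"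
    using inverse_function_theorem[OF S(1) _ cf' S(2) id0, of f] fd f' by metis
  have \<tau>V: "\<tau> y \<in> S" if "y \<in> V" for y using hom U(2) that unfolding homeomorphism_def by blast
  have \<tau>c: "continuous_on V \<tau>" using hom by (simp add: homeomorphism_def)
  have \<tau>C: "C1_on V \<tau>"
  proof (rule C1_onI[OF \<tau>(1)])
    fix v
    \<comment> \<open>The inverse function theorem describes the derivative of \<open>\<tau>\<close>
      pointwise as an inverse map; in matrix form, Cramer's rule shows that it varies
      continuously.\<close>
    define M where "M y = matrix (blinfun_apply (f' (\<tau> y)))" for y
    have Mv: "M y *v h = \<pi> (?D (\<tau> y) h)" if "y \<in> V" for y h
    proof -
      have bl: "linear (blinfun_apply (f' (\<tau> y)))" by (simp add: blinfun.bounded_linear_right bounded_linear.linear)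
      have "M y *v h = blinfun_apply (f' (\<tau> y)) h" unfolding M_def by (rule matrix_works[OF bl[folded linear_matrix_vector_mul_eq]])
      then show ?thesis by (simp add: f'[OF \<tau>V[OF that]])
    qed
    show "continuous_on V (\<lambda>y. \<tau>' y v)"
    proof (rule continuous_on_solve[of V M _ v])
      fix i j
      have "continuous_on V (\<lambda>y. \<pi> (?D (\<tau> y) (axis j 1)) $ i)"
        by (intro continuous_intros continuous_on_compose2[OF cD \<tau>c]) (use \<tau>V in auto)
      moreover have "M y $ i $ j = \<pi> (?D (\<tau> y) (axis j 1)) $ i" if "y \<in> V" for y
        using Mv[OF that, of "axis j 1"] by (metis column_def matrix_vector_mul_component matrix_vector_mult_basis vec_lambda_beta)
      ultimately show "continuous_on V (\<lambda>y. M y $ i $ j)" by (simp cong: continuous_on_cong)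
    next
      fix y assume y: "y \<in> V"
      have bl: "linear (blinfun_apply (f' (\<tau> y)))" by (simp add: blinfun.bounded_linear_right bounded_linear.linear)
      show "det (M y) \<noteq> 0"
      proof (rule matrix_vector_nonzero_det)
        fix h assume "M y *v h = 0"
        then have "blinfun_apply (f' (\<tau> y)) h = 0" using Mv[OF y] f'[OF \<tau>V[OF y]] by simp
        then show "h = 0" using linear_injective_0[OF bl] bij_is_inj[OF \<tau>(3)[OF y]] by blast
      qed
      have "blinfun_apply (f' (\<tau> y)) (\<tau>' y v) = v" using \<tau>(2,3)[OF y] by (simp add: bij_is_surj surj_f_inv_f)
      then show "M y *v \<tau>' y v = v" using Mv[OF y] f'[OF \<tau>V[OF y]] by simp
    qed
  qed
  show ?thesis
  proof (rule that[of U "\<pi> -` V" "\<lambda>z. \<tau> (\<pi> z)"])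
    show "open (\<pi> -` V)" using V bounded_linear.continuous_on[OF \<pi>b continuous_on_id] by (intro open_vimage) (auto simp: id_def)
    show "C1_on (\<pi> -` V) (\<lambda>z. \<tau> (\<pi> z))" by (rule C1_on_compose[OF \<tau>C C1_on_bounded_linear[OF \<pi>b]]) auto
    show "q u \<in> \<pi> -` V \<and> \<tau> (\<pi> (q u)) = u" if "u \<in> U" for u
      using hom that unfolding homeomorphism_def f_def by auto
  qed (use U in auto)
qed

lemma real_polynomial_function_C1:
  fixes f :: "'e::euclidean_space \<Rightarrow> real"
  shows "real_polynomial_function f \<Longrightarrow> C1_on S f"
  by (induction rule: real_polynomial_function.induct)
    (auto intro: C1_on_bounded_linear C1_on_add C1_on_mult)

section \<open>Ambient extensions of functions supported in a chart\<close>

context embedded_manifold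
begin

text \<open>Annihilation will be known for ambient test functions, while test functions are chosen
  in coordinates. A local left inverse of the embedding carries a coordinate function into the
  ambient space, and an ambient cutoff makes it global.\<close>

lemma chart_function_extension:
  assumes c: "c \<in> A" and x0: "x0 \<in> fst c"
  obtains r where "r > 0" "cball (snd c x0) r \<subseteq> img c"
    "\<And>f. C1_on UNIV f \<Longrightarrow> (\<And>u. u \<notin> cball (snd c x0) r \<Longrightarrow> f u = (0::real)) \<Longrightarrow>
      \<exists>F K. C1_on UNIV F \<and> compact K \<and> (\<forall>z. z \<notin> K \<longrightarrow> F z = 0) \<and> (\<forall>x. F (\<psi> x) = (if x \<in> fst c then f (snd c x) else 0))"
proof -
  let ?u0 = "snd c x0"
  define q where "q = \<psi> \<circ> chart_inv c"
  have qC: "C1_on (img c) q" unfolding q_def by (rule C1_funD[OF \<psi>_C1 c])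
  have u0: "?u0 \<in> img c" using x0 by simp
  have "inj (frechet_derivative q (at ?u0))" using embedding c x0 unfolding smooth_embedding_def q_def by blast
  then obtain U W \<sigma> where U: "open U" "?u0 \<in> U" "U \<subseteq> img c" and W: "open W" and \<sigma>: "C1_on W \<sigma>"
    and inv: "\<And>u. u \<in> U \<Longrightarrow> q u \<in> W \<and> \<sigma> (q u) = u"
    by (rule C1_immersion_left_inverse[OF open_img[OF c] u0 qC]) (rule that; assumption)
  have q0: "q ?u0 = \<psi> x0" using inv_coord[OF c x0] by (simp add: q_def)
  have qx: "q (snd c x) = \<psi> x" if "x \<in> fst c" for x using inv_coord[OF c that] by (simp add: q_def)
  have "x0 \<in> chart_inv c ` U" using U(2) inv_coord[OF c x0] by (metis imageI)
  \<comment> \<open>Here the embedding is more than an immersion: every point of the manifold whose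
    image is near \<open>\<psi> x0\<close> lies in the same coordinate patch.\<close>
  from embedding_nbhd[OF open_inv_image[OF c U(1,3)] this]
  obtain R1 where R1: "R1 > 0" "\<And>y. norm (\<psi> y - \<psi> x0) \<le> R1 \<Longrightarrow> y \<in> chart_inv c ` U" by blast
  have "\<psi> x0 \<in> W" using inv[OF U(2)] q0 by simp
  then obtain R2 where R2: "R2 > 0" "cball (\<psi> x0) R2 \<subseteq> W" using W open_contains_cball by blast
  define R where "R = min R1 R2"
  have R: "R > 0" "\<And>y. norm (\<psi> y - \<psi> x0) \<le> R \<Longrightarrow> y \<in> chart_inv c ` U" "cball (\<psi> x0) R \<subseteq> W"
    using R1 R2 by (auto simp: R_def)
  define \<beta> where "\<beta> z = bump R (z - \<psi> x0)" for z
  have \<beta>C: "C1_on S \<beta>" for S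
  proof -
    have "C1_on S (\<lambda>w. w - \<psi> x0)" using C1_on_add[OF C1_on_bounded_linear[OF bounded_linear_ident] C1_on_const[of S "- \<psi> x0"]] by simp
    then show ?thesis unfolding \<beta>_def[abs_def] by (rule C1_on_compose[OF C1_on_bump[of UNIV]]) auto
  qed
  define U1 where "U1 = U \<inter> (img c \<inter> q -` ball (\<psi> x0) R)"
  have U1: "open U1" "?u0 \<in> U1" unfolding U1_def
    using continuous_open_preimage[OF C1_on_imp_continuous_on[OF qC] open_img[OF c] open_ball, of "\<psi> x0" R] U u0 q0 R(1) by auto
  then obtain r where r: "r > 0" "cball ?u0 r \<subseteq> U1" using open_contains_cball by blast
  have \<beta>pos: "\<beta> (q u) > 0" if "u \<in> U1" for u
    using that R(1) by (auto simp: U1_def \<beta>_def bump_pos_iff dist_norm norm_minus_commute)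
  show ?thesis
  proof (rule that[OF r(1)])
    show "cball ?u0 r \<subseteq> img c" using r(2) by (auto simp: U1_def)
    fix f assume f: "C1_on UNIV f" and f0: "\<And>u. u \<notin> cball ?u0 r \<Longrightarrow> f u = (0::real)"
    \<comment> \<open>Dividing by the cutoff in advance lets the factor \<open>\<beta>\<close> in
      \<open>F\<close> restore \<open>f\<close> exactly on the manifold.\<close>
    define f1 where "f1 u = (if u \<in> U1 then f u / \<beta> (q u) else 0)" for u
    have f1C: "C1_on UNIV f1" unfolding f1_def[abs_def]
    proof (rule C1_on_extend_zero[OF U1(1) _ closed_cball r(2)])
      have "C1_on U1 (\<lambda>u. \<beta> (q u))" by (rule C1_on_compose[OF \<beta>C[of UNIV] C1_on_subset[OF qC]]) (auto simp: U1_def)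
      then show "C1_on U1 (\<lambda>u. f u / \<beta> (q u))" using \<beta>pos by (intro C1_on_divide C1_on_subset[OF f]) force+
    qed (use f0 in auto)
    define F where "F z = (if z \<in> W then f1 (\<sigma> z) * \<beta> z else 0)" for z
    have \<beta>0: "\<beta> z = 0" if "z \<notin> cball (\<psi> x0) R" for z using that R(1) by (simp add: \<beta>_def bump_zero_iff dist_norm norm_minus_commute)
    show "\<exists>F K. C1_on UNIV F \<and> compact K \<and> (\<forall>z. z \<notin> K \<longrightarrow> F z = 0) \<and> (\<forall>x. F (\<psi> x) = (if x \<in> fst c then f (snd c x) else 0))"
    proof (intro exI[of _ F] exI[of _ "cball (\<psi> x0) R"] conjI allI impI)
      show "C1_on UNIV F" unfolding F_def[abs_def]
        by (rule C1_on_extend_zero[OF W _ closed_cball R(3)])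
          (use \<beta>0 in \<open>auto intro!: C1_on_mult \<beta>C C1_on_compose[OF f1C \<sigma>]\<close>)
      show "F z = 0" if "z \<notin> cball (\<psi> x0) R" for z using \<beta>0[OF that] by (simp add: F_def)
      fix x
      show "F (\<psi> x) = (if x \<in> fst c then f (snd c x) else 0)"
      proof (cases "norm (\<psi> x - \<psi> x0) < R")
        case True
        then have "x \<in> chart_inv c ` U" using R(2) by simp
        then obtain u where u: "u \<in> U" "x = chart_inv c u" by blast
        then have ui: "u \<in> img c" using U(3) by blast
        then have x: "x \<in> fst c" "snd c x = u" using u inv_dom[OF c ui] coord_inv[OF c ui] by auto
        then have qu: "q u = \<psi> x" using qx[OF x(1)] by simp
        have "u \<in> U1" unfolding U1_def using u(1) ui True by (simp add: qu dist_norm norm_minus_commute)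
        moreover have "\<psi> x \<in> W" "\<sigma> (\<psi> x) = u" using inv[OF u(1)] qu by auto
        ultimately show ?thesis using \<beta>pos[of u] x by (simp add: F_def f1_def qu)
      next
        case False
        then have "\<beta> (\<psi> x) = 0" using R(1) by (simp add: \<beta>_def bump_zero_iff)
        moreover have "f (snd c x) = 0" if "x \<in> fst c"
        proof (rule f0)
          show "snd c x \<notin> cball ?u0 r"
          proof
            assume "snd c x \<in> cball ?u0 r"
            then have "snd c x \<in> U1" using r(2) by blast
            then show False using False qx[OF that] by (simp add: U1_def dist_norm norm_minus_commute)
          qed
        qed
        ultimately show ?thesis by (simp add: F_def)
      qed
    qed simp
  qed
qed

lemma compact_inv_image:
  assumes c: "c \<in> A" and K: "compact K" "K \<subseteq> img c" shows "closed (chart_inv c ` K)"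
  by (intro compact_imp_closed compact_continuous_image K continuous_on_subset[OF cont_inv[OF c]])

lemma coord_in_iff:
  assumes c: "c \<in> A" "x \<in> fst c" and K: "K \<subseteq> img c" shows "x \<in> chart_inv c ` K \<longleftrightarrow> snd c x \<in> K"
proof
  assume "x \<in> chart_inv c ` K"
  then obtain u where "u \<in> K" "x = chart_inv c u" by blast
  then show "snd c x \<in> K" using coord_inv[OF c(1), of u] K by auto
next
  assume "snd c x \<in> K" then show "x \<in> chart_inv c ` K" using inv_coord[OF c] by (metis imageI)
qed

lemma inv_image_dom: "c \<in> A \<Longrightarrow> K \<subseteq> img c \<Longrightarrow> chart_inv c ` K \<subseteq> fst c"
  using inv_dom by blast

end

section \<open>From Stein operators to Lebesgue measure in coordinates\<close>

lemma (in stein_setting) stein_zero: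
  assumes X: "smooth_vector_field A X" and W: "open W" "x \<in> W" "\<And>y. y \<in> W \<Longrightarrow> f y = 0"
  shows "stein X f x = 0"
proof -
  let ?c = "chart_at A x"
  have "frechet_derivative (f \<circ> chart_inv ?c) (at (snd ?c x)) = frechet_derivative (\<lambda>_. 0) (at (snd ?c x))"
  proof (rule frechet_derivative_cong_open[OF open_img_restrict[OF chart_at(1) W(1)]])
    show "snd ?c x \<in> snd ?c ` (fst ?c \<inter> W)" using chart_at(2) W(2) by blast
    show "(f \<circ> chart_inv ?c) u = 0" if "u \<in> snd ?c ` (fst ?c \<inter> W)" for u
      using that W(3) inv_coord[OF chart_at(1)] by auto
  qed
  then show ?thesis using W(2,3) by (simp add: stein_def vf_deriv_def Let_def)
qed

locale stein_functional = stein_setting A g vol \<psi> P p + L: mean_functional \<psi> \<Lambda>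
  for A :: "('a::{t2_space, second_countable_topology}, 'n::finite) chart set" and g and vol
    and \<psi> :: "'a \<Rightarrow> real ^ 'd" and P p and \<Lambda> :: "('a \<Rightarrow> real) \<Rightarrow> real" +
  fixes I :: "nat set" and D :: "nat \<Rightarrow> 'a \<Rightarrow> ('a, 'n) tvec"
  assumes I: "finite I" and fields: "\<And>l. l \<in> I \<Longrightarrow> smooth_vector_field A (D l)"
    and spans: "\<And>x. spans_tangent_space A x I (\<lambda>l. D l x)"
    and ann: "\<And>l F K. l \<in> I \<Longrightarrow> C1_on UNIV F \<Longrightarrow> compact K \<Longrightarrow> (\<And>z. z \<notin> K \<Longrightarrow> F z = 0) \<Longrightarrow>
      \<Lambda> (stein (D l) (\<lambda>y. F (\<psi> y))) = 0"
    and connected: "connected (UNIV :: 'a set)"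
begin

text \<open>The reciprocal of the density of \<open>P\<close> against Lebesgue measure in the chart;
  multiplication by it turns \<open>P\<close> into Lebesgue measure there.\<close>

definition wt :: "('a, 'n) chart \<Rightarrow> 'a \<Rightarrow> real" where
  "wt c x = 1 / (vdens c (snd c x) * p x)"

text \<open>Writing a constant field \<open>e\<close> as \<open>\<Sum>l. a\<^sub>l D\<^sup>l\<close> in the chart and testing with
  \<open>f\<^sub>l = \<phi> a\<^sub>l / (p \<surd>det g)\<close>, the sum of the Stein operators collapses to
  \<open>D\<phi>(e) / (p \<surd>det g)\<close>.\<close>

lemma gradient_annihilated:
  assumes c: "c \<in> A" and x0: "x0 \<in> fst c"
  obtains r where "r > 0" "cball (snd c x0) r \<subseteq> img c"
    "\<And>\<phi> e. C1_on UNIV \<phi> \<Longrightarrow> (\<And>u. u \<notin> cball (snd c x0) r \<Longrightarrow> \<phi> u = 0) \<Longrightarrow>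
      \<Lambda> (\<lambda>x. if x \<in> fst c then wt c x * frechet_derivative \<phi> (at (snd c x)) e else 0) = 0"
proof -
  obtain r where r: "r > 0" "cball (snd c x0) r \<subseteq> img c"
    and ext: "\<And>f. C1_on UNIV f \<Longrightarrow> (\<And>u. u \<notin> cball (snd c x0) r \<Longrightarrow> f u = (0::real)) \<Longrightarrow>
      \<exists>F K. C1_on UNIV F \<and> compact K \<and> (\<forall>z. z \<notin> K \<longrightarrow> F z = 0) \<and> (\<forall>x. F (\<psi> x) = (if x \<in> fst c then f (snd c x) else 0))"
    by (rule chart_function_extension[OF c x0]) (rule that; blast)
  show ?thesis
  proof (rule that[OF r])
    let ?B = "cball (snd c x0) r"
    fix \<phi> :: "real ^ 'n \<Rightarrow> real" and e
    assume \<phi>: "C1_on UNIV \<phi>" and \<phi>0: "\<And>u. u \<notin> ?B \<Longrightarrow> \<phi> u = 0"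
    define X where "X l u = D l (chart_inv c u) c" for l u
    have XC: "C1_on (img c) (X l)" if "l \<in> I" for l unfolding X_def[abs_def] by (rule vector_field_C1[OF fields[OF that] c])
    \<comment> \<open>The frame operator of the fields, invertible because they span. With
      \<open>h\<close> solving \<open>G u *v h u = e\<close>, the coefficients
      \<open>X l u \<bullet> h u\<close> represent \<open>e\<close> and are C1, although the fields
      need not be linearly independent.\<close>
    define G where "G u = (\<chi> i j. \<Sum>l\<in>I. X l u $ i * X l u $ j)" for u
    have Gv: "G u *v y = (\<Sum>l\<in>I. (X l u \<bullet> y) *\<^sub>R X l u)" for u y
    proof (rule vec_eq_iff[THEN iffD2], rule allI)
      fix i
      have "(G u *v y) $ i = (\<Sum>j\<in>UNIV. \<Sum>l\<in>I. X l u $ i * X l u $ j * y $ j)"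
        by (simp add: G_def matrix_vector_mult_def sum_distrib_right)
      also have "\<dots> = (\<Sum>l\<in>I. \<Sum>j\<in>UNIV. X l u $ i * X l u $ j * y $ j)" by (rule sum.swap)
      also have "\<dots> = (\<Sum>l\<in>I. (X l u \<bullet> y) *\<^sub>R X l u) $ i"
        by (simp add: inner_vec_def sum_distrib_left mult_ac)
      finally show "(G u *v y) $ i = (\<Sum>l\<in>I. (X l u \<bullet> y) *\<^sub>R X l u) $ i" .
    qed
    have det: "det (G u) \<noteq> 0" if u: "u \<in> img c" for u
    proof (rule matrix_vector_nonzero_det)
      fix y assume "G u *v y = 0"
      then have "0 = y \<bullet> (G u *v y)" by simp
      also have "\<dots> = (\<Sum>l\<in>I. (X l u \<bullet> y)\<^sup>2)"
        unfolding Gv inner_sum_right by (simp add: power2_eq_square inner_commute)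
      finally have z: "X l u \<bullet> y = 0" if "l \<in> I" for l using sum_nonneg_eq_0_iff[OF I, of "\<lambda>l. (X l u \<bullet> y)\<^sup>2"] that by simp
      obtain a where "y = (\<Sum>l\<in>I. a l *\<^sub>R X l u)"
        unfolding X_def by (rule spans_chart[OF spans c inv_dom[OF c u]])
      then have "y \<bullet> y = (\<Sum>l\<in>I. a l *\<^sub>R X l u) \<bullet> y" by (rule arg_cong)
      also have "\<dots> = (\<Sum>l\<in>I. a l * (X l u \<bullet> y))" by (simp add: inner_sum_left)
      finally have "y \<bullet> y = (\<Sum>l\<in>I. a l * (X l u \<bullet> y))" .
      then show "y = 0" using z by simp
    qed
    have "C1_on (img c) (\<lambda>u. G u $ i $ j)" for i j
      unfolding G_def by (simp, intro C1_on_sum C1_on_mult C1_on_vec_nth XC)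
    then obtain h where h: "C1_on (img c) h" "\<And>u. u \<in> img c \<Longrightarrow> G u *v h u = e"
      using C1_on_solve[of "img c" G e] det by blast
    define a where "a l u = X l u \<bullet> h u" for l u
    have aC: "C1_on (img c) (a l)" if "l \<in> I" for l
      unfolding a_def[abs_def] inner_vec_def inner_real_def by (intro C1_on_sum C1_on_mult C1_on_vec_nth XC h that)
    have ae: "(\<Sum>l\<in>I. a l u *\<^sub>R X l u) = e" if "u \<in> img c" for u using h(2)[OF that] by (simp add: Gv a_def)
    \<comment> \<open>The denominator cancels the weights in \<open>stein_chart\<close>, leaving the
      coordinate divergence of \<phi> a_l X_l.\<close>
    define f where "f l u = (if u \<in> img c then \<phi> u * a l u / (p (chart_inv c u) * vdens c u) else 0)" for l u
    have fC: "C1_on UNIV (f l)" if "l \<in> I" for l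
      unfolding f_def[abs_def]
    proof (rule C1_on_extend_zero[OF open_img[OF c] _ closed_cball r(2)])
      have "C1_on (img c) (\<lambda>u. p (chart_inv c u))" using C1_funD[OF p_C1 c] by (simp add: o_def)
      then show "C1_on (img c) (\<lambda>u. \<phi> u * a l u / (p (chart_inv c u) * vdens c u))"
        by (intro C1_on_divide C1_on_mult C1_on_subset[OF \<phi>] aC that vdens_C1[OF c])
          (use p_pos vdens_pos[OF c] in \<open>auto simp: less_imp_neq[symmetric]\<close>)
    qed (use \<phi>0 in auto)
    have f0: "f l u = 0" if "u \<notin> ?B" for l u using \<phi>0[OF that] by (simp add: f_def)
    have "\<forall>l\<in>I. \<exists>F. (\<exists>K. C1_on UNIV F \<and> compact K \<and> (\<forall>z. z \<notin> K \<longrightarrow> F z = 0)) \<and> (\<forall>x. F (\<psi> x) = (if x \<in> fst c then f l (snd c x) else 0))"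
      using ext[OF fC f0] by blast
    from bchoice[OF this] obtain F where FF: "\<forall>l\<in>I. (\<exists>K. C1_on UNIV (F l) \<and> compact K \<and> (\<forall>z. z \<notin> K \<longrightarrow> F l z = 0)) \<and>
        (\<forall>x. F l (\<psi> x) = (if x \<in> fst c then f l (snd c x) else 0))" by (rule exE)
    have F: "\<exists>K. C1_on UNIV (F l) \<and> compact K \<and> (\<forall>z. z \<notin> K \<longrightarrow> F l z = 0)"
      and Ff: "\<And>x. F l (\<psi> x) = (if x \<in> fst c then f l (snd c x) else 0)" if "l \<in> I" for l
      using bspec[OF FF that] by auto
    define T where "T l = stein (D l) (\<lambda>y. F l (\<psi> y))" for l
    have FC: "C1_fun (\<lambda>y. F l (\<psi> y))" if "l \<in> I" for l
      using F[OF that] by (blast intro: C1_fun_compose[OF _ \<psi>_C1])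
    have T0: "\<Lambda> (T l) = 0" if "l \<in> I" for l
      unfolding T_def using F[OF that] ann[OF that, of "F l"] by blast
    have Tsum: "(\<Sum>l\<in>I. T l x) = (if x \<in> fst c then wt c x * frechet_derivative \<phi> (at (snd c x)) e else 0)" for x
    proof (cases "x \<in> fst c")
      case False
      have "T l x = 0" if l: "l \<in> I" for l
        unfolding T_def
      proof (rule stein_zero[OF fields[OF l], of "- chart_inv c ` ?B"])
        show "open (- chart_inv c ` ?B)" using compact_inv_image[OF c compact_cball r(2)] by auto
        show "x \<in> - chart_inv c ` ?B" using False inv_image_dom[OF c r(2)] by blast
        fix y assume "y \<in> - chart_inv c ` ?B"
        then show "F l (\<psi> y) = 0" using coord_in_iff[OF c _ r(2), of y] f0 by (auto simp: Ff[OF l])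
      qed
      then show ?thesis using False by simp
    next
      case True
      define u where "u = snd c x"
      have u: "u \<in> img c" using True by (simp add: u_def)
      have pos: "vdens c u * p x > 0" using vdens_pos[OF c u] p_pos by simp
      define Q where "Q l i u = \<phi> u * a l u * X l u $ i" for l i u
      have QC: "C1_on (img c) (Q l i)" if "l \<in> I" for l i
        unfolding Q_def[abs_def] by (intro C1_on_mult C1_on_subset[OF \<phi>] aC that C1_on_vec_nth XC) auto
      have Tl: "vdens c u * p x * T l x = (\<Sum>i\<in>UNIV. frechet_derivative (Q l i) (at u) (axis i 1))" if l: "l \<in> I" for l
        unfolding T_def u_def stein_chart[OF fields[OF l] c True FC[OF l]]
      proof (intro sum.cong refl)
        fix i :: 'n
        have "frechet_derivative (\<lambda>u. p (chart_inv c u) * F l (\<psi> (chart_inv c u)) * (vdens c u * D l (chart_inv c u) c $ i)) (at (snd c x))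
          = frechet_derivative (Q l i) (at (snd c x))"
        proof (rule frechet_derivative_cong_open[OF open_img[OF c]])
          fix v assume v: "v \<in> img c"
          have "vdens c v \<noteq> 0" "p (chart_inv c v) \<noteq> 0" using vdens_pos[OF c v] p_pos[of "chart_inv c v"] by auto
          then show "p (chart_inv c v) * F l (\<psi> (chart_inv c v)) * (vdens c v * D l (chart_inv c v) c $ i) = Q l i v"
            using v inv_dom[OF c v] coord_inv[OF c v] by (simp add: Ff[OF l] f_def Q_def X_def)
        qed (use True in simp)
        then show "frechet_derivative (\<lambda>u. p (chart_inv c u) * F l (\<psi> (chart_inv c u)) * (vdens c u * D l (chart_inv c u) c $ i)) (at (snd c x)) (axis i 1)
          = frechet_derivative (Q l i) (at (snd c x)) (axis i 1)" by simp
      qed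
      have Qs: "(\<Sum>l\<in>I. frechet_derivative (Q l i) (at u) v) = e $ i * frechet_derivative \<phi> (at u) v" for i v
      proof -
        have "((\<lambda>u. \<Sum>l\<in>I. Q l i u) has_derivative (\<lambda>v. \<Sum>l\<in>I. frechet_derivative (Q l i) (at u) v)) (at u)"
          by (intro has_derivative_sum C1_on_has_derivative[OF QC u])
        moreover have "((\<lambda>u. e $ i * \<phi> u) has_derivative (\<lambda>v. e $ i * frechet_derivative \<phi> (at u) v)) (at u)"
          by (intro has_derivative_mult_right C1_on_has_derivative[OF \<phi>]) simp
        moreover have "(\<Sum>l\<in>I. Q l i v) = e $ i * \<phi> v" if "v \<in> img c" for v
        proof -
          have "(\<Sum>l\<in>I. Q l i v) = (\<Sum>l\<in>I. a l v *\<^sub>R X l v) $ i * \<phi> v"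
            by (simp add: Q_def sum_distrib_left sum_distrib_right mult_ac)
          then show ?thesis using ae[OF that] by simp
        qed
        ultimately have "((\<lambda>u. e $ i * \<phi> u) has_derivative (\<lambda>v. \<Sum>l\<in>I. frechet_derivative (Q l i) (at u) v)) (at u)"
          using has_derivative_transform_within_open[of "\<lambda>u. \<Sum>l\<in>I. Q l i u" _ u UNIV "img c" "\<lambda>u. e $ i * \<phi> u"] open_img[OF c] u
          by simp
        from has_derivative_unique[OF this \<open>((\<lambda>u. e $ i * \<phi> u) has_derivative (\<lambda>v. e $ i * frechet_derivative \<phi> (at u) v)) (at u)\<close>]
        show ?thesis by (rule fun_cong)
      qed
      have "vdens c u * p x * (\<Sum>l\<in>I. T l x) = (\<Sum>l\<in>I. \<Sum>i\<in>UNIV. frechet_derivative (Q l i) (at u) (axis i 1))"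
        by (simp add: sum_distrib_left Tl)
      also have "\<dots> = (\<Sum>i\<in>UNIV. \<Sum>l\<in>I. frechet_derivative (Q l i) (at u) (axis i 1))" by (rule sum.swap)
      also have "\<dots> = (\<Sum>i\<in>UNIV. e $ i * frechet_derivative \<phi> (at u) (axis i 1))" by (simp only: Qs)
      also have "\<dots> = frechet_derivative \<phi> (at u) e"
        by (rule linear_expand_vec[symmetric, OF has_derivative_linear[OF C1_on_has_derivative[OF \<phi> UNIV_I]]])
      finally have "vdens c u * p x * (\<Sum>l\<in>I. T l x) = frechet_derivative \<phi> (at u) e" .
      then have "(\<Sum>l\<in>I. T l x) = frechet_derivative \<phi> (at u) e / (vdens c u * p x)"
        using pos by (metis less_irrefl nonzero_mult_div_cancel_left)
      then show ?thesis using True by (simp add: wt_def u_def)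
    qed
    have "\<Lambda> (\<lambda>x. \<Sum>l\<in>I. T l x) = (\<Sum>l\<in>I. \<Lambda> (T l))"
      by (rule L.sum) (simp add: T_def continuous_stein fields FC)
    also have "\<dots> = 0" by (simp add: T0)
    finally show "\<Lambda> (\<lambda>x. if x \<in> fst c then wt c x * frechet_derivative \<phi> (at (snd c x)) e else 0) = 0"
      by (simp only: Tsum)
  qed
qed

lemma wt_continuous: "c \<in> A \<Longrightarrow> continuous_on (fst c) (wt c)"
  unfolding wt_def[abs_def]
  by (intro continuous_on_divide continuous_on_mult continuous_on_const ballI
      continuous_on_compose2[OF C1_on_imp_continuous_on[OF vdens_C1] cont_coord]
      continuous_on_subset[OF p_cont])
    (use p_pos vdens_pos in \<open>auto simp: less_imp_neq[symmetric]\<close>)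

text \<open>A functional on a coordinate ball that kills all derivatives is translation invariant; averaging
  over translates as in the uniqueness proof for Haar measure identifies it with Lebesgue measure.\<close>

lemma local_haar:
  assumes c: "c \<in> A" and x0: "x0 \<in> fst c"
  obtains s C where "s > 0" "cball (snd c x0) s \<subseteq> img c"
    "\<And>\<phi>. C1_on UNIV \<phi> \<Longrightarrow> (\<And>u. u \<notin> cball (snd c x0) s \<Longrightarrow> \<phi> u = 0) \<Longrightarrow>
      \<Lambda> (\<lambda>x. if x \<in> fst c then wt c x * \<phi> (snd c x) else 0) = C * (\<integral>u. \<phi> u \<partial>lborel)"
proof -
  let ?u0 = "snd c x0"
  obtain r where r: "r > 0" "cball ?u0 r \<subseteq> img c"
    and grad: "\<And>\<phi> e. C1_on UNIV \<phi> \<Longrightarrow> (\<And>u. u \<notin> cball ?u0 r \<Longrightarrow> \<phi> u = 0) \<Longrightarrow>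
      \<Lambda> (\<lambda>x. if x \<in> fst c then wt c x * frechet_derivative \<phi> (at (snd c x)) e else 0) = 0"
    by (rule gradient_annihilated[OF c x0]) (rule that; blast)
  \<comment> \<open>Test functions live in the ball of radius \<open>s\<close>. Translates by at
    most \<open>s\<close> stay within \<open>2 * s\<close>, where the cutoff below is 1; it vanishes
    beyond \<open>3 * s\<close>, hence outside the ball of radius \<open>r = 4 * s\<close>.\<close>
  define s where "s = r / 4"
  have s: "s > 0" using r by (simp add: s_def)
  have s4: "cball ?u0 (4 * s) = cball ?u0 r" by (simp add: s_def)
  define cut where "cut u = min 1 (max 0 (3 - norm (u - ?u0) / s))" for u
  have cutc: "continuous_on T cut" for T unfolding cut_def[abs_def] by (intro continuous_intros) (use s in auto)
  have cut1: "cut u = 1" if "u \<in> cball ?u0 (2 * s)" for u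
    using that s by (simp add: cut_def dist_norm norm_minus_commute field_simps)
  have cut0: "cut u = 0" if "u \<notin> cball ?u0 r" for u
    using that s by (simp add: cut_def dist_norm norm_minus_commute s_def field_simps)
  define z where "z x = wt c x * cut (snd c x)" for x
  have zc: "continuous_on (fst c) z" unfolding z_def[abs_def]
    by (intro continuous_on_mult wt_continuous[OF c] continuous_on_compose2[OF cutc cont_coord[OF c]]) auto
  have kcl: "closed (chart_inv c ` cball ?u0 r)" "chart_inv c ` cball ?u0 r \<subseteq> fst c"
    using compact_inv_image[OF c compact_cball r(2)] inv_image_dom[OF c r(2)] by auto
  have z0: "z x = 0" if "x \<in> fst c - chart_inv c ` cball ?u0 r" for x
    using that coord_in_iff[OF c _ r(2), of x] cut0 by (auto simp: z_def)
  text \<open>Cutting off keeps the functional below defined and continuous on all continuous functions.\<close>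
  define E where "E \<phi> x = (if x \<in> fst c then z x * \<phi> (snd c x) else 0)" for \<phi> :: "real ^ 'n \<Rightarrow> real" and x
  define \<mu> where "\<mu> \<phi> = \<Lambda> (E \<phi>)" for \<phi>
  have Ejoint: "continuous_on UNIV (\<lambda>(x, v). E (\<lambda>u. \<Phi> u v) x)" if \<Phi>: "continuous_on UNIV (\<lambda>(u, v). \<Phi> u v)"
    for \<Phi> :: "real ^ 'n \<Rightarrow> 'v::t2_space \<Rightarrow> real"
  proof -
    have c1: "continuous_on (fst c \<times> UNIV) (\<lambda>y. z (fst y))" by (rule continuous_on_compose2[OF zc]) (auto intro: continuous_intros)
    have c2: "continuous_on (fst c \<times> UNIV) (\<lambda>y. snd c (fst y))" by (rule continuous_on_compose2[OF cont_coord[OF c]]) (auto intro: continuous_intros)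
    have c3: "continuous_on (fst c \<times> (UNIV :: 'v set)) (\<lambda>y. \<Phi> (snd c (fst y)) (snd y))"
      using continuous_on_compose2[OF \<Phi> continuous_on_Pair[OF c2 continuous_on_snd[OF continuous_on_id]]] by simp
    have "continuous_on UNIV (\<lambda>y. if y \<in> fst c \<times> (UNIV :: 'v set) then z (fst y) * \<Phi> (snd c (fst y)) (snd y) else 0)"
    proof (rule continuous_on_extend_zero[where K = "chart_inv c ` cball ?u0 r \<times> UNIV"])
      show "continuous_on (fst c \<times> UNIV) (\<lambda>y. z (fst y) * \<Phi> (snd c (fst y)) (snd y))" by (intro continuous_on_mult c1 c3)
      show "z (fst y) * \<Phi> (snd c (fst y)) (snd y) = 0"
        if "y \<in> fst c \<times> UNIV - chart_inv c ` cball ?u0 r \<times> UNIV" for y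
      proof -
        have "fst y \<in> fst c - chart_inv c ` cball ?u0 r" using that by (simp add: mem_Times_iff)
        then show ?thesis by (simp add: z0)
      qed
    qed (use open_dom[OF c] kcl in \<open>auto intro: open_Times closed_Times\<close>)
    then show ?thesis by (simp add: E_def case_prod_beta mem_Times_iff)
  qed
  have Ec: "continuous_on UNIV (E \<phi>)" if "continuous_on UNIV \<phi>" for \<phi>
  proof -
    have "continuous_on UNIV (\<lambda>(u, v::real). \<phi> u)" unfolding case_prod_beta
      by (rule continuous_on_compose2[OF that]) (auto intro: continuous_intros)
    from Ejoint[OF this] have "continuous_on (UNIV \<times> UNIV) (\<lambda>(x, v::real). E \<phi> x)" by simp
    from continuous_on_slice[OF continuous_on_swap_args[OF this], of 0] show ?thesis by simp
  qed
  have Escale: "\<mu> (\<lambda>u. k * \<phi> u) = k * \<mu> \<phi>" if "continuous_on UNIV \<phi>" for \<phi> k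
  proof -
    have "E (\<lambda>u. k * \<phi> u) = (\<lambda>x. k * E \<phi> x)" by (auto simp: E_def)
    then show ?thesis unfolding \<mu>_def by (simp add: L.scale[OF Ec[OF that]])
  qed
  have Ewt: "E \<phi> = (\<lambda>x. if x \<in> fst c then wt c x * \<phi> (snd c x) else 0)" if "\<And>u. u \<notin> cball ?u0 (2 * s) \<Longrightarrow> \<phi> u = 0" for \<phi>
  proof
    fix x
    show "E \<phi> x = (if x \<in> fst c then wt c x * \<phi> (snd c x) else 0)"
      using that[of "snd c x"] cut1[of "snd c x"] by (cases "snd c x \<in> cball ?u0 (2 * s)") (auto simp: E_def z_def)
  qed
  have \<mu>grad: "\<mu> (\<lambda>u. frechet_derivative \<phi> (at u) e) = 0"
    if \<phi>: "C1_on UNIV \<phi>" "\<And>u. u \<notin> cball ?u0 (2 * s) \<Longrightarrow> \<phi> u = 0" for \<phi> e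
  proof -
    have "frechet_derivative \<phi> (at u) e = 0" if "u \<notin> cball ?u0 (2 * s)" for u
      by (rule frechet_derivative_zero_outside[OF closed_cball \<phi>(2) that])
    then have "\<mu> (\<lambda>u. frechet_derivative \<phi> (at u) e) = \<Lambda> (\<lambda>x. if x \<in> fst c then wt c x * frechet_derivative \<phi> (at (snd c x)) e else 0)"
      unfolding \<mu>_def by (subst Ewt) auto
    also have "\<dots> = 0" by (rule grad[OF \<phi>(1)]) (use \<phi>(2) s in \<open>auto simp: s_def\<close>)
    finally show ?thesis .
  qed
  have shiftC: "C1_on UNIV (\<lambda>u. \<phi> (u - b))" if "C1_on UNIV \<phi>" for \<phi> :: "real ^ 'n \<Rightarrow> real" and b
  proof (rule C1_on_compose[OF that])
    show "C1_on UNIV (\<lambda>u. u - b)" using C1_on_add[OF C1_on_bounded_linear[OF bounded_linear_ident] C1_on_const[of UNIV "- b"]] by simp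
  qed simp
  have shift: "\<mu> (\<lambda>u. \<phi> (u - a)) = \<mu> \<phi>"
    if \<phi>: "C1_on UNIV \<phi>" "\<And>u. u \<notin> cball ?u0 s \<Longrightarrow> \<phi> u = 0" and a: "norm a \<le> s" for \<phi> a
  proof -
    have \<phi>c: "continuous_on UNIV \<phi>" by (rule C1_on_imp_continuous_on[OF \<phi>(1)])
    \<comment> \<open>Moving the test function along \<open>t *\<^sub>R a\<close>, the functional
      has as derivative its value on a directional derivative, which is zero for \<open>t\<close>
      between 0 and 1.\<close>
    define F where "F t = E (\<lambda>u. \<phi> (u - t *\<^sub>R a))" for t :: real
    define F' where "F' t = E (\<lambda>u. - frechet_derivative \<phi> (at (u - t *\<^sub>R a)) a)" for t :: real
    have D: "((\<lambda>t. \<Lambda> (F t)) has_real_derivative \<Lambda> (F' t)) (at t)" for t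
    proof (rule L.deriv_param[of UNIV])
      fix t x
      have "((\<lambda>t. \<phi> (snd c x + t *\<^sub>R (- a))) has_real_derivative frechet_derivative \<phi> (at (snd c x + t *\<^sub>R (- a))) (- a)) (at t)"
        by (rule C1_on_line_real_derivative[OF \<phi>(1)]) simp
      moreover have "frechet_derivative \<phi> (at v) (- a) = - frechet_derivative \<phi> (at v) a" for v
        by (rule linear_neg[OF has_derivative_linear[OF C1_on_has_derivative[OF \<phi>(1) UNIV_I]]])
      ultimately have "((\<lambda>t. \<phi> (snd c x - t *\<^sub>R a)) has_real_derivative - frechet_derivative \<phi> (at (snd c x - t *\<^sub>R a)) a) (at t)" by simp
      then show "((\<lambda>t. F t x) has_real_derivative F' t x) (at t)"
        unfolding F_def F'_def E_def
        by (cases "x \<in> fst c") (simp_all only: if_True if_False DERIV_cmult DERIV_const)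
      show "continuous_on UNIV (F t)" unfolding F_def
        by (intro Ec continuous_on_compose2[OF \<phi>c]) (auto intro: continuous_intros)
    next
      have "continuous_on UNIV (\<lambda>(u, t). - frechet_derivative \<phi> (at (u - t *\<^sub>R a)) a)"
        unfolding case_prod_beta by (intro continuous_intros C1_on_joint_continuous[OF \<phi>(1)]) auto
      from Ejoint[OF this] have "continuous_on (UNIV \<times> UNIV) (\<lambda>(x, t). F' t x)" by (simp add: F'_def)
      then show "continuous_on (UNIV \<times> UNIV) (\<lambda>(t, x). F' t x)" by (rule continuous_on_swap_args)
    qed auto
    have F'0: "\<Lambda> (F' t) = 0" if t: "0 \<le> t" "t \<le> 1" for t
    proof -
      define \<phi>' where "\<phi>' u = \<phi> (u - t *\<^sub>R a)" for u
      have \<phi>'C: "C1_on UNIV \<phi>'" unfolding \<phi>'_def[abs_def] by (rule shiftC[OF \<phi>(1)])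
      have "frechet_derivative \<phi>' (at u) a = frechet_derivative \<phi> (at (u - t *\<^sub>R a)) a" for u
      proof -
        have "((\<lambda>u. u - t *\<^sub>R a) has_derivative (\<lambda>h. h)) (at u)" by (auto intro!: derivative_eq_intros)
        from has_derivative_compose[OF this C1_on_has_derivative[OF \<phi>(1) UNIV_I]]
        have "(\<phi>' has_derivative frechet_derivative \<phi> (at (u - t *\<^sub>R a))) (at u)" unfolding \<phi>'_def .
        then show ?thesis using frechet_derivative_at by metis
      qed
      then have "\<Lambda> (F' t) = \<mu> (\<lambda>u. (-1) * frechet_derivative \<phi>' (at u) a)" by (simp add: F'_def \<mu>_def)
      also have "\<dots> = (-1) * \<mu> (\<lambda>u. frechet_derivative \<phi>' (at u) a)"
        by (rule Escale[OF C1_on_continuous_derivative[OF \<phi>'C]])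
      also have "\<mu> (\<lambda>u. frechet_derivative \<phi>' (at u) a) = 0"
      proof (rule \<mu>grad[OF \<phi>'C])
        fix u assume u: "u \<notin> cball ?u0 (2 * s)"
        show "\<phi>' u = 0" unfolding \<phi>'_def
        proof (rule \<phi>(2))
          have "norm (t *\<^sub>R a) \<le> s" using t a mult_mono[of t 1 "norm a" s] by simp
          moreover have "norm (u - ?u0) \<le> norm (u - t *\<^sub>R a - ?u0) + norm (t *\<^sub>R a)"
            using norm_triangle_ineq[of "u - t *\<^sub>R a - ?u0" "t *\<^sub>R a"] by (simp add: algebra_simps)
          ultimately show "u - t *\<^sub>R a \<notin> cball ?u0 s" using u by (simp add: dist_norm norm_minus_commute)
        qed
      qed
      finally show ?thesis by simp
    qed
    have "\<exists>t. t > 0 \<and> t < 1 \<and> \<Lambda> (F 1) - \<Lambda> (F 0) = (1 - 0) * \<Lambda> (F' t)" by (rule MVT2) (use D in auto)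
    then have "\<Lambda> (F 1) = \<Lambda> (F 0)" using F'0 by auto
    then show ?thesis by (simp add: F_def \<mu>_def)
  qed
  define \<eta> :: "real ^ 'n \<Rightarrow> real" where "\<eta> = bump s"
  have \<eta>C: "C1_on UNIV \<eta>" unfolding \<eta>_def by (rule C1_on_bump)
  have \<eta>c: "continuous_on UNIV \<eta>" by (rule C1_on_imp_continuous_on[OF \<eta>C])
  have \<eta>0: "\<eta> u = 0" if "u \<notin> cball 0 s" for u using that s by (simp add: \<eta>_def bump_zero_iff)
  define J where "J = (\<integral>u. \<eta> u \<partial>lborel)"
  have J: "J > 0" unfolding J_def
  proof (rule integral_pos_continuous[OF \<eta>c])
    show "integrable lborel \<eta>" by (rule integrable_compact_support[OF \<eta>c compact_cball \<eta>0])
    show "0 < \<eta> 0" using s by (simp add: \<eta>_def bump_pos_iff)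
  qed (simp add: \<eta>_def)
  define C0 where "C0 = \<mu> (\<lambda>u. \<eta> (u - ?u0))"
  have main: "\<mu> \<phi> = C0 / J * (\<integral>u. \<phi> u \<partial>lborel)" if \<phi>: "C1_on UNIV \<phi>" "\<And>u. u \<notin> cball ?u0 s \<Longrightarrow> \<phi> u = 0" for \<phi>
  proof -
    have \<phi>c: "continuous_on UNIV \<phi>" by (rule C1_on_imp_continuous_on[OF \<phi>(1)])
    have cc: "continuous_on S (\<lambda>y. f (h y))" if "continuous_on UNIV f" "continuous_on S h" for f :: "real ^ 'n \<Rightarrow> real" and S :: "((real ^ 'n) \<times> (real ^ 'n)) set" and h
      by (rule continuous_on_compose2[OF that]) auto
    \<comment> \<open>The average of \<open>\<phi> (u - y) * \<eta> y\<close> over \<open>y\<close>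
      is evaluated in two ways: translating \<open>\<phi>\<close> back gives
      \<open>\<mu> \<phi> * J\<close>; after the substitution \<open>v = u - y\<close>, translating
      \<open>\<eta>\<close> back to \<open>?u0\<close> gives \<open>C0\<close> times the integral of
      \<open>\<phi>\<close>.\<close>
    define Q where "Q x y = E (\<lambda>u. \<phi> (u - y) * \<eta> y) x" for x y
    define R where "R x v = E (\<lambda>u. \<phi> v * \<eta> (u - v)) x" for x v
    have Qc: "continuous_on UNIV (\<lambda>(x, y). Q x y)" unfolding Q_def
      by (rule Ejoint) (unfold case_prod_beta, intro continuous_intros cc[OF \<phi>c] cc[OF \<eta>c])
    have Rc: "continuous_on UNIV (\<lambda>(x, y). R x y)" unfolding R_def
      by (rule Ejoint) (unfold case_prod_beta, intro continuous_intros cc[OF \<phi>c] cc[OF \<eta>c])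
    have c1: "continuous_on UNIV (\<lambda>u. f (u - y))" if "continuous_on UNIV f" for f :: "real ^ 'n \<Rightarrow> real" and y
      by (rule continuous_on_compose2[OF that]) (auto intro: continuous_intros)
    have "\<mu> \<phi> * J = (\<integral>y. \<Lambda> (\<lambda>x. Q x y) \<partial>lborel)"
    proof -
      have "\<Lambda> (\<lambda>x. Q x y) = \<mu> \<phi> * \<eta> y" for y
      proof -
        have "\<Lambda> (\<lambda>x. Q x y) = \<mu> (\<lambda>u. \<eta> y * \<phi> (u - y))" by (simp add: Q_def \<mu>_def mult.commute)
        also have "\<dots> = \<eta> y * \<mu> (\<lambda>u. \<phi> (u - y))" by (rule Escale[OF c1[OF \<phi>c]])
        also have "\<dots> = \<mu> \<phi> * \<eta> y"
        proof (cases "norm y \<le> s")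
          case True then show ?thesis using shift[OF \<phi> True] by simp
        next
          case False then show ?thesis using \<eta>0[of y] by simp
        qed
        finally show ?thesis .
      qed
      then show ?thesis by (simp add: J_def)
    qed
    also have "\<dots> = \<Lambda> (\<lambda>x. \<integral>y. Q x y \<partial>lborel)"
      by (rule L.fubini_lborel(1)[OF Qc compact_cball[of 0 s], symmetric]) (simp add: Q_def E_def \<eta>0)
    also have "(\<lambda>x. \<integral>y. Q x y \<partial>lborel) = (\<lambda>x. \<integral>v. R x v \<partial>lborel)"
    proof
      fix x
      have "(\<integral>y. Q x y \<partial>lborel) = (\<integral>v. Q x (snd c x - v) \<partial>lborel)"
        by (rule integral_reflect[symmetric])
          (rule borel_measurable_continuous_onI[OF continuous_on_slice[OF Qc[folded UNIV_Times_UNIV] UNIV_I]])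
      moreover have "Q x (snd c x - v) = R x v" for v by (auto simp: Q_def R_def E_def)
      ultimately show "(\<integral>y. Q x y \<partial>lborel) = (\<integral>v. R x v \<partial>lborel)" by simp
    qed
    also have "\<Lambda> (\<lambda>x. \<integral>v. R x v \<partial>lborel) = (\<integral>v. \<Lambda> (\<lambda>x. R x v) \<partial>lborel)"
      by (rule L.fubini_lborel(1)[OF Rc compact_cball[of ?u0 s]]) (simp add: R_def E_def \<phi>(2))
    also have "\<dots> = (\<integral>v. C0 * \<phi> v \<partial>lborel)"
    proof (intro Bochner_Integration.integral_cong refl)
      fix v
      have "\<Lambda> (\<lambda>x. R x v) = \<mu> (\<lambda>u. \<phi> v * \<eta> (u - v))" by (simp add: R_def \<mu>_def)
      also have "\<dots> = \<phi> v * \<mu> (\<lambda>u. \<eta> (u - v))" by (rule Escale[OF c1[OF \<eta>c]])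
      also have "\<dots> = C0 * \<phi> v"
      proof (cases "v \<in> cball ?u0 s")
        case True
        have "\<mu> (\<lambda>u. \<eta> (u - (v - ?u0) - ?u0)) = \<mu> (\<lambda>u. \<eta> (u - ?u0))"
        proof (rule shift[OF shiftC[OF \<eta>C]])
          show "\<eta> (u - ?u0) = 0" if "u \<notin> cball ?u0 s" for u
            using that by (intro \<eta>0) (simp add: dist_norm norm_minus_commute)
          show "norm (v - ?u0) \<le> s" using True by (simp add: dist_norm norm_minus_commute)
        qed
        then show ?thesis by (simp add: C0_def algebra_simps)
      qed (simp add: \<phi>(2))
      finally show "\<Lambda> (\<lambda>x. R x v) = C0 * \<phi> v" .
    qed
    finally have "\<mu> \<phi> * J = C0 * (\<integral>u. \<phi> u \<partial>lborel)" by simp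
    then show ?thesis using J by (simp add: field_simps)
  qed
  show ?thesis
  proof (rule that[OF s])
    show "cball ?u0 s \<subseteq> img c" using r s by (auto simp: s_def)
    fix \<phi> :: "real ^ 'n \<Rightarrow> real" assume \<phi>: "C1_on UNIV \<phi>" and \<phi>0: "\<And>u. u \<notin> cball ?u0 s \<Longrightarrow> \<phi> u = 0"
    have "\<phi> u = 0" if "u \<notin> cball ?u0 (2 * s)" for u using that s by (intro \<phi>0) auto
    from Ewt[OF this] main[OF \<phi> \<phi>0]
    show "\<Lambda> (\<lambda>x. if x \<in> fst c then wt c x * \<phi> (snd c x) else 0) = C0 / J * (\<integral>u. \<phi> u \<partial>lborel)"
      by (simp add: \<mu>_def)
  qed
qed

end

section \<open>From local to global proportionality\<close>

context stein_functional
begin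

text \<open>With \<open>\<phi>\<close> chosen as \<open>h\<close> times the coordinate density of
  \<open>P\<close>, the weight \<open>wt\<close> cancels and Lebesgue measure turns back into
  \<open>P\<close>. The constant may still depend on \<open>x0\<close>.\<close>

lemma local_proportional:
  "\<exists>N C. open N \<and> x0 \<in> N \<and> (\<exists>c\<in>A. N \<subseteq> fst c) \<and>
    (\<forall>h K. C1_fun h \<and> closed K \<and> K \<subseteq> N \<and> (\<forall>x. x \<notin> K \<longrightarrow> h x = 0) \<longrightarrow> \<Lambda> h = C * (\<integral>x. h x \<partial>P))"
proof -
  define c where "c = chart_at A x0"
  have c: "c \<in> A" and x0: "x0 \<in> fst c" using chart_at by (auto simp: c_def)
  let ?u0 = "snd c x0"
  obtain s C where s: "s > 0" "cball ?u0 s \<subseteq> img c"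
    and haar: "\<And>\<phi>. C1_on UNIV \<phi> \<Longrightarrow> (\<And>u. u \<notin> cball ?u0 s \<Longrightarrow> \<phi> u = 0) \<Longrightarrow>
      \<Lambda> (\<lambda>x. if x \<in> fst c then wt c x * \<phi> (snd c x) else 0) = C * (\<integral>u. \<phi> u \<partial>lborel)"
    by (rule local_haar[OF c x0]) (rule that; blast)
  have B: "ball ?u0 s \<subseteq> img c" using s(2) ball_subset_cball by blast
  show ?thesis
  proof (intro exI[of _ "chart_inv c ` ball ?u0 s"] exI[of _ C] conjI allI impI)
    show "open (chart_inv c ` ball ?u0 s)" by (rule open_inv_image[OF c open_ball B])
    show "x0 \<in> chart_inv c ` ball ?u0 s" using coord_in_iff[OF c x0 B] s(1) by simp
    show "\<exists>c'\<in>A. chart_inv c ` ball ?u0 s \<subseteq> fst c'" using c inv_image_dom[OF c B] by blast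
    fix h :: "'a \<Rightarrow> real" and K
    assume a: "C1_fun h \<and> closed K \<and> K \<subseteq> chart_inv c ` ball ?u0 s \<and> (\<forall>x. x \<notin> K \<longrightarrow> h x = 0)"
    then have h: "C1_fun h" and K: "closed K" "K \<subseteq> chart_inv c ` ball ?u0 s" and h0: "\<And>x. x \<notin> K \<Longrightarrow> h x = 0" by auto
    have Kc: "K \<subseteq> fst c" using K(2) inv_image_dom[OF c B] by blast
    define \<phi> where "\<phi> u = (if u \<in> img c then vdens c u * p (chart_inv c u) * h (chart_inv c u) else 0)" for u
    have K': "compact (snd c ` K)" by (rule compact_coord_image[OF c K(1) Kc])
    have \<phi>C: "C1_on UNIV \<phi>" unfolding \<phi>_def[abs_def]
    proof (rule C1_on_extend_zero[OF open_img[OF c] _ compact_imp_closed[OF K']])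
      show "C1_on (img c) (\<lambda>u. vdens c u * p (chart_inv c u) * h (chart_inv c u))"
        using C1_funD[OF p_C1 c] C1_funD[OF h c] by (intro C1_on_mult vdens_C1[OF c]) (simp_all add: o_def)
      show "vdens c u * p (chart_inv c u) * h (chart_inv c u) = 0" if "u \<in> img c - snd c ` K" for u
        using that chart_support[OF c] h0 by auto
    qed (use Kc in auto)
    have "\<Lambda> (\<lambda>x. if x \<in> fst c then wt c x * \<phi> (snd c x) else 0) = C * (\<integral>u. \<phi> u \<partial>lborel)"
    proof (rule haar[OF \<phi>C])
      fix u assume u: "u \<notin> cball ?u0 s"
      show "\<phi> u = 0"
      proof (cases "u \<in> img c")
        case True
        have "chart_inv c u \<notin> chart_inv c ` ball ?u0 s"
          using coord_in_iff[OF c inv_dom[OF c True] B] coord_inv[OF c True] u by auto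
        then show ?thesis using h0[of "chart_inv c u"] K(2) by (auto simp: \<phi>_def)
      qed (simp add: \<phi>_def)
    qed
    also have "(\<lambda>x. if x \<in> fst c then wt c x * \<phi> (snd c x) else 0) = h"
    proof
      fix x
      show "(if x \<in> fst c then wt c x * \<phi> (snd c x) else 0) = h x"
      proof (cases "x \<in> fst c")
        case True
        then show ?thesis using vdens_pos[OF c, of "snd c x"] p_pos[of x]
          by (simp add: \<phi>_def wt_def inv_coord[OF c])
      qed (use h0 Kc in auto)
    qed
    also have "(\<integral>u. \<phi> u \<partial>lborel) = (\<integral>x. h x \<partial>P)" unfolding \<phi>_def
      by (rule integral_P_chart[symmetric, OF c borel_measurable_continuous_onI[OF C1_fun_continuous[OF h]]])
        (use h0 Kc in auto)
    finally show "\<Lambda> h = C * (\<integral>x. h x \<partial>P)" .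
  qed
qed

text \<open>On overlaps a bump with positive integral against \<open>P\<close> determines the
  constant, so it is locally constant; connectedness makes it global, and total mass 1 fixes its
  value.\<close>

lemma eq_on_C1:
  assumes h: "C1_fun h" shows "\<Lambda> h = (\<integral>x. h x \<partial>P)"
proof -
  obtain N C where N: "\<And>x. open (N x)" "\<And>x. x \<in> N x" "\<And>x. \<exists>c\<in>A. N x \<subseteq> fst c"
    and NC: "\<And>x h K. C1_fun h \<Longrightarrow> closed K \<Longrightarrow> K \<subseteq> N x \<Longrightarrow> (\<And>x. x \<notin> K \<Longrightarrow> h x = 0) \<Longrightarrow> \<Lambda> h = C x * (\<integral>x. h x \<partial>P)"
  proof -
    have "\<forall>x0. \<exists>NC. open (fst NC) \<and> x0 \<in> fst NC \<and> (\<exists>c\<in>A. fst NC \<subseteq> fst c) \<and>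
      (\<forall>h K. C1_fun h \<and> closed K \<and> K \<subseteq> fst NC \<and> (\<forall>x. x \<notin> K \<longrightarrow> h x = 0) \<longrightarrow> \<Lambda> h = snd NC * (\<integral>x. h x \<partial>P))"
      using local_proportional by simp
    from choice[OF this] obtain NC where NC: "\<forall>x0. open (fst (NC x0)) \<and> x0 \<in> fst (NC x0) \<and> (\<exists>c\<in>A. fst (NC x0) \<subseteq> fst c) \<and>
      (\<forall>h K. C1_fun h \<and> closed K \<and> K \<subseteq> fst (NC x0) \<and> (\<forall>x. x \<notin> K \<longrightarrow> h x = 0) \<longrightarrow> \<Lambda> h = snd (NC x0) * (\<integral>x. h x \<partial>P))"
      by (rule exE)
    show ?thesis
      by (rule that[of "\<lambda>x. fst (NC x)" "\<lambda>x. snd (NC x)"]) (use NC in blast)+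
  qed
  have Ceq: "C y = C x" if y: "y \<in> N x" for x y
  proof -
    have NN: "open (N x \<inter> N y)" "y \<in> N x \<inter> N y" using N(1,2) y by auto
    obtain r where r: "r > 0" "\<And>z. norm (\<psi> z - \<psi> y) \<le> r \<Longrightarrow> z \<in> N x \<inter> N y" using embedding_nbhd[OF NN] by blast
    define K where "K = {z. norm (\<psi> z - \<psi> y) \<le> r}"
    have K: "closed K" "K \<subseteq> N x" "K \<subseteq> N y" unfolding K_def using r(2)
      by (auto intro!: closed_Collect_le continuous_intros \<psi>_cont)
    define f where "f z = bump r (\<psi> z - \<psi> y)" for z
    have f: "C1_fun f" "\<And>z. 0 \<le> f z" "0 < f y" unfolding f_def[abs_def] using bump_C1 r(1) by (auto simp: bump_pos_iff)
    have f0: "f z = 0" if "z \<notin> K" for z using that r(1) by (simp add: f_def K_def bump_zero_iff)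
    obtain c where "c \<in> A" "N x \<subseteq> fst c" using N(3) by blast
    then have "0 < (\<integral>z. f z \<partial>P)"
      using P_pos[of c K f y] K f f0 C1_fun_continuous[OF f(1)] by blast
    moreover have "C x * (\<integral>z. f z \<partial>P) = C y * (\<integral>z. f z \<partial>P)"
      by (rule trans[OF NC[OF f(1) K(1,2) f0, symmetric] NC[OF f(1) K(1,3) f0]])
    ultimately show ?thesis by simp
  qed
  obtain x0 :: 'a where True by blast
  have Cc: "C x = C x0" for x
  proof -
    \<comment> \<open>Two open sets collect the neighbourhoods with the constant of
      \<open>x0\<close> and those with another one; they are disjoint because the constant does not
      change within a neighbourhood.\<close>
    define U where "U = \<Union> (N ` {x. C x = C x0})"
    define V where "V = \<Union> (N ` {x. C x \<noteq> C x0})"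
    have UV: "open U" "open V" unfolding U_def V_def using N(1) by auto
    have "C y = C x0" if "y \<in> U" for y using that Ceq by (auto simp: U_def)
    moreover have "C y \<noteq> C x0" if "y \<in> V" for y using that Ceq by (auto simp: V_def)
    ultimately have "U \<inter> V \<inter> UNIV = {}" by blast
    moreover have "UNIV \<subseteq> U \<union> V" using N(2) by (auto simp: U_def V_def)
    ultimately have "U \<inter> UNIV = {} \<or> V \<inter> UNIV = {}" by (rule connectedD[OF connected UV])
    moreover have "x0 \<in> U" using N(2) by (auto simp: U_def)
    ultimately have "x \<notin> V" by blast
    then show ?thesis using N(2)[of x] by (auto simp: V_def)
  qed
  have scaled: "\<Lambda> h = C x0 * (\<integral>x. h x \<partial>P)" if h: "C1_fun h" for h
  proof -
    obtain J :: "'a set" and \<theta> where J: "finite J"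
      and CC: "\<And>x. x \<in> J \<Longrightarrow> \<exists>W F. open W \<and> range \<psi> \<subseteq> W \<and> C1_on W F \<and> \<theta> x = (\<lambda>y. F (\<psi> y))"
      and nn: "\<And>x y. 0 \<le> \<theta> x y" and s1: "\<And>y. (\<Sum>x\<in>J. \<theta> x y) = (1::real)"
      and K: "\<And>x. x \<in> J \<Longrightarrow> \<exists>K. closed K \<and> K \<subseteq> N x \<and> (\<forall>y. y \<notin> K \<longrightarrow> \<theta> x y = 0)"
      by (rule C1_partition_of_unity[OF N(1,2)]) (rule that; assumption)
    have fC: "C1_fun (\<lambda>y. \<theta> i y * h y)" if "i \<in> J" for i
      by (rule C1_fun_mult[OF partition_C1[OF CC[OF that]] h])
    have eq: "h = (\<lambda>y. \<Sum>i\<in>J. \<theta> i y * h y)" by (simp add: sum_distrib_right[symmetric] s1)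
    have "\<Lambda> h = (\<Sum>i\<in>J. \<Lambda> (\<lambda>y. \<theta> i y * h y))"
      by (subst eq, rule L.sum) (rule C1_fun_continuous[OF fC])
    also have "\<dots> = (\<Sum>i\<in>J. C x0 * (\<integral>y. \<theta> i y * h y \<partial>P))"
    proof (rule sum.cong[OF refl])
      fix i assume i: "i \<in> J"
      obtain K where "closed K" "K \<subseteq> N i" "\<And>y. y \<notin> K \<Longrightarrow> \<theta> i y = 0" using K[OF i] by blast
      then show "\<Lambda> (\<lambda>y. \<theta> i y * h y) = C x0 * (\<integral>y. \<theta> i y * h y \<partial>P)"
        using NC[OF fC[OF i], of K i] Cc[of i] by simp
    qed
    also have "\<dots> = C x0 * (\<integral>y. (\<Sum>i\<in>J. \<theta> i y * h y) \<partial>P)"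
      by (subst P.sum) (auto simp: sum_distrib_left intro: C1_fun_continuous[OF fC])
    finally show ?thesis by (simp add: eq[symmetric])
  qed
  have "C x0 = 1" using scaled[OF C1_fun_const[of 1]] L.one P.one by simp
  then show ?thesis using scaled[OF h] by simp
qed

text \<open>Polynomials in the ambient coordinates are dense by Stone-Weierstrass and are C1 on the
  manifold, and both functionals are contractions for the supremum norm.\<close>

theorem eq_on_continuous:
  assumes h: "continuous_on UNIV h" shows "\<Lambda> h = (\<integral>x. h x \<partial>P)"
proof -
  obtain k where k: "homeomorphism UNIV (range \<psi>) \<psi> k" using embedding unfolding smooth_embedding_def by blast
  then have kc: "continuous_on (range \<psi>) k" and k\<psi>: "\<And>x. k (\<psi> x) = x" by (auto simp: homeomorphism_def)
  have cr: "compact (range \<psi>)" by (rule compact_continuous_image[OF \<psi>_cont compact_manifold])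
  have hk: "continuous_on (range \<psi>) (\<lambda>z. h (k z))" by (rule continuous_on_compose2[OF h kc]) simp
  have "\<bar>\<Lambda> h - (\<integral>x. h x \<partial>P)\<bar> \<le> 0 + e" if e: "e > 0" for e
  proof -
    have "e / 2 > 0" using e by simp
    from Stone_Weierstrass_polynomial_function[OF cr hk this]
    obtain q where q: "polynomial_function q" "\<And>z. z \<in> range \<psi> \<Longrightarrow> norm (h (k z) - q z) < e / 2" by blast
    have qC: "C1_fun (\<lambda>x. q (\<psi> x))"
      by (rule C1_fun_compose[OF real_polynomial_function_C1[of q UNIV] \<psi>_C1]) (use q(1) in \<open>auto simp: real_polynomial_function_eq\<close>)
    have app: "\<bar>h x - q (\<psi> x)\<bar> \<le> e / 2" for x using q(2)[of "\<psi> x"] by (simp add: k\<psi> less_imp_le)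
    have "\<bar>\<Lambda> h - \<Lambda> (\<lambda>x. q (\<psi> x))\<bar> \<le> e / 2"
      by (rule L.abs_diff_le[OF h C1_fun_continuous[OF qC] app])
    moreover have "\<bar>(\<integral>x. h x \<partial>P) - (\<integral>x. q (\<psi> x) \<partial>P)\<bar> \<le> e / 2"
      by (rule P.abs_diff_le[OF h C1_fun_continuous[OF qC] app])
    ultimately show ?thesis using eq_on_C1[OF qC] by linarith
  qed
  then have "\<bar>\<Lambda> h - (\<integral>x. h x \<partial>P)\<bar> \<le> 0" by (rule field_le_epsilon)
  then show ?thesis by simp
qed

end

section \<open>Stein kernels and cluster functionals\<close>

text \<open>Coordinate lines realise every tangent direction, so that representers along curves
  reach all derivatives in a chart.\<close>

lemma (in embedded_manifold) chart_curve:
  assumes c: "c \<in> A" and u: "u \<in> img c"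
  shows "smooth_curve \<psi> (\<lambda>t. chart_inv c (u + t *\<^sub>R v)) (frechet_derivative (\<psi> \<circ> chart_inv c) (at u) v)"
proof -
  define \<alpha>' where "\<alpha>' t = frechet_derivative (\<psi> \<circ> chart_inv c) (at (u + t *\<^sub>R v)) v" for t
  obtain r where r: "r > 0" "ball u r \<subseteq> img c" using open_img[OF c] u open_contains_ball by blast
  \<comment> \<open>Without the summand 1 the division would return 0 for
    \<open>v = 0\<close>.\<close>
  define \<delta> where "\<delta> = r / (norm v + 1)"
  have nv: "norm v + 1 > 0" by (simp add: add_nonneg_pos)
  have \<delta>: "\<delta> > 0" using r nv by (simp add: \<delta>_def)
  have seg: "u + t *\<^sub>R v \<in> img c" if "\<bar>t\<bar> < \<delta>" for t
  proof -
    have "\<bar>t\<bar> * norm v \<le> \<bar>t\<bar> * (norm v + 1)" by (intro mult_left_mono) auto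
    also have "\<dots> < \<delta> * (norm v + 1)" using that nv by (intro mult_strict_right_mono)
    also have "\<dots> = r" using nv by (simp add: \<delta>_def)
    finally show ?thesis using r(2) by (auto simp: dist_norm)
  qed
  note C = C1_funD[OF \<psi>_C1 c]
  have d: "((\<lambda>t. \<psi> (chart_inv c (u + t *\<^sub>R v))) has_vector_derivative \<alpha>' t) (at t)" if "\<bar>t\<bar> < \<delta>" for t
    using C1_on_line_derivative[OF C seg[OF that]] by (simp add: \<alpha>'_def o_def)
  have "continuous_on {-\<delta><..<\<delta>} \<alpha>'" unfolding \<alpha>'_def[abs_def]
    by (rule C1_on_joint_continuous[OF C]) (auto intro!: continuous_intros seg)
  then show ?thesis unfolding smooth_curve_def
    by (intro exI[of _ \<delta>] exI[of _ \<alpha>']) (use \<delta> d in \<open>simp add: \<alpha>'_def\<close>)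
qed

lemma (in embedded_manifold) push_curve:
  assumes X: "smooth_vector_field A X"
  shows "\<exists>\<gamma>. \<gamma> 0 = y \<and> smooth_curve \<psi> \<gamma> (push \<psi> X y)"
proof -
  let ?c = "chart_at A y"
  have "snd ?c y \<in> img ?c" using chart_at(2) by simp
  from chart_curve[OF chart_at(1) this, of "X y ?c"] show ?thesis
    by (intro exI[of _ "\<lambda>t. chart_inv ?c (snd ?c y + t *\<^sub>R X y ?c)"]) (simp add: inv_coord[OF chart_at] push_def chart_deriv_def)
qed

text \<open>In its application the modulus \<open>B\<close> is a norm bound from Cauchy-Schwarz, a
  different function for each \<open>x0\<close>.\<close>

lemma continuous_on_bound:
  fixes f :: "'a::topological_space \<Rightarrow> real"
  assumes "\<And>x0. x0 \<in> S \<Longrightarrow> \<exists>B. continuous_on S B \<and> B x0 = 0 \<and> (\<forall>x\<in>S. \<bar>f x - f x0\<bar> \<le> B x)"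
  shows "continuous_on S f"
  unfolding continuous_on_def
proof
  fix x0 assume x0: "x0 \<in> S"
  obtain B where B: "continuous_on S B" "B x0 = 0" "\<And>x. x \<in> S \<Longrightarrow> \<bar>f x - f x0\<bar> \<le> B x" using assms[OF x0] by blast
  have "(B \<longlongrightarrow> 0) (at x0 within S)" using B(1,2) x0 unfolding continuous_on_def by metis
  moreover have "\<forall>\<^sub>F x in at x0 within S. norm (f x - f x0) \<le> B x"
    using B(3) by (simp add: eventually_at_topological) blast
  ultimately have "((\<lambda>x. f x - f x0) \<longlongrightarrow> 0) (at x0 within S)" by (intro Lim_null_comparison[of "\<lambda>x. f x - f x0" B])
  then show "(f \<longlongrightarrow> f x0) (at x0 within S)" by (simp add: Lim_null[symmetric])
qed

text \<open>Tychonoff: for each \<open>n\<close> the values form one point of a product of compact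
  intervals. With uncountably many indices \<open>i\<close> a cluster point need not be the limit of
  a subsequence, so a finer filter takes the place of one.\<close>

lemma cluster_filter:
  fixes a :: "'i \<Rightarrow> 'n \<Rightarrow> real"
  assumes F0: "F0 \<noteq> bot" and bd: "\<And>i. \<exists>B. \<forall>n. \<bar>a i n\<bar> \<le> B"
  obtains F l where "F \<le> F0" "F \<noteq> bot" "\<And>i. ((\<lambda>n. a i n) \<longlongrightarrow> l i) F"
proof -
  obtain B where B: "\<And>i n. \<bar>a i n\<bar> \<le> B i" using bd by metis
  define X where "X = PiE UNIV (\<lambda>i. cball (0::real) (B i))"
  have "compactin (product_topology (\<lambda>i. euclidean) UNIV) X" unfolding X_def by (simp add: compactin_PiE)
  then have X: "compact X" by (simp add: euclidean_product_topology)
  define a' where "a' n = (\<lambda>i. a i n)" for n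
  have "filtermap a' F0 \<noteq> bot" using F0 by (simp add: filtermap_bot_iff)
  moreover have "eventually (\<lambda>f. f \<in> X) (filtermap a' F0)"
    unfolding eventually_filtermap by (rule always_eventually) (use B in \<open>auto simp: X_def a'_def\<close>)
  ultimately obtain l where l: "inf (nhds l) (filtermap a' F0) \<noteq> bot" using X unfolding compact_filter by blast
  \<comment> \<open>The given filter is refined by the preimages of the neighbourhoods of
    \<open>l\<close>; the result is proper because \<open>l\<close> is a cluster point.\<close>
  define F where "F = inf F0 (filtercomap a' (nhds l))"
  have "F \<noteq> bot"
  proof
    assume "F = bot"
    then have "eventually (\<lambda>_. False) F" by simp
    then obtain P Q where PQ: "eventually P F0" "eventually Q (filtercomap a' (nhds l))" "\<And>n. P n \<Longrightarrow> Q n \<Longrightarrow> False"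
      unfolding F_def eventually_inf by blast
    obtain R where R: "eventually R (nhds l)" "\<And>n. R (a' n) \<Longrightarrow> Q n" using PQ(2) unfolding eventually_filtercomap by blast
    have "eventually (\<lambda>f. \<not> R f) (filtermap a' F0)" unfolding eventually_filtermap
      using PQ(1) by eventually_elim (use PQ(3) R(2) in blast)
    with R(1) have "eventually (\<lambda>_. False) (inf (nhds l) (filtermap a' F0))" unfolding eventually_inf by blast
    then show False using l by (simp add: trivial_limit_def)
  qed
  moreover have "((\<lambda>n. a i n) \<longlongrightarrow> l i) F" for i
  proof -
    have "filterlim a' (nhds l) F" unfolding F_def by (meson filterlim_filtercomap filterlim_mono inf_le2 order_refl)
    moreover have "((\<lambda>f. f i) \<longlongrightarrow> l i) (nhds l)"
      using continuous_on_product_coordinates[of i] unfolding continuous_on_def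
      by (metis UNIV_I at_within_open open_UNIV tendsto_at_iff_tendsto_nhds)
    ultimately show ?thesis using filterlim_compose unfolding a'_def by fastforce
  qed
  ultimately show ?thesis using that[of F l] by (simp add: F_def)
qed

section \<open>Weak convergence and the kernel Stein discrepancy\<close>

locale ksd_setting = stein_setting A g vol \<psi> P p + embedded_rkhs \<kappa> \<psi> H ip
  for A :: "('a::{t2_space, second_countable_topology}, 'n::finite) chart set" and g and vol
    and \<psi> :: "'a \<Rightarrow> real ^ 'd" and P p and \<kappa> :: "real ^ 'd \<Rightarrow> real ^ 'd \<Rightarrow> real" and H ip
begin

section \<open>Elements of the Hilbert space as C1 functions\<close>

lemma eta_chart_in: "c \<in> A \<Longrightarrow> u \<in> img c \<Longrightarrow> eta (chart_inv c u) (frechet_derivative (\<psi> \<circ> chart_inv c) (at u) v) \<in> H"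
  using curve_representer(1)[OF chart_curve[of c u v]] by simp

text \<open>Each directional derivative is an inner product with a representer. Representers are
  linear in the direction and, by \<open>ip_eta\<close>, move continuously in norm, which is what
  \<open>gateaux_C1_imp_has_derivative\<close> asks for.\<close>

lemma rkhs_chart_derivative:
  assumes f: "f \<in> H" and c: "c \<in> A"
  defines "d u v \<equiv> ip f (eta (chart_inv c u) (frechet_derivative (\<psi> \<circ> chart_inv c) (at u) v))"
  shows "u \<in> img c \<Longrightarrow> ((f \<circ> chart_inv c) has_derivative d u) (at u)" and "continuous_on (img c) (\<lambda>u. d u v)"
proof -
  let ?D = "\<lambda>u. frechet_derivative (\<psi> \<circ> chart_inv c) (at u)"
  let ?e = "\<lambda>u v. eta (chart_inv c u) (?D u v)"
  note C = C1_funD[OF \<psi>_C1 c]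
  have lin: "linear (d u)" if u: "u \<in> img c" for u
  proof (rule linearI)
    have DL: "linear (?D u)" by (rule has_derivative_linear[OF C1_on_has_derivative[OF C u]])
    show "d u (v + w) = d u v + d u w" for v w
    proof -
      have "?e u (v + w) = (\<lambda>y. ?e u v y + ?e u w y)"
        unfolding eta_def by (simp add: linear_add[OF DL] linear_add[OF d1_linear])
      then show ?thesis unfolding d_def by (simp add: ip_add2 eta_chart_in[OF c u] f)
    qed
    show "d u (r *\<^sub>R v) = r *\<^sub>R d u v" for r v
    proof -
      have "?e u (r *\<^sub>R v) = (\<lambda>y. r * ?e u v y)"
        unfolding eta_def by (simp add: linear_cmul[OF DL] linear_cmul[OF d1_linear])
      then show ?thesis unfolding d_def by (simp add: ip_scale2 eta_chart_in[OF c u] f)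
    qed
  qed
  have ipe: "ip (?e u v) (?e u' v') = d12 (?D u v) (?D u' v') (\<psi> (chart_inv c u)) (\<psi> (chart_inv c u'))"
    if "u \<in> img c" "u' \<in> img c" for u u' v v'
    using ip_eta[OF chart_curve[OF c that(1), of v] chart_curve[OF c that(2), of v']] by simp
  have cont: "continuous_on (img c) (\<lambda>u. d u v)" for v
  proof (rule continuous_on_bound)
    fix u0 assume u0: "u0 \<in> img c"
    \<comment> \<open>The norm of \<open>f\<close> times the distance between the representers at
      \<open>u\<close> and \<open>u0\<close>, expanded by \<open>ip_eta\<close>.\<close>
    define B where "B u = sqrt (ip f f) * sqrt (d12 (?D u v) (?D u v) (\<psi> (chart_inv c u)) (\<psi> (chart_inv c u))
        - 2 * d12 (?D u v) (?D u0 v) (\<psi> (chart_inv c u)) (\<psi> (chart_inv c u0))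
        + d12 (?D u0 v) (?D u0 v) (\<psi> (chart_inv c u0)) (\<psi> (chart_inv c u0)))" for u
    have cd: "continuous_on (img c) (\<lambda>u. ?D u v)" by (rule C1_on_continuous_derivative[OF C])
    have cp: "continuous_on (img c) (\<lambda>u. \<psi> (chart_inv c u))" using C1_on_imp_continuous_on[OF C] by (simp add: o_def)
    have "continuous_on (img c) B" unfolding B_def by (intro continuous_intros cd cp)
    moreover have "B u0 = 0" by (simp add: B_def)
    moreover have "\<bar>d u v - d u0 v\<bar> \<le> B u" if u: "u \<in> img c" for u
    proof -
      have "d u v - d u0 v = ip f (\<lambda>y. ?e u v y - ?e u0 v y)"
        unfolding d_def by (simp add: ip_diff2 eta_chart_in[OF c] u u0 f)
      then have "\<bar>d u v - d u0 v\<bar> \<le> sqrt (ip f f) * sqrt (ip (\<lambda>y. ?e u v y - ?e u0 v y) (\<lambda>y. ?e u v y - ?e u0 v y))"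
        using Cauchy_Schwarz[OF f diffH[OF eta_chart_in[OF c u] eta_chart_in[OF c u0]]] by simp
      also have "\<dots> = B u"
        by (simp add: ip_diff_self eta_chart_in[OF c] u u0 ipe B_def)
      finally show ?thesis .
    qed
    ultimately show "\<exists>B. continuous_on (img c) B \<and> B u0 = 0 \<and> (\<forall>u\<in>img c. \<bar>d u v - d u0 v\<bar> \<le> B u)" by blast
  qed
  have line: "((\<lambda>t. (f \<circ> chart_inv c) (u + t *\<^sub>R v)) has_real_derivative d u v) (at 0)" if "u \<in> img c" for u v
    using curve_representer(2)[OF chart_curve[OF c that, of v] f] by (simp add: d_def)
  show "u \<in> img c \<Longrightarrow> ((f \<circ> chart_inv c) has_derivative d u) (at u)"
    by (rule gateaux_C1_imp_has_derivative[OF open_img[OF c] _ line lin cont])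
  show "continuous_on (img c) (\<lambda>u. d u v)" by (rule cont)
qed

lemma rkhs_C1: "f \<in> H \<Longrightarrow> C1_fun f"
  unfolding C1_fun_def by (intro ballI C1_onI[OF rkhs_chart_derivative])

section \<open>Stein operators as inner products\<close>

text \<open>The element of \<open>H\<close> whose inner product with \<open>f\<close> is
  \<open>stein X f x\<close>.\<close>

definition xi :: "('a \<Rightarrow> ('a, 'n) tvec) \<Rightarrow> 'a \<Rightarrow> 'a \<Rightarrow> real" where
  "xi X x = (\<lambda>y. eta x (push \<psi> X x) y + stein_drift X x * \<kappa> (\<psi> y) (\<psi> x))"

text \<open>The Stein operator applied to both arguments of the kernel, that is, the Gram kernel of
  the representers \<open>xi X x\<close>.\<close>

definition stein_kernel :: "('a \<Rightarrow> ('a, 'n) tvec) \<Rightarrow> 'a \<Rightarrow> 'a \<Rightarrow> real" where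
  "stein_kernel X x y = d12 (push \<psi> X x) (push \<psi> X y) (\<psi> x) (\<psi> y)
     + stein_drift X y * d1 (push \<psi> X x) (\<psi> x) (\<psi> y) + stein_drift X x * d1 (push \<psi> X y) (\<psi> y) (\<psi> x)
     + stein_drift X x * stein_drift X y * \<kappa> (\<psi> x) (\<psi> y)"

lemma eta_push_in: "smooth_vector_field A X \<Longrightarrow> eta x (push \<psi> X x) \<in> H"
  using push_curve[of X x] curve_representer(1) by metis

lemma xi_in: "smooth_vector_field A X \<Longrightarrow> xi X x \<in> H"
  unfolding xi_def by (intro addH scaleH KH eta_push_in)

lemma stein_representer:
  assumes X: "smooth_vector_field A X" and f: "f \<in> H"
  shows "stein X f x = ip f (xi X x)"
proof -
  let ?c = "chart_at A x"
  have u: "snd ?c x \<in> img ?c" using chart_at(2) by simp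
  have "vf_deriv A X f x = chart_deriv ?c f x (X x ?c)"
    by (rule vf_deriv_C1[of X x f, OF vector_field_tangent[OF X] rkhs_C1[OF f] chart_at])
  also have "\<dots> = ip f (eta x (push \<psi> X x))"
    unfolding chart_deriv_def push_def
    using fun_cong[OF frechet_derivative_at[OF rkhs_chart_derivative(1)[OF f chart_at(1) u]], of "X x ?c"]
    by (simp add: inv_coord[OF chart_at])
  finally have "stein X f x = ip f (eta x (push \<psi> X x)) + stein_drift X x * ip f (\<lambda>y. \<kappa> (\<psi> y) (\<psi> x))"
    by (simp add: stein_def reproducing[OF f] mult.commute)
  then show ?thesis unfolding xi_def by (simp add: ip_add2 ip_scale2 eta_push_in[OF X] scaleH KH f)
qed

lemma ip_xi:
  assumes X: "smooth_vector_field A X" shows "ip (xi X x) (xi X y) = stein_kernel X x y"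
proof -
  obtain \<gamma> where \<gamma>: "\<gamma> 0 = x" "smooth_curve \<psi> \<gamma> (push \<psi> X x)" using push_curve[OF X] by blast
  obtain \<gamma>' where \<gamma>': "\<gamma>' 0 = y" "smooth_curve \<psi> \<gamma>' (push \<psi> X y)" using push_curve[OF X] by blast
  have ee: "ip (eta x (push \<psi> X x)) (eta y (push \<psi> X y)) = d12 (push \<psi> X x) (push \<psi> X y) (\<psi> x) (\<psi> y)"
    using ip_eta[OF \<gamma>(2) \<gamma>'(2)] \<gamma>(1) \<gamma>'(1) by simp
  have ek: "ip (eta z (push \<psi> X z)) (\<lambda>y. \<kappa> (\<psi> y) (\<psi> w)) = d1 (push \<psi> X z) (\<psi> z) (\<psi> w)" for z w
    using reproducing[OF eta_push_in[OF X]] by (simp add: eta_def)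
  have ke: "ip (\<lambda>y. \<kappa> (\<psi> y) (\<psi> w)) (eta z (push \<psi> X z)) = d1 (push \<psi> X z) (\<psi> z) (\<psi> w)" for z w
    using ek[of z w] ip_sym[OF KH eta_push_in[OF X]] by simp
  have kk: "ip (\<lambda>z. \<kappa> (\<psi> z) (\<psi> x)) (\<lambda>z. \<kappa> (\<psi> z) (\<psi> y)) = \<kappa> (\<psi> x) (\<psi> y)"
    using reproducing[OF KH, of x y] kernel_sym by simp
  show ?thesis unfolding xi_def stein_kernel_def
    by (simp add: ip_add ip_add2 ip_scale ip_scale2 addH scaleH KH eta_push_in[OF X] ee ek ke kk)
qed

lemma continuous_stein_kernel:
  assumes X: "smooth_vector_field A X" and f: "continuous_on S f" "continuous_on S h"
  shows "continuous_on S (\<lambda>z. stein_kernel X (f z) (h z))"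
proof -
  have c: "continuous_on S (\<lambda>z. k (q z))" if "continuous_on UNIV k" "continuous_on S q" for k :: "'a \<Rightarrow> 'w::topological_space" and q
    by (rule continuous_on_compose2[OF that]) simp
  note P = c[OF continuous_push[OF X \<psi>_C1]] and B = c[OF continuous_stein_drift[OF X]] and E = c[OF \<psi>_cont]
  show ?thesis unfolding stein_kernel_def by (intro continuous_intros P B E f)
qed

text \<open>Cauchy-Schwarz bounds the variation of all \<open>f\<close> in the unit ball by the
  distance of two representers, and continuity of \<open>stein_kernel\<close> makes this distance
  small.\<close>

lemma stein_equicontinuous:
  assumes X: "smooth_vector_field A X" and e: "e > 0"
  shows "\<exists>N. open N \<and> x \<in> N \<and> (\<forall>y\<in>N. \<forall>f\<in>{f \<in> H. ip f f \<le> 1}. \<bar>stein X f y - stein X f x\<bar> \<le> e)"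
proof -
  define B where "B y = sqrt (stein_kernel X y y - 2 * stein_kernel X y x + stein_kernel X x x)" for y
  have "continuous_on UNIV B" unfolding B_def by (intro continuous_intros continuous_stein_kernel[OF X])
  then have "open {y. B y < e}" by (intro open_Collect_less continuous_intros)
  moreover have "x \<in> {y. B y < e}" using e by (simp add: B_def)
  moreover have "\<bar>stein X f y - stein X f x\<bar> \<le> e" if y: "y \<in> {y. B y < e}" and f: "f \<in> {f \<in> H. ip f f \<le> 1}" for y f
  proof -
    have fH: "f \<in> H" "ip f f \<le> 1" using f by auto
    have "stein X f y - stein X f x = ip f (\<lambda>z. xi X y z - xi X x z)"
      by (simp add: stein_representer[OF X fH(1)] ip_diff2 xi_in[OF X] fH(1))
    then have "\<bar>stein X f y - stein X f x\<bar> \<le> sqrt (ip f f) * sqrt (ip (\<lambda>z. xi X y z - xi X x z) (\<lambda>z. xi X y z - xi X x z))"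
      using Cauchy_Schwarz[OF fH(1) diffH[OF xi_in[OF X] xi_in[OF X]]] by simp
    also have "\<dots> = sqrt (ip f f) * B y" by (simp add: ip_diff_self xi_in[OF X] ip_xi[OF X] B_def)
    also have "\<dots> \<le> 1 * B y"
    proof (rule mult_right_mono)
      have "0 \<le> ip (\<lambda>z. xi X y z - xi X x z) (\<lambda>z. xi X y z - xi X x z)" by (intro ip_nonneg diffH xi_in X)
      then show "0 \<le> B y" by (simp add: ip_diff_self xi_in[OF X] ip_xi[OF X] B_def)
    qed (use fH in simp)
    finally show ?thesis using y by simp
  qed
  ultimately show ?thesis by blast
qed

lemma stein_bounded:
  assumes X: "smooth_vector_field A X" and f: "f \<in> H" "ip f f \<le> 1"
  shows "\<bar>stein X f x\<bar> \<le> sqrt (stein_kernel X x x)"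
proof -
  have "\<bar>stein X f x\<bar> \<le> sqrt (ip f f) * sqrt (stein_kernel X x x)"
    using Cauchy_Schwarz[OF f(1) xi_in[OF X]] by (simp add: stein_representer[OF X f(1)] ip_xi[OF X])
  also have "\<dots> \<le> 1 * sqrt (stein_kernel X x x)"
    using f(2) ip_nonneg[OF xi_in[OF X], of x] by (intro mult_right_mono) (auto simp: ip_xi[OF X])
  finally show ?thesis by simp
qed

section \<open>Weak convergence forces the discrepancy to zero\<close>

text \<open>By equicontinuity finitely many functions \<open>\<theta> x\<close> carry the whole unit
  ball up to a small error, so convergence of finitely many integrals gives a bound uniform in
  \<open>f\<close>.\<close>

lemma weak_convergence_uniform:
  assumes X: "smooth_vector_field A X" and Q: "\<And>n. prob_space (Q n)" "\<And>n. sets (Q n) = sets borel"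
    and conv: "converges_weakly Q P" and e: "e > 0"
  shows "\<forall>\<^sub>F n in sequentially. \<forall>f\<in>{f \<in> H. ip f f \<le> 1}. \<bar>\<integral>x. stein X f x \<partial>Q n\<bar> \<le> e"
proof -
  \<comment> \<open>One third each for the approximation under \<open>Q n\<close>, the approximation
    under \<open>P\<close>, and the difference of the finite sums.\<close>
  define e' where "e' = e / 3"
  have e': "e' > 0" using e by (simp add: e'_def)
  let ?B = "{f \<in> H. ip f f \<le> 1}"
  obtain J :: "'a set" and \<theta> where J: "finite J" and c: "\<And>x. x \<in> J \<Longrightarrow> continuous_on UNIV (\<theta> x)"
    and nn: "\<And>x y. 0 \<le> \<theta> x y" and s1: "\<And>y. (\<Sum>x\<in>J. \<theta> x y) = 1"
    and app: "\<And>y f. f \<in> ?B \<Longrightarrow> \<bar>stein X f y - (\<Sum>x\<in>J. \<theta> x y * stein X f x)\<bar> \<le> e'"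
    by (rule equicontinuous_approx[of ?B "\<lambda>y f. stein X f y" e'])
      (rule stein_equicontinuous[OF X e'] | rule that; assumption)+
  define b where "b x = sqrt (stein_kernel X x x)" for x
  have lim: "(\<lambda>n. \<Sum>x\<in>J. b x * \<bar>(\<integral>y. \<theta> x y \<partial>Q n) - (\<integral>y. \<theta> x y \<partial>P)\<bar>) \<longlonglongrightarrow> (\<Sum>x\<in>J. b x * \<bar>(\<integral>y. \<theta> x y \<partial>P) - (\<integral>y. \<theta> x y \<partial>P)\<bar>)"
  proof (intro tendsto_intros)
    fix x assume x: "x \<in> J"
    have "bounded (range (\<theta> x))" by (intro compact_imp_bounded compact_continuous_image c x compact_manifold)
    then show "(\<lambda>n. \<integral>y. \<theta> x y \<partial>Q n) \<longlonglongrightarrow> (\<integral>y. \<theta> x y \<partial>P)" using conv c[OF x] unfolding converges_weakly_def by blast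
  qed
  then have "(\<lambda>n. \<Sum>x\<in>J. b x * \<bar>(\<integral>y. \<theta> x y \<partial>Q n) - (\<integral>y. \<theta> x y \<partial>P)\<bar>) \<longlonglongrightarrow> 0" by simp
  from order_tendstoD(2)[OF this e'] show ?thesis
  proof eventually_elim
    case (elim n)
    interpret Qn: mean_functional \<psi> "\<lambda>f. \<integral>x. f x \<partial>Q n" by (rule mean_functional_prob[OF Q])
    show ?case
    proof
      fix f assume f: "f \<in> ?B"
      then have fH: "f \<in> H" "ip f f \<le> 1" by auto
      have sc: "continuous_on UNIV (stein X f)" by (rule continuous_stein[OF X rkhs_C1[OF fH(1)]])
      define S where "S y = (\<Sum>x\<in>J. \<theta> x y * stein X f x)" for y
      have Sc: "continuous_on UNIV S" unfolding S_def[abs_def] by (intro continuous_intros c)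
      have 1: "\<bar>(\<integral>y. stein X f y \<partial>Q n) - (\<integral>y. S y \<partial>Q n)\<bar> \<le> e'"
        by (rule Qn.abs_diff_le[OF sc Sc]) (use app[OF f] in \<open>simp add: S_def\<close>)
      have 2: "\<bar>(\<integral>y. stein X f y \<partial>P) - (\<integral>y. S y \<partial>P)\<bar> \<le> e'"
        by (rule P.abs_diff_le[OF sc Sc]) (use app[OF f] in \<open>simp add: S_def\<close>)
      have 3: "(\<integral>y. stein X f y \<partial>P) = 0" by (rule stein_identity[OF X rkhs_C1[OF fH(1)]])
      have SQ: "(\<integral>y. S y \<partial>Q n) = (\<Sum>x\<in>J. (\<integral>y. \<theta> x y \<partial>Q n) * stein X f x)"
        unfolding S_def by (subst Qn.sum) (auto intro!: continuous_intros c)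
      have SP: "(\<integral>y. S y \<partial>P) = (\<Sum>x\<in>J. (\<integral>y. \<theta> x y \<partial>P) * stein X f x)"
        unfolding S_def by (subst P.sum) (auto intro!: continuous_intros c)
      have "\<bar>(\<integral>y. S y \<partial>Q n) - (\<integral>y. S y \<partial>P)\<bar> = \<bar>\<Sum>x\<in>J. stein X f x * ((\<integral>y. \<theta> x y \<partial>Q n) - (\<integral>y. \<theta> x y \<partial>P))\<bar>"
        unfolding SQ SP by (simp add: sum_subtractf[symmetric] algebra_simps)
      also have "\<dots> \<le> (\<Sum>x\<in>J. b x * \<bar>(\<integral>y. \<theta> x y \<partial>Q n) - (\<integral>y. \<theta> x y \<partial>P)\<bar>)"
        unfolding b_def by (rule order_trans[OF sum_abs sum_mono]) (simp add: abs_mult mult_right_mono stein_bounded[OF X fH])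
      finally have "\<bar>(\<integral>y. S y \<partial>Q n) - (\<integral>y. S y \<partial>P)\<bar> < e'" using elim by linarith
      then show "\<bar>\<integral>x. stein X f x \<partial>Q n\<bar> \<le> e" using 1 2 3 unfolding e'_def by linarith
    qed
  qed
qed

lemma stein_operator_eq: "stein_operator A g m D p f x = (\<Sum>l=1..m. stein (D l) (f l) x)"
  by (simp add: stein_operator_def stein_def stein_drift_def algebra_simps)

lemma integral_stein_operator:
  assumes "\<And>l. l \<in> {1..m} \<Longrightarrow> smooth_vector_field A (D l)" "\<And>l. l \<in> {1..m} \<Longrightarrow> f l \<in> H"
    and "prob_space R" "sets R = sets borel"
  shows "(\<integral>x. stein_operator A g m D p f x \<partial>R) = (\<Sum>l=1..m. \<integral>x. stein (D l) (f l) x \<partial>R)"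
proof -
  interpret R: mean_functional \<psi> "\<lambda>f. \<integral>x. f x \<partial>R" by (rule mean_functional_prob[OF assms(3,4)])
  show ?thesis unfolding stein_operator_eq by (rule R.sum) (intro continuous_stein assms rkhs_C1)
qed

lemma KSD_tendsto_zero:
  assumes D: "\<And>l. l \<in> {1..m} \<Longrightarrow> smooth_vector_field A (D l)"
    and Q: "\<And>n. prob_space (Q n)" "\<And>n. sets (Q n) = sets borel" and conv: "converges_weakly Q P"
  shows "(\<lambda>n. KSD A g m D H ip p (Q n)) \<longlonglongrightarrow> 0"
proof (rule order_tendstoI)
  fix a :: ereal assume a: "a < 0"
  have "0 \<le> KSD A g m D H ip p (Q n)" for n
    unfolding KSD_def
  \<comment> \<open>The zero tuple is admissible, which bounds the supremum below by 0.\<close>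
  proof (rule SUP_upper2[of "\<lambda>_ _. 0"])
    show "(\<lambda>_ _. 0) \<in> {f. (\<forall>l\<in>{1..m}. f l \<in> H) \<and> sqrt (\<Sum>l = 1..m. ip (f l) (f l)) \<le> 1}"
      using zeroH ip_zero[OF zeroH] by simp
    have "stein (D l) (\<lambda>_. 0) x = 0" for l x
      by (simp add: stein_def vf_deriv_def Let_def o_def)
    then show "0 \<le> ereal (\<integral>x. stein_operator A g m D p (\<lambda>_ _. 0) x \<partial>Q n)" by (simp add: stein_operator_eq)
  qed
  then show "\<forall>\<^sub>F n in sequentially. a < KSD A g m D H ip p (Q n)" using less_le_trans[OF a] by (intro always_eventually allI) blast
next
  fix a :: ereal assume a: "0 < a"
  obtain e where e: "0 < e" "ereal e < a" using ereal_dense2[OF a] by auto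
  \<comment> \<open>Each of the \<open>m\<close> components gets \<open>e'\<close>; the summand 1
    covers \<open>m = 0\<close>.\<close>
  define e' where "e' = e / (real m + 1)"
  have e': "e' > 0" using e by (simp add: e'_def)
  have "\<forall>\<^sub>F n in sequentially. \<forall>l\<in>{1..m}. \<forall>f\<in>{f \<in> H. ip f f \<le> 1}. \<bar>\<integral>x. stein (D l) f x \<partial>Q n\<bar> \<le> e'"
    by (rule eventually_ball_finite) (use weak_convergence_uniform[OF D Q conv e'] in auto)
  then show "\<forall>\<^sub>F n in sequentially. KSD A g m D H ip p (Q n) < a"
  proof eventually_elim
    case (elim n)
    have "KSD A g m D H ip p (Q n) \<le> ereal e" unfolding KSD_def
    proof (rule SUP_least)
      fix f assume "f \<in> {f. (\<forall>l\<in>{1..m}. f l \<in> H) \<and> sqrt (\<Sum>l = 1..m. ip (f l) (f l)) \<le> 1}"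
      then have f: "\<And>l. l \<in> {1..m} \<Longrightarrow> f l \<in> H" and n: "(\<Sum>l = 1..m. ip (f l) (f l)) \<le> 1" by auto
      have fl: "ip (f l) (f l) \<le> 1" if l: "l \<in> {1..m}" for l
      proof -
        have "ip (f l) (f l) \<le> (\<Sum>l = 1..m. ip (f l) (f l))"
          by (rule member_le_sum[OF l]) (use f in \<open>auto intro!: ip_nonneg\<close>)
        then show ?thesis using n by simp
      qed
      have "(\<integral>x. stein_operator A g m D p f x \<partial>Q n) = (\<Sum>l=1..m. \<integral>x. stein (D l) (f l) x \<partial>Q n)"
        by (rule integral_stein_operator[OF D f Q])
      also have "\<dots> \<le> (\<Sum>l=1..m. e')"
        using elim f fl by (intro sum_mono) (auto simp: abs_le_iff)
      also have "\<dots> = real m * e'" by simp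
      also have "\<dots> \<le> (real m + 1) * e'" using e' by (intro mult_right_mono) auto
      also have "\<dots> = e" by (simp add: e'_def)
      finally show "ereal (\<integral>x. stein_operator A g m D p f x \<partial>Q n) \<le> ereal e" by simp
    qed
    then show ?case using e(2) by (rule le_less_trans)
  qed
qed

section \<open>Vanishing discrepancy forces weak convergence\<close>

text \<open>The tuple with \<open>k\<close> as its only nonzero component, normalised by
  \<open>1 + sqrt (ip k k)\<close>, which is positive even for \<open>k = 0\<close>; a sign factor
  produces the absolute value.\<close>

lemma KSD_lower_bound:
  assumes D: "\<And>l. l \<in> {1..m} \<Longrightarrow> smooth_vector_field A (D l)" and l: "l \<in> {1..m}"
    and R: "prob_space R" "sets R = sets borel" and k: "k \<in> H"
  shows "ereal (\<bar>\<integral>x. stein (D l) k x \<partial>R\<bar> / (1 + sqrt (ip k k))) \<le> KSD A g m D H ip p R"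
proof -
  define N where "N = 1 + sqrt (ip k k)"
  have N: "N > 0" "sqrt (ip k k) \<le> N" using ip_nonneg[OF k] by (auto simp: N_def add_pos_nonneg)
  define I where "I = (\<integral>x. stein (D l) k x \<partial>R)"
  define r where "r = sgn I / N"
  define f where "f j = (if j = l then (\<lambda>x. r * k x) else (\<lambda>x. 0))" for j
  have fH: "f j \<in> H" for j unfolding f_def using scaleH[OF k] zeroH by simp
  have "(\<Sum>j=1..m. ip (f j) (f j)) = (\<Sum>j=1..m. if j = l then r * (r * ip k k) else 0)"
    by (rule sum.cong) (auto simp: f_def ip_scale ip_scale2 k scaleH ip_zero zeroH)
  also have "\<dots> = r\<^sup>2 * ip k k" using l by (simp add: power2_eq_square)
  finally have "sqrt (\<Sum>j=1..m. ip (f j) (f j)) = \<bar>r\<bar> * sqrt (ip k k)" by (simp add: real_sqrt_mult)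
  also have "\<dots> \<le> (1 / N) * N"
    using N ip_nonneg[OF k] by (intro mult_mono) (auto simp: r_def sgn_if divide_right_mono)
  finally have fn: "sqrt (\<Sum>j=1..m. ip (f j) (f j)) \<le> 1" using N by simp
  have "(\<integral>x. stein_operator A g m D p f x \<partial>R) = (\<Sum>j=1..m. \<integral>x. stein (D j) (f j) x \<partial>R)"
    by (rule integral_stein_operator[OF D fH R])
  also have "\<dots> = (\<Sum>j=1..m. if j = l then r * I else 0)"
  proof (rule sum.cong[OF refl])
    fix j assume j: "j \<in> {1..m}"
    have "stein (D l) (\<lambda>x. r * k x) x = r * stein (D l) k x" for x
      by (simp add: stein_representer[OF D[OF l]] k scaleH ip_scale xi_in[OF D[OF l]])
    moreover have "stein (D j) (\<lambda>x. 0) x = 0" for x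
      by (simp add: stein_representer[OF D[OF j]] zeroH ip_zero xi_in[OF D[OF j]])
    ultimately show "(\<integral>x. stein (D j) (f j) x \<partial>R) = (if j = l then r * I else 0)" by (simp add: f_def I_def)
  qed
  also have "\<dots> = r * I" using l by simp
  also have "\<dots> = \<bar>I\<bar> / N" by (simp add: r_def sgn_if)
  finally have eq: "(\<integral>x. stein_operator A g m D p f x \<partial>R) = \<bar>I\<bar> / N" .
  have "ereal (\<integral>x. stein_operator A g m D p f x \<partial>R) \<le> KSD A g m D H ip p R"
    unfolding KSD_def by (rule SUP_upper) (use fH fn in simp)
  then show ?thesis unfolding eq by (simp add: I_def N_def)
qed

text \<open>The hypothesis reaches kernel sections at points of the manifold only;
  \<open>annihilated_everywhere\<close> and \<open>test_function_annihilated\<close> extend it to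
  the ambient test functions that \<open>stein_functional\<close> requires.\<close>

lemma stein_functional_unique:
  assumes D: "\<And>l. l \<in> {1..m} \<Longrightarrow> smooth_vector_field A (D l)"
    and spans: "\<And>x. spans_tangent_space A x {1..m} (\<lambda>l. D l x)"
    and conn: "connected (UNIV :: 'a set)"
    and char: "characteristic_kernel \<kappa>" and tr: "translation_invariant \<kappa>"
    and \<Lambda>: "mean_functional \<psi> \<Lambda>"
    and ann: "\<And>l y. l \<in> {1..m} \<Longrightarrow> \<Lambda> (stein (D l) (\<lambda>x. \<kappa> (\<psi> x) (\<psi> y))) = 0"
    and h: "continuous_on UNIV h"
  shows "\<Lambda> h = (\<integral>x. h x \<partial>P)"
proof -
  interpret M: mean_functional \<psi> \<Lambda> by (rule \<Lambda>)
  have "\<Lambda> (stein (D l) (\<lambda>y. F (\<psi> y))) = 0"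
    if l: "l \<in> {1..m}" and F: "C1_on UNIV F" "compact K" "\<And>z. z \<notin> K \<Longrightarrow> F z = 0" for l F K
  proof -
    let ?X = "D l"
    note X = D[OF l]
    interpret KF: kernel_functional \<psi> \<Lambda> \<kappa> "push \<psi> ?X" "stein_drift ?X"
      by unfold_locales (rule continuous_push[OF X \<psi>_C1] continuous_stein_drift[OF X])+
    have "stein ?X (\<lambda>x. \<kappa> (\<psi> x) z) = (\<lambda>x. d1 (push \<psi> ?X x) (\<psi> x) z + stein_drift ?X x * \<kappa> (\<psi> x) z)" for z
      by (rule ext) (subst stein_compose[OF X has_derivative_fst], simp)
    then have a: "\<Lambda> (\<lambda>x. d1 (push \<psi> ?X x) (\<psi> x) (\<psi> y) + stein_drift ?X x * \<kappa> (\<psi> x) (\<psi> y)) = 0" for y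
      using ann[OF l, of y] by simp
    have "\<Lambda> (\<lambda>x. frechet_derivative F (at (\<psi> x)) (push \<psi> ?X x) + stein_drift ?X x * F (\<psi> x)) = 0"
      by (rule KF.test_function_annihilated[OF tr char KF.annihilated_everywhere[OF a push_curve[OF X]] F])
    moreover have "stein ?X (\<lambda>y. F (\<psi> y)) = (\<lambda>x. frechet_derivative F (at (\<psi> x)) (push \<psi> ?X x) + stein_drift ?X x * F (\<psi> x))"
      by (rule ext) (subst stein_compose[OF X C1_on_has_derivative[OF F(1) UNIV_I]], simp)
    ultimately show ?thesis by simp
  qed
  then interpret SF: stein_functional A g vol \<psi> P p \<Lambda> "{1..m}" D
    by unfold_locales (use D spans conn in auto)
  show ?thesis by (rule SF.eq_on_continuous[OF h])
qed

lemma converges_weakly_if_KSD_tendsto_zero: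
  assumes D: "\<And>l. l \<in> {1..m} \<Longrightarrow> smooth_vector_field A (D l)"
    and spans: "\<And>x. spans_tangent_space A x {1..m} (\<lambda>l. D l x)"
    and conn: "connected (UNIV :: 'a set)"
    and char: "characteristic_kernel \<kappa>" and tr: "translation_invariant \<kappa>"
    and Q: "\<And>n. prob_space (Q n)" "\<And>n. sets (Q n) = sets borel"
    and lim: "(\<lambda>n. KSD A g m D H ip p (Q n)) \<longlonglongrightarrow> 0"
  shows "converges_weakly Q P"
  unfolding converges_weakly_def
proof (intro allI impI)
  fix h :: "'a \<Rightarrow> real" assume h: "continuous_on UNIV h \<and> bounded (range h)"
  have M: "mean_functional \<psi> (\<lambda>f. \<integral>x. f x \<partial>Q n)" for n by (rule mean_functional_prob[OF Q])
  have null: "(\<lambda>n. \<integral>x. stein (D l) k x \<partial>Q n) \<longlonglongrightarrow> 0" if l: "l \<in> {1..m}" and k: "k \<in> H" for l k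
  proof (rule LIMSEQ_I)
    fix e :: real assume e: "0 < e"
    define N where "N = 1 + sqrt (ip k k)"
    have N: "N > 0" using ip_nonneg[OF k] by (simp add: N_def add_pos_nonneg)
    have "0 < ereal (e / N)" using e N by simp
    from order_tendstoD(2)[OF lim this] obtain n0 where n0: "\<And>n. n \<ge> n0 \<Longrightarrow> KSD A g m D H ip p (Q n) < ereal (e / N)"
      unfolding eventually_sequentially by blast
    have "norm ((\<integral>x. stein (D l) k x \<partial>Q n) - 0) < e" if "n \<ge> n0" for n
    proof -
      have "ereal (\<bar>\<integral>x. stein (D l) k x \<partial>Q n\<bar> / N) < ereal (e / N)"
        using KSD_lower_bound[OF D l Q k] n0[OF that] unfolding N_def by (rule le_less_trans)
      then show ?thesis using N by (simp add: divide_less_cancel)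
    qed
    then show "\<exists>n0. \<forall>n\<ge>n0. norm ((\<integral>x. stein (D l) k x \<partial>Q n) - 0) < e" by blast
  qed
  show "(\<lambda>n. \<integral>x. h x \<partial>Q n) \<longlonglongrightarrow> (\<integral>x. h x \<partial>P)"
  proof (rule ccontr)
    assume "\<not> (\<lambda>n. \<integral>x. h x \<partial>Q n) \<longlonglongrightarrow> (\<integral>x. h x \<partial>P)"
    then obtain e where e: "e > 0" "\<not> (\<forall>\<^sub>F n in sequentially. dist (\<integral>x. h x \<partial>Q n) (\<integral>x. h x \<partial>P) < e)"
      unfolding tendsto_iff by blast
    \<comment> \<open>The indices at which the integral of \<open>h\<close> stays \<open>e\<close>
      away from its target. Restricted to them the filter is proper, because convergence fails, and
      every finer filter inherits the gap.\<close>
    define B where "B = {n. \<not> dist (\<integral>x. h x \<partial>Q n) (\<integral>x. h x \<partial>P) < e}"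
    define F0 where "F0 = inf sequentially (principal B)"
    have F0: "F0 \<noteq> bot"
      using e(2) unfolding F0_def trivial_limit_def eventually_inf_principal by (simp add: B_def)
    \<comment> \<open>The value 0 at discontinuous \<open>f\<close> keeps the family bounded at
      every index, as \<open>cluster_filter\<close> demands.\<close>
    define a where "a f n = (if continuous_on UNIV f then \<integral>x. f x \<partial>Q n else 0)" for f :: "'a \<Rightarrow> real" and n
    have "\<exists>C. \<forall>n. \<bar>a f n\<bar> \<le> C" for f
    proof (cases "continuous_on UNIV f")
      case True
      have "bounded (range f)" by (rule compact_imp_bounded[OF compact_continuous_image[OF True compact_manifold]])
      then obtain C where "\<And>x. \<bar>f x\<bar> \<le> C" unfolding bounded_iff by auto
      then have "\<bar>a f n\<bar> \<le> C" for n unfolding a_def using mean_functional.abs_le[OF M True] True by simp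
      then show ?thesis by blast
    qed (auto simp: a_def)
    note bd = this
    obtain F L where F: "F \<le> F0" "F \<noteq> bot" and L: "\<And>f. ((\<lambda>n. a f n) \<longlongrightarrow> L f) F"
      by (rule cluster_filter[of F0 a, OF F0 bd]) (rule that; assumption)
    have Ll: "((\<lambda>n. \<integral>x. f x \<partial>Q n) \<longlongrightarrow> L f) F" if "continuous_on UNIV f" for f
      using L[of f] that by (simp add: a_def)
    have uniq: "L f = r" if "continuous_on UNIV f" "((\<lambda>n. \<integral>x. f x \<partial>Q n) \<longlongrightarrow> r) F" for f r
      using tendsto_unique[OF F(2) Ll[OF that(1)] that(2)] .
    have "mean_functional \<psi> L"
    proof
      fix f k :: "'a \<Rightarrow> real" and c :: real assume f: "continuous_on UNIV f"
      show "L (\<lambda>x. c * f x) = c * L f"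
        by (rule uniq) (use tendsto_mult_left[OF Ll[OF f], of c] f in \<open>auto intro!: continuous_intros simp: mean_functional.scale[OF M f]\<close>)
      show "0 \<le> L f" if "\<And>x. 0 \<le> f x"
        by (rule tendsto_lowerbound[OF Ll[OF f] _ F(2)]) (simp add: that)
      assume k: "continuous_on UNIV k"
      show "L (\<lambda>x. f x + k x) = L f + L k"
        by (rule uniq) (use tendsto_add[OF Ll[OF f] Ll[OF k]] f k in \<open>auto intro!: continuous_intros simp: mean_functional.add[OF M f k]\<close>)
    next
      show "L (\<lambda>x. 1) = 1" by (rule uniq) (simp_all only: mean_functional.one[OF M] tendsto_const continuous_on_const)
    qed
    moreover have "L (stein (D l) (\<lambda>x. \<kappa> (\<psi> x) (\<psi> y))) = 0" if l: "l \<in> {1..m}" for l y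
    proof (rule uniq)
      show "continuous_on UNIV (stein (D l) (\<lambda>x. \<kappa> (\<psi> x) (\<psi> y)))"
        by (intro continuous_stein D l rkhs_C1 KH)
      have "F \<le> sequentially" using F(1) unfolding F0_def by (meson inf_le1 order_trans)
      then show "((\<lambda>n. \<integral>x. stein (D l) (\<lambda>x. \<kappa> (\<psi> x) (\<psi> y)) x \<partial>Q n) \<longlongrightarrow> 0) F"
        using null[OF l KH, of y] by (rule tendsto_mono)
    qed
    ultimately have Lh: "L h = (\<integral>x. h x \<partial>P)"
      using h by (intro stein_functional_unique[OF D spans conn char tr]) auto
    have "F \<le> principal B" using F(1) unfolding F0_def by (meson inf_le2 order_trans)
    then have "\<forall>\<^sub>F n in F. n \<in> B" by (simp add: le_principal)
    moreover have "\<forall>\<^sub>F n in F. dist (\<integral>x. h x \<partial>Q n) (\<integral>x. h x \<partial>P) < e"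
      using Ll[of h] h e(1) unfolding Lh tendsto_iff by blast
    ultimately have "\<forall>\<^sub>F n in F. False" by eventually_elim (simp add: B_def)
    then show False using F(2) by (simp add: trivial_limit_def)
  qed
qed

end

theorem theorem3p4:
  fixes A :: "('a::{t2_space, second_countable_topology}, 'n::finite) chart set"
    and g :: "'a \<Rightarrow> ('a, 'n) tvec \<Rightarrow> ('a, 'n) tvec \<Rightarrow> real"
    and vol P :: "'a measure"
    and m s :: nat
    and D :: "nat \<Rightarrow> 'a \<Rightarrow> ('a, 'n) tvec"
    and p :: "'a \<Rightarrow> real"
    and \<psi> :: "'a \<Rightarrow> real ^ 'd::finite"
    and \<kappa> :: "real ^ 'd \<Rightarrow> real ^ 'd \<Rightarrow> real"
    and H :: "('a \<Rightarrow> real) set"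
    and ip :: "('a \<Rightarrow> real) \<Rightarrow> ('a \<Rightarrow> real) \<Rightarrow> real"
    and Q :: "nat \<Rightarrow> 'a measure"
  assumes "compact (UNIV :: 'a set)" and "connected (UNIV :: 'a set)"
    and "smooth_atlas A" and "riemannian_metric A g" and "is_riemannian_volume A g vol"
    and "\<And>l. l \<in> {1..m} \<Longrightarrow> smooth_vector_field A (D l)"
    and "\<And>x. spans_tangent_space A x {1..m} (\<lambda>l. D l x)"
    and "prob_space P" and "P = density vol (\<lambda>x. ennreal (p x))" and "\<And>x. 0 < p x"
    and "real s > real CARD('n) / 2" and "Ck_manifold A (s + 1) p"
    and "smooth_embedding A \<psi>" and "CARD('d) > CARD('n)"
    and "psd_kernel \<kappa>" and "C11 \<kappa>" and "characteristic_kernel \<kappa>" and "translation_invariant \<kappa>"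
    and "is_rkhs (\<lambda>x y. \<kappa> (\<psi> x) (\<psi> y)) H ip"
    and "\<And>n. prob_space (Q n)" and "\<And>n. sets (Q n) = sets borel"
  shows "converges_weakly Q P \<longleftrightarrow> (\<lambda>n. KSD A g m D H ip p (Q n)) \<longlonglongrightarrow> 0"
proof -
  interpret smooth_manifold A by unfold_locales (rule assms(3))
  have p: "C1_fun p" using assms(12) by (intro Ck_manifold_imp_C1_fun[of s]) simp
  interpret prob: prob_space P by (rule assms(8))
  interpret ksd_setting A g vol \<psi> P p \<kappa> H ip
    by unfold_locales (rule assms p)+
  show ?thesis
    using KSD_tendsto_zero[of m D Q, OF assms(6,20,21)]
      converges_weakly_if_KSD_tendsto_zero[of m D Q, OF assms(6,7,2,17,18,20,21)] by blast
qed

end
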